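(* Let $L>0$ and let $\mu\in\mathcal{P}_1(\mathbb{R}^{dT})$ have $L$-Lipschitz kernels. Then there exists $\tilde C_L>0$ such that for all $\sigma>0$, $\mathcal{AW}_1(\mu,\mu\ast\mathcal{N}_\sigma)\le\tilde C_L\,\sigma$.
   Context: $d\ge1$ and $T\ge1$ are integers. Points of $\mathbb{R}^{dT}$ are paths $x=x_{1:T}=(x_1,\dots,x_T)$ with $x_t\in\mathbb{R}^d$; $x_{1:t}=(x_1,\dots,x_t)\in\mathbb{R}^{dt}$, and $\mathbb{R}^{dt}$ carries the norm $\|x_{1:t}\|=\sum_{s=1}^t\|x_s\|_{\mathbb{R}^d}$ (Euclidean norm on $\mathbb{R}^d$). $\mathcal{P}_1(\mathbb{R}^{dT})$ is the set of Borel probability measures with finite first moment. $\mu_{x_{1:t}}\in\mathcal{P}(\mathbb{R}^d)$ is the disintegration kernel of $\mu$ (conditional law of $x_{t+1}$ given $x_{1:t}$); analogously $\pi_{x_{1:t},y_{1:t}}$ is the conditional law of $(x_{t+1},y_{t+1})$ given $(x_{1:t},y_{1:t})$ under $\pi\in\mathcal{P}(\mathbb{R}^{dT}\times\mathbb{R}^{dT})$. $\mathrm{Cpl}(\mu,\nu)$ is the set of couplings of $\mu,\nu$. $\mathrm{Cpl}_{\mathrm{bc}}(\mu,\nu)$, the set of bi-causal couplings, consists of those $\pi\in\mathrm{Cpl}(\mu,\nu)$ with $\pi_{x_{1:t},y_{1:t}}\in\mathrm{Cpl}(\mu_{x_{1:t}},\nu_{y_{1:t}})$ for $\pi$-a.e.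 $(x,y)$ and all $t=1,\dots,T-1$. The adapted Wasserstein distance is $\mathcal{AW}_1(\mu,\nu)=\inf_{\pi\in\mathrm{Cpl}_{\mathrm{bc}}(\mu,\nu)}\int\|x-y\|\,\pi(dx,dy)$, and $\mathcal{W}_1$ is the usual first-order Wasserstein distance. $\mathcal{N}_\sigma=\mathcal{N}(\mathbf{0},\sigma^2\mathbf{I}_{dT})$ and $\ast$ is convolution of measures. $\mu$ has $L$-Lipschitz kernels if it admits a disintegration such that for all $t=1,\dots,T-1$ the map $x_{1:t}\mapsto\mu_{x_{1:t}}$ is $L$-Lipschitz, with $\mathcal{P}(\mathbb{R}^d)$ equipped with $\mathcal{W}_1$. *)

theory Defs
  imports "HOL-Probability.Probability"
begin

text \<open>A path \<open>x\<close> of length \<open>t\<close> in d-dimensional space is a function on \<open>{1..t}\<close>, extensional as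
  usual for product measures; the product sigma-algebra is the Borel one, the index set being
  finite.\<close>

definition path_space :: "nat \<Rightarrow> (nat \<Rightarrow> real ^ 'd) measure" where
  "path_space t = PiM {1..t} (\<lambda>_. borel)"

definition path_norm :: "nat \<Rightarrow> (nat \<Rightarrow> real ^ 'd) \<Rightarrow> real" where
  "path_norm t x = (\<Sum>s = 1..t. norm (x s))"

abbreviation path_prefix :: "nat \<Rightarrow> (nat \<Rightarrow> real ^ 'd) \<Rightarrow> nat \<Rightarrow> real ^ 'd" where
  "path_prefix t x \<equiv> restrict x {1..t}"

definition P1 :: "nat \<Rightarrow> (nat \<Rightarrow> real ^ 'd) measure set" where
  "P1 T = {\<mu>. prob_space \<mu> \<and> sets \<mu> = sets (path_space T) \<and> integrable \<mu> (path_norm T)}"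

text \<open>\<open>K\<close> is a regular version of the conditional law under \<open>M\<close> of the \<open>N\<close>-valued
  variable \<open>Y\<close> given the \<open>S\<close>-valued variable \<open>X\<close>.\<close>

definition cond_law ::
  "'w measure \<Rightarrow> 'a measure \<Rightarrow> ('w \<Rightarrow> 'a) \<Rightarrow> 'b measure \<Rightarrow> ('w \<Rightarrow> 'b) \<Rightarrow> ('a \<Rightarrow> 'b measure) \<Rightarrow> bool"
where
  "cond_law M S X N Y K \<longleftrightarrow>
     K \<in> S \<rightarrow>\<^sub>M prob_algebra N \<and>
     (\<forall>A\<in>sets S. \<forall>B\<in>sets N.
        emeasure M {w \<in> space M. X w \<in> A \<and> Y w \<in> B} =
        (\<integral>\<^sup>+ w. indicator A (X w) * emeasure (K (X w)) B \<partial>M))"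

definition path_kernel ::
  "nat \<Rightarrow> (nat \<Rightarrow> real ^ 'd) measure \<Rightarrow> ((nat \<Rightarrow> real ^ 'd) \<Rightarrow> (real ^ 'd) measure) \<Rightarrow> bool" where
  "path_kernel t \<mu> K \<longleftrightarrow> cond_law \<mu> (path_space t) (path_prefix t) borel (\<lambda>x. x (Suc t)) K"

definition pair_kernel ::
  "nat \<Rightarrow> ((nat \<Rightarrow> real ^ 'd) \<times> (nat \<Rightarrow> real ^ 'd)) measure \<Rightarrow>
   ((nat \<Rightarrow> real ^ 'd) \<times> (nat \<Rightarrow> real ^ 'd) \<Rightarrow> ((real ^ 'd) \<times> (real ^ 'd)) measure) \<Rightarrow> bool" where
  "pair_kernel t \<pi> K \<longleftrightarrow>
     cond_law \<pi> (path_space t \<Otimes>\<^sub>M path_space t) (\<lambda>(x, y). (path_prefix t x, path_prefix t y))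
       (borel \<Otimes>\<^sub>M borel) (\<lambda>(x, y). (x (Suc t), y (Suc t))) K"

definition couplings :: "'a measure \<Rightarrow> 'b measure \<Rightarrow> ('a \<times> 'b) measure set" where
  "couplings M N = {\<pi>. sets \<pi> = sets (M \<Otimes>\<^sub>M N) \<and> distr \<pi> M fst = M \<and> distr \<pi> N snd = N}"

text \<open>Conditional laws are unique up to null sets, so it does not matter which versions are
  chosen below.\<close>

definition bicausal_couplings ::
  "nat \<Rightarrow> (nat \<Rightarrow> real ^ 'd) measure \<Rightarrow> (nat \<Rightarrow> real ^ 'd) measure \<Rightarrow>
   ((nat \<Rightarrow> real ^ 'd) \<times> (nat \<Rightarrow> real ^ 'd)) measure set" where
  "bicausal_couplings T \<mu> \<nu> = {\<pi> \<in> couplings \<mu> \<nu>.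
     \<forall>t\<in>{1..<T}. \<exists>K\<mu> K\<nu> K\<pi>.
       path_kernel t \<mu> K\<mu> \<and> path_kernel t \<nu> K\<nu> \<and> pair_kernel t \<pi> K\<pi> \<and>
       (AE (x, y) in \<pi>.
          K\<pi> (path_prefix t x, path_prefix t y) \<in> couplings (K\<mu> (path_prefix t x)) (K\<nu> (path_prefix t y)))}"

text \<open>Both distances take values in the extended nonnegative reals.\<close>

definition W1 :: "(real ^ 'd) measure \<Rightarrow> (real ^ 'd) measure \<Rightarrow> ennreal" where
  "W1 M N = (INF \<pi>\<in>couplings M N. \<integral>\<^sup>+ (x, y). ennreal (norm (x - y)) \<partial>\<pi>)"

definition AW1 ::
  "nat \<Rightarrow> (nat \<Rightarrow> real ^ 'd) measure \<Rightarrow> (nat \<Rightarrow> real ^ 'd) measure \<Rightarrow> ennreal" where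
  "AW1 T \<mu> \<nu> =
     (INF \<pi>\<in>bicausal_couplings T \<mu> \<nu>. \<integral>\<^sup>+ (x, y). ennreal (path_norm T (\<lambda>s. x s - y s)) \<partial>\<pi>)"

definition lipschitz_kernels :: "nat \<Rightarrow> real \<Rightarrow> (nat \<Rightarrow> real ^ 'd) measure \<Rightarrow> bool" where
  "lipschitz_kernels T L \<mu> \<longleftrightarrow>
     (\<exists>K. \<forall>t\<in>{1..<T}. path_kernel t \<mu> (K t) \<and>
        (\<forall>x\<in>space (path_space t). \<forall>y\<in>space (path_space t).
           W1 (K t x) (K t y) \<le> ennreal (L * path_norm t (\<lambda>s. x s - y s))))"

text \<open>The centred normal law with covariance \<open>\<sigma>\<^sup>2 I\<close>: the covariance is diagonal, so the density with respect
  to Lebesgue measure is the product of the one-dimensional ones (\<open>\<sigma>\<close> is the standard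
  deviation in \<^const>\<open>normal_density\<close>).\<close>

definition gaussian :: "nat \<Rightarrow> real \<Rightarrow> (nat \<Rightarrow> real ^ 'd) measure" where
  "gaussian T \<sigma> = density (PiM {1..T} (\<lambda>_. lborel))
     (\<lambda>z. ennreal (\<Prod>t = 1..T. \<Prod>i\<in>UNIV. normal_density 0 \<sigma> (z t $ i)))"

text \<open>The library's \<^const>\<open>convolution\<close> needs addition on the whole type; here addition is
  that of \<open>path_space T\<close>.\<close>

definition path_convolution ::
  "nat \<Rightarrow> (nat \<Rightarrow> real ^ 'd) measure \<Rightarrow> (nat \<Rightarrow> real ^ 'd) measure \<Rightarrow> (nat \<Rightarrow> real ^ 'd) measure" where
  "path_convolution T \<mu> \<nu> =
     distr (\<mu> \<Otimes>\<^sub>M \<nu>) (path_space T) (\<lambda>(x, z). \<lambda>s\<in>{1..T}. x s + z s)"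

end

theory Submission
  imports Defs
begin

text \<open>Let \<open>X\<close> have law \<open>\<mu>\<close>, let \<open>Z\<close> be the independent Gaussian path, \<open>Y = X + Z\<close>, and let \<open>\<nu>\<close> be the law of \<open>Y\<close>.
  A bi-causal coupling of \<open>\<mu>\<close> and \<open>\<nu>\<close> is built one time step at a time. Given the past \<open>x\<close> of the first
  path and the past \<open>y\<close> of the second one, the next pair has to couple the conditional laws of \<open>\<mu>\<close> at \<open>x\<close>
  and of \<open>\<nu>\<close> at \<open>y\<close>. As the next noise value is independent of everything else, the conditional law of \<open>\<nu>\<close>
  at \<open>y\<close> is a mixture: draw \<open>x'\<close> from the posterior law of the past of \<open>X\<close> given that the past of \<open>Y\<close> is \<open>y\<close>,
  draw \<open>c\<close> from the kernel of \<open>\<mu>\<close> at \<open>x'\<close>, and add fresh noise \<open>z\<close> (\<open>path_kernel_noisy\<close>). So it suffices to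
  draw \<open>x'\<close> from the posterior at \<open>y\<close>, then \<open>(a, c)\<close> from a near-optimal coupling of the kernels of \<open>\<mu>\<close> at \<open>x\<close>
  and at \<open>x'\<close>, and to take the pair \<open>(a, c + z)\<close>.

  By the Lipschitz property the expected distance of this pair is at most
  \<open>L * |x - x'| + E |z|\<close> up to an arbitrarily small error, and \<open>|x - x'| \<le> |x - y| + |x' - y|\<close>. On average
  over \<open>y\<close> with law \<open>\<nu>\<close>, the pair \<open>(x', y)\<close> is distributed like the pasts of \<open>(X, Y)\<close>, so that the mean of
  \<open>|x' - y|\<close> is the mean norm of the past of \<open>Z\<close>. With mean noise at most \<open>c\<close> at each time, the cost \<open>a n\<close> of
  the first \<open>n\<close> steps therefore satisfies \<open>a (n + 1) \<le> (1 + L) * a n + L * n * c + 2 * c\<close>, where one \<open>c\<close> is the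
  slack for the near-optimal couplings (\<open>AW1_noisy_le\<close>). For Gaussian noise \<open>c\<close> may be taken as the dimension
  times \<open>\<sigma>\<close>.

  Two points need care. The posterior has to be an actual kernel; it is given by Bayes' formula, as the
  Gaussian density is positive and bounded (\<open>posterior_exists\<close>). And the near-optimal couplings have to
  depend measurably on \<open>(x, x')\<close> (\<open>measurable_coupling_selection\<close>). For this, the space is cut into countably
  many small cells, and a matrix with rational entries and finite support prescribes how much mass moves
  from cell to cell; inside a block the mass is spread like the product measure, and the remaining
  mass is coupled independently. This gives countably many candidates that depend measurably on the two
  marginals and contain a near-optimal one for each pair of marginals, so the first good candidate can
  be taken.\<close>

section \<open>Couplings that are constant on blocks\<close>

lemma measure_eq_nn_integralI:
  assumes sets: "sets M = sets N"
    and eq: "\<And>f. f \<in> borel_measurable N \<Longrightarrow> (\<integral>\<^sup>+x. f x \<partial>M) = (\<integral>\<^sup>+x. f x \<partial>N)"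
  shows "M = N"
proof (rule measure_eqI[OF sets])
  fix A assume "A \<in> sets M"
  then show "emeasure M A = emeasure N A"
    using eq[of "indicator A"] sets by simp
qed

lemma couplings_nn_integral_fst:
  assumes "\<pi> \<in> couplings M N" and [measurable]: "f \<in> borel_measurable M"
  shows "(\<integral>\<^sup>+w. f (fst w) \<partial>\<pi>) = (\<integral>\<^sup>+x. f x \<partial>M)"
proof -
  have [measurable_cong]: "sets \<pi> = sets (M \<Otimes>\<^sub>M N)" and eq: "distr \<pi> M fst = M"
    using assms(1) by (auto simp: couplings_def)
  show ?thesis by (subst eq[symmetric], subst nn_integral_distr) auto
qed

lemma couplings_nn_integral_snd:
  assumes "\<pi> \<in> couplings M N" and [measurable]: "f \<in> borel_measurable N"
  shows "(\<integral>\<^sup>+w. f (snd w) \<partial>\<pi>) = (\<integral>\<^sup>+x. f x \<partial>N)"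
proof -
  have [measurable_cong]: "sets \<pi> = sets (M \<Otimes>\<^sub>M N)" and eq: "distr \<pi> N snd = N"
    using assms(1) by (auto simp: couplings_def)
  show ?thesis by (subst eq[symmetric], subst nn_integral_distr) auto
qed

lemma couplingsI_nn_integral:
  assumes sets: "sets \<pi> = sets (M \<Otimes>\<^sub>M N)"
    and 1: "\<And>f. f \<in> borel_measurable M \<Longrightarrow> (\<integral>\<^sup>+w. f (fst w) \<partial>\<pi>) = (\<integral>\<^sup>+x. f x \<partial>M)"
    and 2: "\<And>f. f \<in> borel_measurable N \<Longrightarrow> (\<integral>\<^sup>+w. f (snd w) \<partial>\<pi>) = (\<integral>\<^sup>+x. f x \<partial>N)"
  shows "\<pi> \<in> couplings M N"
proof -
  note [measurable_cong] = sets
  have "distr \<pi> M fst = M"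
    by (rule measure_eq_nn_integralI) (simp_all add: nn_integral_distr 1)
  moreover have "distr \<pi> N snd = N"
    by (rule measure_eq_nn_integralI) (simp_all add: nn_integral_distr 2)
  ultimately show ?thesis using sets by (simp add: couplings_def)
qed

lemma density_couplings:
  fixes m :: "'a measure" and n :: "'b measure" and f :: "'a \<Rightarrow> 'b \<Rightarrow> real"
  assumes "prob_space m" "prob_space n"
    and [measurable]: "case_prod f \<in> borel_measurable (m \<Otimes>\<^sub>M n)"
    and row: "AE a in m. (\<integral>\<^sup>+b. ennreal (f a b) \<partial>n) = 1"
    and col: "AE b in n. (\<integral>\<^sup>+a. ennreal (f a b) \<partial>m) = 1"
  shows "density (m \<Otimes>\<^sub>M n) (\<lambda>(a, b). ennreal (f a b)) \<in> couplings m n"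
proof (rule couplingsI_nn_integral)
  interpret m: prob_space m by fact
  interpret n: prob_space n by fact
  interpret pair_sigma_finite m n ..
  let ?g = "density (m \<Otimes>\<^sub>M n) (\<lambda>(a, b). ennreal (f a b))"
  show "(\<integral>\<^sup>+w. u (fst w) \<partial>?g) = (\<integral>\<^sup>+a. u a \<partial>m)" if [measurable]: "u \<in> borel_measurable m" for u
  proof -
    have "(\<integral>\<^sup>+w. u (fst w) \<partial>?g) = (\<integral>\<^sup>+a. \<integral>\<^sup>+b. ennreal (f a b) * u a \<partial>n \<partial>m)"
      by (simp add: nn_integral_density n.nn_integral_fst[symmetric] split_beta')
    also have "\<dots> = (\<integral>\<^sup>+a. (\<integral>\<^sup>+b. ennreal (f a b) \<partial>n) * u a \<partial>m)"
      by (intro nn_integral_cong nn_integral_multc) simp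
    also have "\<dots> = (\<integral>\<^sup>+a. u a \<partial>m)"
      by (rule nn_integral_cong_AE) (use row in eventually_elim, simp)
    finally show ?thesis .
  qed
  show "(\<integral>\<^sup>+w. u (snd w) \<partial>?g) = (\<integral>\<^sup>+b. u b \<partial>n)" if [measurable]: "u \<in> borel_measurable n" for u
  proof -
    have "(\<integral>\<^sup>+w. u (snd w) \<partial>?g) = (\<integral>\<^sup>+b. \<integral>\<^sup>+a. ennreal (f a b) * u b \<partial>m \<partial>n)"
      by (simp add: nn_integral_density nn_integral_snd[symmetric] split_beta')
    also have "\<dots> = (\<integral>\<^sup>+b. (\<integral>\<^sup>+a. ennreal (f a b) \<partial>m) * u b \<partial>n)"
      by (intro nn_integral_cong nn_integral_multc) simp
    also have "\<dots> = (\<integral>\<^sup>+b. u b \<partial>n)"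
      by (rule nn_integral_cong_AE) (use col in eventually_elim, simp)
    finally show ?thesis .
  qed
qed simp

lemma prob_borel_space:
  assumes "sets m = sets (borel :: 'a::topological_space measure)"
  shows "space m = UNIV"
  using sets_eq_imp_space_eq[OF assms] by simp

text \<open>The cells \<open>idx -` {i}\<close> partition the space, and \<open>r\<close> is a matrix of which only the first
  \<open>N\<close> rows and columns count. The value \<open>row_excess m idx N r i\<close> is the fraction of the \<open>m\<close>-mass of cell \<open>i\<close> that
  the row sum of \<open>r\<close> leaves unused. Column sums are handled by passing the transpose of \<open>r\<close>.\<close>

definition row_excess :: "'a measure \<Rightarrow> ('a \<Rightarrow> nat) \<Rightarrow> nat \<Rightarrow> (nat \<Rightarrow> nat \<Rightarrow> real) \<Rightarrow> nat \<Rightarrow> real" where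
  "row_excess m idx N r i = 1 - (\<Sum>k<N. (\<Sum>j<N. r k j) / measure m (idx -` {k}) * of_bool (i = k))"

text \<open>A density with respect to the product of \<open>m\<close> and \<open>n\<close>. It moves mass \<open>r i j\<close> from cell \<open>i\<close> to cell
  \<open>j\<close>, spread like the product measure inside the block, and couples the mass left over on both
  sides independently. A cell of mass zero divides by zero, which yields \<open>0\<close>; such cells carry no
  mass of a sub-coupling.\<close>

definition block_density ::
  "('a \<Rightarrow> nat) \<Rightarrow> nat \<Rightarrow> (nat \<Rightarrow> nat \<Rightarrow> real) \<Rightarrow> 'a measure \<Rightarrow> 'a measure \<Rightarrow> 'a \<Rightarrow> 'a \<Rightarrow> real" where
  "block_density idx N r m n a b =
     (\<Sum>i<N. \<Sum>j<N. r i j / (measure m (idx -` {i}) * measure n (idx -` {j})) * of_bool (idx a = i) * of_bool (idx b = j)) +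
     row_excess m idx N r (idx a) * row_excess n idx N (\<lambda>i j. r j i) (idx b) / (1 - (\<Sum>i<N. \<Sum>j<N. r i j))"

text \<open>The matrix \<open>r\<close> is dominated by the cell masses of \<open>m\<close> and \<open>n\<close>. The total mass is required to be
  strictly below one so that the left-over part can be normalised.\<close>

definition subcoupling ::
  "('a \<Rightarrow> nat) \<Rightarrow> nat \<Rightarrow> (nat \<Rightarrow> nat \<Rightarrow> real) \<Rightarrow> 'a measure \<Rightarrow> 'a measure \<Rightarrow> bool" where
  "subcoupling idx N r m n \<longleftrightarrow>
     (\<forall>i<N. \<forall>j<N. 0 \<le> r i j) \<and>
     (\<forall>i<N. (\<Sum>j<N. r i j) \<le> measure m (idx -` {i})) \<and>
     (\<forall>j<N. (\<Sum>i<N. r i j) \<le> measure n (idx -` {j})) \<and>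
     (\<Sum>i<N. \<Sum>j<N. r i j) < 1"

lemma subcoupling_swap: "subcoupling idx N r m n \<Longrightarrow> subcoupling idx N (\<lambda>i j. r j i) n m"
  unfolding subcoupling_def using sum.swap[of r "{..<N}" "{..<N}"] by auto

lemma row_excess_alt:
  "row_excess m idx N r i = (if i < N then 1 - (\<Sum>j<N. r i j) / measure m (idx -` {i}) else 1)"
proof -
  have "(\<Sum>k<N. (\<Sum>j<N. r k j) / measure m (idx -` {k}) * of_bool (i = k)) =
      (\<Sum>k<N. if k = i then (\<Sum>j<N. r i j) / measure m (idx -` {i}) else 0)"
    by (intro sum.cong) auto
  then show ?thesis by (simp add: row_excess_def)
qed

lemma row_excess_nonneg:
  assumes "subcoupling idx N r m n"
  shows "0 \<le> row_excess m idx N r i"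
  using assms by (auto simp: row_excess_alt subcoupling_def divide_le_eq_1 less_le)

lemma integral_row_excess:
  fixes m :: "'a::topological_space measure" and g :: "nat \<Rightarrow> real"
  assumes "prob_space m" and [simp, measurable_cong]: "sets m = sets borel"
    and [measurable]: "idx \<in> borel \<rightarrow>\<^sub>M count_space UNIV"
    and sub: "subcoupling idx N r m n" and int: "integrable m (\<lambda>a. g (idx a))"
  shows "has_bochner_integral m (\<lambda>a. g (idx a) * row_excess m idx N r (idx a))
     ((\<integral>a. g (idx a) \<partial>m) - (\<Sum>i<N. \<Sum>j<N. g i * r i j))"
proof -
  interpret prob_space m by fact
  have [simp]: "space m = UNIV" by (rule prob_borel_space) simp
  let ?p = "\<lambda>k. measure m (idx -` {k})"
  have [measurable]: "idx -` {k} \<in> sets borel" for k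
    using measurable_sets[of idx borel "count_space UNIV" "{k}"] by simp
  have ind: "has_bochner_integral m (\<lambda>a. g k * (\<Sum>j<N. r k j) / ?p k * indicator (idx -` {k}) a)
      (\<Sum>j<N. g k * r k j)" if "k < N" for k
  proof -
    have "0 \<le> (\<Sum>j<N. r k j)" "(\<Sum>j<N. r k j) \<le> ?p k"
      using sub that by (auto simp: subcoupling_def intro: sum_nonneg)
    then have eq: "g k * (\<Sum>j<N. r k j) / ?p k * ?p k = (\<Sum>j<N. g k * r k j)"
      by (cases "?p k = 0") (auto simp: sum_distrib_left[symmetric])
    have "has_bochner_integral m (\<lambda>a. g k * (\<Sum>j<N. r k j) / ?p k * indicator (idx -` {k}) a)
      (g k * (\<Sum>j<N. r k j) / ?p k * ?p k)"
      by (intro has_bochner_integral_mult_right has_bochner_integral_real_indicator) (auto simp: less_top[symmetric])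
    then show ?thesis unfolding eq .
  qed
  have "has_bochner_integral m (\<lambda>a. g (idx a) -
      (\<Sum>k<N. g k * (\<Sum>j<N. r k j) / ?p k * indicator (idx -` {k}) a))
      ((\<integral>a. g (idx a) \<partial>m) - (\<Sum>i<N. \<Sum>j<N. g i * r i j))"
    using int by (intro has_bochner_integral_diff has_bochner_integral_sum ind has_bochner_integral_integrable) auto
  also have "(\<lambda>a. g (idx a) - (\<Sum>k<N. g k * (\<Sum>j<N. r k j) / ?p k * indicator (idx -` {k}) a)) =
     (\<lambda>a. g (idx a) * row_excess m idx N r (idx a))"
    by (auto simp: fun_eq_iff row_excess_def right_diff_distrib sum_distrib_left indicator_def of_bool_def intro!: sum.cong)
  finally show ?thesis .
qed

lemma block_density_measurable [measurable]:
  fixes m n :: "'a::topological_space measure"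
  assumes [measurable]: "idx \<in> borel \<rightarrow>\<^sub>M count_space UNIV"
  shows "(\<lambda>(a, b). block_density idx N r m n a b) \<in> borel_measurable (borel \<Otimes>\<^sub>M borel)"
proof -
  have [measurable]: "row_excess m idx N r \<in> borel_measurable (count_space UNIV)" for m r
    by simp
  show ?thesis unfolding block_density_def by measurable
qed

lemma block_density_nonneg:
  assumes "subcoupling idx N r m n"
  shows "0 \<le> block_density idx N r m n a b"
  unfolding block_density_def
  using assms row_excess_nonneg[OF assms] row_excess_nonneg[OF subcoupling_swap[OF assms]]
  by (intro add_nonneg_nonneg sum_nonneg divide_nonneg_nonneg mult_nonneg_nonneg) (auto simp: subcoupling_def)

lemma block_density_swap:
  "block_density idx N r m n a b = block_density idx N (\<lambda>i j. r j i) n m b a"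
proof -
  have "(\<Sum>i<N. \<Sum>j<N. r i j) = (\<Sum>i<N. \<Sum>j<N. r j i)" by (rule sum.swap)
  moreover have "(\<Sum>i<N. \<Sum>j<N. r i j / (measure m (idx -` {i}) * measure n (idx -` {j})) * of_bool (idx a = i) * of_bool (idx b = j)) =
    (\<Sum>i<N. \<Sum>j<N. r j i / (measure n (idx -` {i}) * measure m (idx -` {j})) * of_bool (idx b = i) * of_bool (idx a = j) :: real)"
    by (subst sum.swap) (auto intro!: sum.cong simp: mult_ac)
  ultimately show ?thesis
    by (simp add: block_density_def mult_ac)
qed

lemma block_density_row:
  fixes m n :: "'a::topological_space measure"
  assumes "prob_space m" and m[simp, measurable_cong]: "sets m = sets borel"
    and "prob_space n" and n[simp, measurable_cong]: "sets n = sets borel"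
    and [measurable]: "idx \<in> borel \<rightarrow>\<^sub>M count_space UNIV"
    and sub: "subcoupling idx N r m n"
  shows "AE a in m. (\<integral>\<^sup>+b. ennreal (block_density idx N r m n a b) \<partial>n) = 1"
proof -
  interpret m: prob_space m by fact
  interpret n: prob_space n by fact
  have [simp]: "space m = UNIV" "space n = UNIV" by (simp_all add: prob_borel_space)
  let ?p = "\<lambda>k. measure m (idx -` {k})" and ?q = "\<lambda>k. measure n (idx -` {k})"
  let ?s = "\<Sum>i<N. \<Sum>j<N. r i j"
  let ?v = "row_excess n idx N (\<lambda>i j. r j i)"
  have [measurable]: "idx -` {k} \<in> sets borel" for k
    using measurable_sets[of idx borel "count_space UNIV" "{k}"] by simp
  have V: "has_bochner_integral n (\<lambda>b. ?v (idx b)) (1 - ?s)"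
    using integral_row_excess[OF \<open>prob_space n\<close> n \<open>idx \<in> _\<close> subcoupling_swap[OF sub], of "\<lambda>_. 1"]
    using n.prob_space sum.swap[of r "{..<N}" "{..<N}"] by simp
  have s: "?s < 1" using sub by (simp add: subcoupling_def)
  have null: "AE a in m. ?p (idx a) \<noteq> 0"
  proof -
    have "AE a in m. ?p i = 0 \<longrightarrow> idx a \<noteq> i" for i
    proof (cases "?p i = 0")
      case True
      then have "idx -` {i} \<in> null_sets m" by (auto intro!: null_setsI simp: m.emeasure_eq_measure)
      then show ?thesis by (intro AE_I'[of "idx -` {i}"]) auto
    qed simp
    then have "AE a in m. \<forall>i. ?p i = 0 \<longrightarrow> idx a \<noteq> i" by (simp add: AE_all_countable)
    then show ?thesis by eventually_elim auto
  qed
  have int: "has_bochner_integral n (\<lambda>b. block_density idx N r m n a b)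
     ((\<Sum>i<N. \<Sum>j<N. r i j / (?p i * ?q j) * of_bool (idx a = i) * ?q j) +
      row_excess m idx N r (idx a) / (1 - ?s) * (1 - ?s))" for a
  proof -
    have "has_bochner_integral n (\<lambda>b. (\<Sum>i<N. \<Sum>j<N. r i j / (?p i * ?q j) * of_bool (idx a = i) * indicator (idx -` {j}) b) +
       row_excess m idx N r (idx a) / (1 - ?s) * ?v (idx b))
     ((\<Sum>i<N. \<Sum>j<N. r i j / (?p i * ?q j) * of_bool (idx a = i) * ?q j) +
      row_excess m idx N r (idx a) / (1 - ?s) * (1 - ?s))"
      by (intro has_bochner_integral_add has_bochner_integral_sum has_bochner_integral_mult_right
            has_bochner_integral_real_indicator V) (auto simp: less_top[symmetric])
    then show ?thesis
      by (simp add: block_density_def indicator_def of_bool_def)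
  qed
  show ?thesis
    using null
  proof eventually_elim
    fix a assume a: "?p (idx a) \<noteq> 0"
    have q: "r i j / (?p i * ?q j) * of_bool (idx a = i) * ?q j = r i j / ?p i * of_bool (idx a = i)"
      if "i < N" "j < N" for i j
    proof (cases "?q j = 0")
      case True
      have "r i j \<le> (\<Sum>i<N. r i j)"
        using sub that by (intro member_le_sum) (auto simp: subcoupling_def)
      also have "\<dots> \<le> 0" using sub that True by (force simp: subcoupling_def)
      finally have "r i j = 0" using sub that by (force simp: subcoupling_def)
      then show ?thesis by simp
    qed simp
    have "(\<Sum>i<N. \<Sum>j<N. r i j / (?p i * ?q j) * of_bool (idx a = i) * ?q j) =
        (\<Sum>i<N. \<Sum>j<N. r i j / ?p i * of_bool (idx a = i))"
      by (intro sum.cong refl q) auto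
    also have "\<dots> = (\<Sum>i<N. (\<Sum>j<N. r i j) / ?p i * of_bool (idx a = i))"
      by (simp only: sum_distrib_right sum_divide_distrib)
    also have "\<dots> + row_excess m idx N r (idx a) / (1 - ?s) * (1 - ?s) = 1"
      using s by (simp add: row_excess_def)
    finally have "has_bochner_integral n (\<lambda>b. block_density idx N r m n a b) 1"
      using int[of a] by simp
    then show "(\<integral>\<^sup>+b. ennreal (block_density idx N r m n a b) \<partial>n) = 1"
      by (subst nn_integral_eq_integral)
         (auto simp: has_bochner_integral_iff block_density_nonneg[OF sub])
  qed
qed

lemma block_coupling:
  fixes m n :: "'a::second_countable_topology measure"
  assumes m: "prob_space m" "sets m = sets borel"
    and n: "prob_space n" "sets n = sets borel"
    and idx: "idx \<in> borel \<rightarrow>\<^sub>M count_space UNIV"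
    and sub: "subcoupling idx N r m n"
  shows "density (m \<Otimes>\<^sub>M n) (\<lambda>(a, b). ennreal (block_density idx N r m n a b)) \<in> couplings m n"
proof (rule density_couplings)
  note [measurable_cong] = m(2) n(2) and [measurable] = idx
  show "case_prod (block_density idx N r m n) \<in> borel_measurable (m \<Otimes>\<^sub>M n)"
    by measurable
  show "AE a in m. (\<integral>\<^sup>+b. ennreal (block_density idx N r m n a b) \<partial>n) = 1"
    by (rule block_density_row) fact+
  show "AE b in n. (\<integral>\<^sup>+a. ennreal (block_density idx N r m n a b) \<partial>m) = 1"
    by (subst block_density_swap, rule block_density_row) (fact | rule subcoupling_swap)+
qed fact+

text \<open>An upper bound for the cost of the block coupling of \<open>r\<close>. The blocks are charged the distance of the
  cell centres \<open>h\<close>, the left-over mass is charged its distance to the origin on either side, and \<open>\<delta>\<close>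
  bounds the radius of the cells.\<close>

definition block_cost ::
  "('a \<Rightarrow> nat) \<Rightarrow> (nat \<Rightarrow> 'a::real_normed_vector) \<Rightarrow> real \<Rightarrow> nat \<Rightarrow> (nat \<Rightarrow> nat \<Rightarrow> real) \<Rightarrow> 'a measure \<Rightarrow> 'a measure \<Rightarrow> real"
where
  "block_cost idx h \<delta> N r m n =
     (\<Sum>i<N. \<Sum>j<N. r i j * (norm (h i - h j) + 2 * \<delta>)) +
     ((\<integral>a. norm (h (idx a)) + \<delta> \<partial>m) - (\<Sum>i<N. \<Sum>j<N. (norm (h i) + \<delta>) * r i j)) +
     ((\<integral>a. norm (h (idx a)) + \<delta> \<partial>n) - (\<Sum>i<N. \<Sum>j<N. (norm (h j) + \<delta>) * r i j))"

lemma block_coupling_cost: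
  fixes m n :: "'a::{real_normed_vector, second_countable_topology} measure" and h :: "nat \<Rightarrow> 'a"
  assumes m: "prob_space m" "sets m = sets borel"
    and n: "prob_space n" "sets n = sets borel"
    and idx: "idx \<in> borel \<rightarrow>\<^sub>M count_space UNIV"
    and sub: "subcoupling idx N r m n"
    and h: "\<And>a. norm (a - h (idx a)) \<le> \<delta>"
    and Hm: "integrable m (\<lambda>a. norm (h (idx a)) + \<delta>)"
    and Hn: "integrable n (\<lambda>a. norm (h (idx a)) + \<delta>)"
  shows "(\<integral>\<^sup>+(a, b). ennreal (norm (a - b)) \<partial>density (m \<Otimes>\<^sub>M n) (\<lambda>(a, b). ennreal (block_density idx N r m n a b)))
    \<le> ennreal (block_cost idx h \<delta> N r m n)"
proof -
  interpret m: prob_space m by fact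
  interpret n: prob_space n by fact
  note [simp, measurable_cong] = m(2) n(2) and [measurable] = idx
  have [simp]: "space m = UNIV" "space n = UNIV" by (simp_all add: prob_borel_space)
  let ?p = "\<lambda>k. measure m (idx -` {k})" and ?q = "\<lambda>k. measure n (idx -` {k})"
  have [measurable]: "idx -` {k} \<in> sets borel" for k
    using measurable_sets[of idx borel "count_space UNIV" "{k}"] by simp
  have \<delta>: "0 \<le> \<delta>" using order_trans[OF norm_ge_zero h] .
  define H where "H i = norm (h i) + \<delta>" for i
  define D where "D i j = norm (h i - h j) + 2 * \<delta>" for i j
  define s where "s = (\<Sum>i<N. \<Sum>j<N. r i j)"
  define w where "w = row_excess m idx N r"
  define v where "v = row_excess n idx N (\<lambda>i j. r j i)"
  have s: "s < 1" using sub by (simp add: subcoupling_def s_def)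
  have r: "0 \<le> r i j" if "i < N" "j < N" for i j using sub that by (simp add: subcoupling_def)
  have nn[simp]: "0 \<le> H i" "0 \<le> D i j" "0 \<le> w i" "0 \<le> v i" for i j
    using \<delta> row_excess_nonneg[OF sub] row_excess_nonneg[OF subcoupling_swap[OF sub]]
    by (auto simp: H_def D_def w_def v_def)
  define W where "W = (\<integral>a. H (idx a) \<partial>m) - (\<Sum>i<N. \<Sum>j<N. H i * r i j)"
  define V where "V = (\<integral>a. H (idx a) \<partial>n) - (\<Sum>i<N. \<Sum>j<N. H j * r i j)"
  have w1: "has_bochner_integral m (\<lambda>a. w (idx a)) (1 - s)"
    using integral_row_excess[OF m idx sub, of "\<lambda>_. 1"] m.prob_space by (simp add: w_def s_def)
  have v1: "has_bochner_integral n (\<lambda>a. v (idx a)) (1 - s)"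
    using integral_row_excess[OF n idx subcoupling_swap[OF sub], of "\<lambda>_. 1"] n.prob_space
      sum.swap[of r "{..<N}" "{..<N}"]
    by (simp add: v_def s_def)
  have wH: "has_bochner_integral m (\<lambda>a. H (idx a) * w (idx a)) W"
    using integral_row_excess[OF m idx sub Hm] by (simp add: w_def W_def H_def)
  have vH: "has_bochner_integral n (\<lambda>a. H (idx a) * v (idx a)) V"
    using integral_row_excess[OF n idx subcoupling_swap[OF sub] Hn]
      sum.swap[of "\<lambda>i j. H i * r j i" "{..<N}" "{..<N}"]
    by (simp add: v_def V_def H_def)
  define F where "F a b = (\<Sum>i<N. \<Sum>j<N. r i j / (?p i * ?q j) * D i j * indicator (idx -` {i}) a * indicator (idx -` {j}) b)
      + (H (idx a) * w (idx a) / (1 - s) * v (idx b) + w (idx a) / (1 - s) * (H (idx b) * v (idx b)))" for a b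
  define G where "G a = (\<Sum>i<N. \<Sum>j<N. r i j / (?p i * ?q j) * D i j * ?q j * indicator (idx -` {i}) a)
      + (H (idx a) * w (idx a) + V / (1 - s) * w (idx a))" for a
  have F_nn: "0 \<le> F a b" for a b
    unfolding F_def using s r
    by (intro add_nonneg_nonneg sum_nonneg mult_nonneg_nonneg divide_nonneg_nonneg) auto
  have V_nn: "0 \<le> V" using vH
    by (auto simp: has_bochner_integral_iff intro!: integral_nonneg_AE)
  have G_nn: "0 \<le> G a" for a
    unfolding G_def using s r V_nn
    by (intro add_nonneg_nonneg sum_nonneg mult_nonneg_nonneg divide_nonneg_nonneg) auto
  have FG: "has_bochner_integral n (F a) (G a)" for a
  proof -
    have "has_bochner_integral n (\<lambda>b. (\<Sum>i<N. \<Sum>j<N. (r i j / (?p i * ?q j) * D i j * indicator (idx -` {i}) a) * indicator (idx -` {j}) b)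
      + (H (idx a) * w (idx a) / (1 - s) * v (idx b) + w (idx a) / (1 - s) * (H (idx b) * v (idx b))))
      ((\<Sum>i<N. \<Sum>j<N. (r i j / (?p i * ?q j) * D i j * indicator (idx -` {i}) a) * ?q j)
      + (H (idx a) * w (idx a) / (1 - s) * (1 - s) + w (idx a) / (1 - s) * V))"
      by (intro has_bochner_integral_add has_bochner_integral_sum has_bochner_integral_mult_right
            has_bochner_integral_real_indicator v1 vH) (auto simp: less_top[symmetric])
    moreover have "(\<Sum>i<N. \<Sum>j<N. (r i j / (?p i * ?q j) * D i j * indicator (idx -` {i}) a) * ?q j)
      + (H (idx a) * w (idx a) / (1 - s) * (1 - s) + w (idx a) / (1 - s) * V) = G a"
    proof -
      have "(\<Sum>i<N. \<Sum>j<N. (r i j / (?p i * ?q j) * D i j * indicator (idx -` {i}) a) * ?q j) =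
        (\<Sum>i<N. \<Sum>j<N. r i j / (?p i * ?q j) * D i j * ?q j * indicator (idx -` {i}) a)"
        by (intro sum.cong refl) (simp only: mult_ac)
      then show ?thesis using s by (simp add: G_def)
    qed
    ultimately show ?thesis by (simp add: F_def[abs_def])
  qed
  have G: "has_bochner_integral m G ((\<Sum>i<N. \<Sum>j<N. r i j / (?p i * ?q j) * D i j * ?q j * ?p i) + (W + V / (1 - s) * (1 - s)))"
    unfolding G_def
    by (intro has_bochner_integral_add has_bochner_integral_sum has_bochner_integral_mult_right
            has_bochner_integral_real_indicator w1 wH) (auto simp: less_top[symmetric])
  \<comment> \<open>the matrix part of the density uses the bound by the centres \<open>D\<close>, the left-over part the bound by \<open>H\<close>\<close>
  have ptw: "norm (a - b) * block_density idx N r m n a b \<le> F a b" for a b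
  proof -
    have h': "norm (h (idx a) - a) \<le> \<delta>" for a using h by (simp add: norm_minus_commute)
    have 1: "norm (a - b) \<le> D (idx a) (idx b)"
    proof -
      have "norm (a - b) \<le> norm (a - h (idx a)) + norm (h (idx a) - h (idx b)) + norm (h (idx b) - b)"
        by norm
      with h[of a] h'[of b] show ?thesis by (simp add: D_def)
    qed
    have 2: "norm (a - b) \<le> H (idx a) + H (idx b)"
    proof -
      have "norm (a - b) \<le> norm (a - h (idx a)) + norm (h (idx a)) + norm (h (idx b)) + norm (h (idx b) - b)"
        by norm
      with h[of a] h'[of b] show ?thesis by (simp add: H_def)
    qed
    let ?B = "\<Sum>i<N. \<Sum>j<N. r i j / (?p i * ?q j) * of_bool (idx a = i) * of_bool (idx b = j)"
    have "norm (a - b) * ?B \<le> D (idx a) (idx b) * ?B"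
      using 1 r by (intro mult_right_mono sum_nonneg) auto
    also have "\<dots> = (\<Sum>i<N. \<Sum>j<N. r i j / (?p i * ?q j) * D i j * indicator (idx -` {i}) a * indicator (idx -` {j}) b)"
      by (simp add: sum_distrib_left) (auto intro!: sum.cong simp: indicator_def)
    moreover have "norm (a - b) * (w (idx a) * v (idx b) / (1 - s)) \<le> (H (idx a) + H (idx b)) * (w (idx a) * v (idx b) / (1 - s))"
      using 2 s by (intro mult_right_mono) auto
    moreover have "(H (idx a) + H (idx b)) * (w (idx a) * v (idx b) / (1 - s)) =
       H (idx a) * w (idx a) / (1 - s) * v (idx b) + w (idx a) / (1 - s) * (H (idx b) * v (idx b))"
      by (simp add: distrib_left distrib_right add_divide_distrib mult_ac)
    moreover have "norm (a - b) * block_density idx N r m n a b = norm (a - b) * ?B + norm (a - b) * (w (idx a) * v (idx b) / (1 - s))"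
      unfolding block_density_def w_def v_def s_def by (simp add: distrib_left)
    ultimately show ?thesis
      unfolding F_def by linarith
  qed
  have le: "r i j / (?p i * ?q j) * D i j * ?q j * ?p i \<le> r i j * D i j" if "i < N" "j < N" for i j
    using r[OF that] by (cases "?p i = 0 \<or> ?q j = 0") auto
  have "(\<integral>\<^sup>+(a, b). ennreal (norm (a - b)) \<partial>density (m \<Otimes>\<^sub>M n) (\<lambda>(a, b). ennreal (block_density idx N r m n a b)))
     = (\<integral>\<^sup>+z. ennreal (norm (fst z - snd z)) * ennreal (block_density idx N r m n (fst z) (snd z)) \<partial>(m \<Otimes>\<^sub>M n))"
    by (subst nn_integral_density) (auto simp: split_beta' mult_ac)
  also have "\<dots> = (\<integral>\<^sup>+a. \<integral>\<^sup>+b. ennreal (norm (a - b)) * ennreal (block_density idx N r m n a b) \<partial>n \<partial>m)"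
    by (subst n.nn_integral_fst[symmetric]) auto
  also have "\<dots> \<le> (\<integral>\<^sup>+a. \<integral>\<^sup>+b. ennreal (F a b) \<partial>n \<partial>m)"
    by (intro nn_integral_mono) (auto simp: ennreal_mult'[symmetric] intro!: ennreal_leI ptw)
  also have "\<dots> = (\<integral>\<^sup>+a. ennreal (G a) \<partial>m)"
    using FG F_nn by (intro nn_integral_cong) (auto simp: nn_integral_eq_integral has_bochner_integral_iff)
  also have "\<dots> = ennreal ((\<Sum>i<N. \<Sum>j<N. r i j / (?p i * ?q j) * D i j * ?q j * ?p i) + (W + V / (1 - s) * (1 - s)))"
    using G G_nn by (auto simp: nn_integral_eq_integral has_bochner_integral_iff)
  also have "\<dots> \<le> ennreal ((\<Sum>i<N. \<Sum>j<N. r i j * D i j) + W + V)"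
  proof (rule ennreal_leI)
    have "V / (1 - s) * (1 - s) = V" using s by simp
    moreover have "(\<Sum>i<N. \<Sum>j<N. r i j / (?p i * ?q j) * D i j * ?q j * ?p i) \<le> (\<Sum>i<N. \<Sum>j<N. r i j * D i j)"
      by (intro sum_mono le) auto
    ultimately show "(\<Sum>i<N. \<Sum>j<N. r i j / (?p i * ?q j) * D i j * ?q j * ?p i) + (W + V / (1 - s) * (1 - s)) \<le>
        (\<Sum>i<N. \<Sum>j<N. r i j * D i j) + W + V" by linarith
  qed
  finally show ?thesis
    by (simp add: block_cost_def W_def V_def D_def H_def)
qed

text \<open>For marginals of finite first moment, every coupling of finite cost is approximated by a rational sub-coupling matrix: its block masses
  on a large finite square, rounded down to rationals, lose little cost and leave little mass times
  distance to the origin.\<close>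

lemma rational_subcoupling_exists:
  fixes m n :: "'a::{real_normed_vector, second_countable_topology} measure" and h :: "nat \<Rightarrow> 'a"
  assumes m: "prob_space m" "sets m = sets borel"
    and n: "prob_space n" "sets n = sets borel"
    and idx: "idx \<in> borel \<rightarrow>\<^sub>M count_space UNIV"
    and h: "\<And>a. norm (a - h (idx a)) \<le> \<delta>"
    and Hm: "integrable m (\<lambda>a. norm (h (idx a)) + \<delta>)"
    and Hn: "integrable n (\<lambda>a. norm (h (idx a)) + \<delta>)"
    and \<pi>: "\<pi> \<in> couplings m n"
    and cost: "(\<integral>\<^sup>+(a, b). ennreal (norm (a - b)) \<partial>\<pi>) \<le> ennreal c" "0 \<le> c"
    and \<epsilon>: "4 * \<delta> < \<epsilon>"
  shows "\<exists>N r. range (case_prod r) \<subseteq> \<rat> \<and> subcoupling idx N r m n \<and>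
     block_cost idx h \<delta> N r m n \<le> c + \<epsilon>"
proof -
  interpret m: prob_space m by fact
  interpret n: prob_space n by fact
  note [simp, measurable_cong] = m(2) n(2) and [measurable] = idx
  have [simp]: "space m = UNIV" "space n = UNIV" by (simp_all add: prob_borel_space)
  have \<pi>_sets[simp, measurable_cong]: "sets \<pi> = sets (borel \<Otimes>\<^sub>M borel)"
    and \<pi>_m: "distr \<pi> m fst = m" and \<pi>_n: "distr \<pi> n snd = n"
    using \<pi> sets_pair_measure_cong[OF m(2) n(2)] by (auto simp: couplings_def)
  have [simp]: "space \<pi> = UNIV"
    using sets_eq_imp_space_eq[OF \<pi>_sets] by (simp add: space_pair_measure)
  interpret prob_space \<pi>
  proof
    have "emeasure m UNIV = emeasure \<pi> UNIV"
      by (subst \<pi>_m[symmetric]) (simp add: emeasure_distr)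
    then show "emeasure \<pi> (space \<pi>) = 1" using m.emeasure_space_1 by simp
  qed
  have \<delta>: "0 \<le> \<delta>" using order_trans[OF norm_ge_zero h] .
  define H where "H i = norm (h i) + \<delta>" for i
  define D where "D i j = norm (h i - h j) + 2 * \<delta>" for i j
  define P where "P i j = measure \<pi> {z. idx (fst z) = i \<and> idx (snd z) = j}" for i j
  have cell[measurable]: "{z. idx (fst z) = i \<and> idx (snd z) = j} \<in> sets (borel \<Otimes>\<^sub>M borel)" for i j
  proof -
    have "{z \<in> space (borel \<Otimes>\<^sub>M borel). idx (fst z) = i \<and> idx (snd z) = j} \<in> sets (borel \<Otimes>\<^sub>M borel)"
      by measurable
    then show ?thesis by (simp add: space_pair_measure)
  qed
  have [measurable]: "{z. idx (fst z) = i} \<in> sets (borel \<Otimes>\<^sub>M borel)"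
    "{z. idx (snd z) = i} \<in> sets (borel \<Otimes>\<^sub>M borel)" for i
  proof -
    have "{z \<in> space (borel \<Otimes>\<^sub>M borel). idx (fst z) = i} \<in> sets (borel \<Otimes>\<^sub>M borel)"
      "{z \<in> space (borel \<Otimes>\<^sub>M borel). idx (snd z) = i} \<in> sets (borel \<Otimes>\<^sub>M borel)"
      by measurable
    then show "{z. idx (fst z) = i} \<in> sets (borel \<Otimes>\<^sub>M borel)"
      "{z. idx (snd z) = i} \<in> sets (borel \<Otimes>\<^sub>M borel)" by (simp_all add: space_pair_measure)
  qed
  have \<pi>1: "integrable \<pi> (\<lambda>z. f (fst z)) \<longleftrightarrow> integrable m f" "(\<integral>z. f (fst z) \<partial>\<pi>) = integral\<^sup>L m f"
    if [measurable]: "f \<in> borel_measurable borel" for f :: "'a \<Rightarrow> real"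
    by (subst \<pi>_m[symmetric], simp add: integrable_distr_eq integral_distr)+
  have \<pi>2: "integrable \<pi> (\<lambda>z. f (snd z)) \<longleftrightarrow> integrable n f" "(\<integral>z. f (snd z) \<partial>\<pi>) = integral\<^sup>L n f"
    if [measurable]: "f \<in> borel_measurable borel" for f :: "'a \<Rightarrow> real"
    by (subst \<pi>_n[symmetric], simp add: integrable_distr_eq integral_distr)+
  have cells: "has_bochner_integral \<pi>
     (\<lambda>z. if idx (fst z) < M \<and> idx (snd z) < N then G (idx (fst z)) (idx (snd z)) else 0)
     (\<Sum>i<M. \<Sum>j<N. G i j * P i j)" for G :: "nat \<Rightarrow> nat \<Rightarrow> real" and M N
  proof -
    have "has_bochner_integral \<pi>
      (\<lambda>z. \<Sum>i<M. \<Sum>j<N. G i j * indicator {z. idx (fst z) = i \<and> idx (snd z) = j} z)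
      (\<Sum>i<M. \<Sum>j<N. G i j * P i j)"
      unfolding P_def
      by (intro has_bochner_integral_sum has_bochner_integral_mult_right has_bochner_integral_real_indicator)
         (auto simp: less_top[symmetric])
    also have "(\<lambda>z. \<Sum>i<M. \<Sum>j<N. G i j * indicator {z. idx (fst z) = i \<and> idx (snd z) = j} z) =
      (\<lambda>z. if idx (fst z) < M \<and> idx (snd z) < N then G (idx (fst z)) (idx (snd z)) else 0)"
    proof
      fix z
      have "(\<Sum>i<M. \<Sum>j<N. G i j * indicator {z. idx (fst z) = i \<and> idx (snd z) = j} z) =
         (\<Sum>i<M. if i = idx (fst z) then (\<Sum>j<N. if j = idx (snd z) then G (idx (fst z)) (idx (snd z)) else 0) else 0)"
        by (intro sum.cong refl) (auto simp: indicator_def intro!: sum.cong)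
      then show "(\<Sum>i<M. \<Sum>j<N. G i j * indicator {z. idx (fst z) = i \<and> idx (snd z) = j} z) =
        (if idx (fst z) < M \<and> idx (snd z) < N then G (idx (fst z)) (idx (snd z)) else 0)"
        by simp
    qed
    finally show ?thesis .
  qed
  define \<eta> where "\<eta> = (\<epsilon> - 4 * \<delta>) / 2"
  have \<eta>: "0 < \<eta>" using \<epsilon> by (simp add: \<eta>_def)
  let ?Hs = "\<lambda>z. H (idx (fst z)) + H (idx (snd z))"
  have Hm': "integrable \<pi> (\<lambda>z. H (idx (fst z)))" and Hn': "integrable \<pi> (\<lambda>z. H (idx (snd z)))"
    using Hm Hn \<pi>1(1)[of "\<lambda>a. H (idx a)"] \<pi>2(1)[of "\<lambda>a. H (idx a)"] by (auto simp: H_def)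
  have Hs: "integrable \<pi> ?Hs" using Hm' Hn' by simp
  obtain N where N: "(\<integral>z. (if idx (fst z) < N \<and> idx (snd z) < N then 0 else ?Hs z) \<partial>\<pi>) < \<eta>"
  proof -
    have "(\<lambda>N. \<integral>z. (if idx (fst z) < N \<and> idx (snd z) < N then 0 else ?Hs z) \<partial>\<pi>) \<longlonglongrightarrow> (\<integral>z. 0 \<partial>\<pi>)"
    proof (rule integral_dominated_convergence[where w="?Hs"])
      show "AE z in \<pi>. (\<lambda>N. if idx (fst z) < N \<and> idx (snd z) < N then 0 else ?Hs z) \<longlonglongrightarrow> 0"
      proof (intro AE_I2 tendsto_eventually)
        fix z show "\<forall>\<^sub>F N in sequentially. (if idx (fst z) < N \<and> idx (snd z) < N then 0 else ?Hs z) = 0"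
          using eventually_gt_at_top[of "max (idx (fst z)) (idx (snd z))"] by eventually_elim auto
      qed
    qed (use Hs \<delta> in \<open>auto simp: H_def\<close>)
    then have "\<forall>\<^sub>F N in sequentially. (\<integral>z. (if idx (fst z) < N \<and> idx (snd z) < N then 0 else ?Hs z) \<partial>\<pi>) < \<eta>"
      by (rule order_tendstoD) (use \<eta> in simp)
    then show ?thesis using that by (auto simp: eventually_sequentially)
  qed
  \<comment> \<open>\<open>\<theta>\<close> is the rounding error allowed per block\<close>
  define \<theta> where "\<theta> = \<eta> / (1 + (\<Sum>i<N. \<Sum>j<N. H i + H j))"
  have Hnn[simp]: "0 \<le> H i" for i using \<delta> by (simp add: H_def)
  have SH: "0 \<le> (\<Sum>i<N. \<Sum>j<N. H i + H j)" by (intro sum_nonneg) (auto intro: add_nonneg_nonneg)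
  have \<theta>: "0 < \<theta>" using SH \<eta> by (simp add: \<theta>_def add_pos_nonneg)
  \<comment> \<open>rounding strictly down on the blocks of positive mass makes the total mass less than one\<close>
  have "\<exists>x\<in>\<rat>. 0 \<le> x \<and> x \<le> P i j \<and> P i j - \<theta> \<le> x \<and> (0 < P i j \<longrightarrow> x < P i j)" for i j
  proof (cases "0 < P i j")
    case True
    then have "max 0 (P i j - \<theta>) < P i j" using \<theta> by simp
    from Rats_dense_in_real[OF this] show ?thesis by (auto intro: less_imp_le)
  next
    case False
    then have "P i j = 0" by (simp add: P_def zero_less_measure_iff)
    then show ?thesis using \<theta> by (intro bexI[of _ 0]) auto
  qed
  then obtain r where r: "r i j \<in> \<rat>" "0 \<le> r i j" "r i j \<le> P i j" "P i j - \<theta> \<le> r i j"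
     "0 < P i j \<Longrightarrow> r i j < P i j" for i j by metis
  have sub: "subcoupling idx N r m n"
    unfolding subcoupling_def
  proof (intro conjI allI impI)
    fix i assume "i < N"
    have "(\<Sum>j<N. r i j) \<le> (\<Sum>j<N. P i j)" by (intro sum_mono r)
    also have "\<dots> = measure \<pi> (\<Union>j<N. {z. idx (fst z) = i \<and> idx (snd z) = j})"
      unfolding P_def by (intro finite_measure_finite_Union[symmetric]) (auto simp: disjoint_family_on_def)
    also have "\<dots> \<le> measure \<pi> {z \<in> space \<pi>. idx (fst z) = i}"
      by (intro finite_measure_mono) auto
    also have "\<dots> = measure m (idx -` {i})"
      by (subst \<pi>_m[symmetric], subst measure_distr) (auto simp: vimage_def intro!: measurable_sets[of idx borel "count_space UNIV" "{i}", simplified])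
    finally show "(\<Sum>j<N. r i j) \<le> measure m (idx -` {i})" .
  next
    fix j assume "j < N"
    have "(\<Sum>i<N. r i j) \<le> (\<Sum>i<N. P i j)" by (intro sum_mono r)
    also have "\<dots> = measure \<pi> (\<Union>i<N. {z. idx (fst z) = i \<and> idx (snd z) = j})"
      unfolding P_def by (intro finite_measure_finite_Union[symmetric]) (auto simp: disjoint_family_on_def)
    also have "\<dots> \<le> measure \<pi> {z \<in> space \<pi>. idx (snd z) = j}"
      by (intro finite_measure_mono) auto
    also have "\<dots> = measure n (idx -` {j})"
      by (subst \<pi>_n[symmetric], subst measure_distr) (auto simp: vimage_def intro!: measurable_sets[of idx borel "count_space UNIV" "{j}", simplified])
    finally show "(\<Sum>i<N. r i j) \<le> measure n (idx -` {j})" .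
  next
    have P1: "(\<Sum>i<N. \<Sum>j<N. P i j) \<le> 1"
    proof -
      have "(\<Sum>i<N. \<Sum>j<N. P i j) = (\<integral>z. (if idx (fst z) < N \<and> idx (snd z) < N then 1 else 0) \<partial>\<pi>)"
        using cells[of N N "\<lambda>_ _. 1"] by (simp add: has_bochner_integral_iff)
      also have "\<dots> \<le> (\<integral>z. 1 \<partial>\<pi>)"
        using cells[of N N "\<lambda>_ _. 1"] by (intro integral_mono) (auto simp: has_bochner_integral_iff)
      finally show ?thesis using prob_space by simp
    qed
    show "(\<Sum>i<N. \<Sum>j<N. r i j) < 1"
    proof (cases "\<exists>i<N. \<exists>j<N. 0 < P i j")
      case True
      then obtain i j where ij: "i < N" "j < N" "0 < P i j" by blast
      have "(\<Sum>i<N. \<Sum>j<N. r i j) < (\<Sum>i<N. \<Sum>j<N. P i j)"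
      proof (rule sum_strict_mono_ex1)
        have "(\<Sum>j<N. r i j) < (\<Sum>j<N. P i j)"
          using ij by (intro sum_strict_mono_ex1) (auto intro!: bexI[of _ j] r)
        then show "\<exists>i\<in>{..<N}. (\<Sum>j<N. r i j) < (\<Sum>j<N. P i j)" using ij by auto
      qed (auto intro!: sum_mono r)
      then show ?thesis using P1 by linarith
    next
      case False
      then have "r i j \<le> 0" if "i < N" "j < N" for i j
        using r(3)[of i j] that by (meson not_less order_trans)
      then have "(\<Sum>i<N. \<Sum>j<N. r i j) \<le> 0" by (intro sum_nonpos) auto
      then show ?thesis by linarith
    qed
  qed (rule r)
  have nint: "integrable \<pi> (\<lambda>z. norm (fst z - snd z))" and cost': "(\<integral>z. norm (fst z - snd z) \<partial>\<pi>) \<le> c"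
  proof -
    have le: "(\<integral>\<^sup>+z. ennreal (norm (fst z - snd z)) \<partial>\<pi>) \<le> ennreal c"
      using cost(1) by (simp add: split_beta')
    then show int: "integrable \<pi> (\<lambda>z. norm (fst z - snd z))"
      by (intro integrableI_bounded) (auto simp: le_less_trans)
    show "(\<integral>z. norm (fst z - snd z) \<partial>\<pi>) \<le> c"
      using le nn_integral_eq_integral[OF int] cost(2) by simp
  qed
  have 1: "(\<Sum>i<N. \<Sum>j<N. r i j * D i j) \<le> c + 4 * \<delta>"
  proof -
    have "(\<Sum>i<N. \<Sum>j<N. r i j * D i j) \<le> (\<Sum>i<N. \<Sum>j<N. D i j * P i j)"
    proof (intro sum_mono)
      fix i j show "r i j * D i j \<le> D i j * P i j"
        using \<delta> r(3)[of i j] by (subst mult.commute) (auto simp: D_def intro!: mult_left_mono)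
    qed
    also have "\<dots> = (\<integral>z. (if idx (fst z) < N \<and> idx (snd z) < N then D (idx (fst z)) (idx (snd z)) else 0) \<partial>\<pi>)"
      using cells[of N N D] by (simp add: has_bochner_integral_iff)
    also have "\<dots> \<le> (\<integral>z. norm (fst z - snd z) + 4 * \<delta> \<partial>\<pi>)"
    proof (rule integral_mono)
      fix z :: "'a \<times> 'a"
      have "norm (h (idx (fst z)) - h (idx (snd z))) \<le>
         norm (fst z - h (idx (fst z))) + norm (fst z - snd z) + norm (snd z - h (idx (snd z)))"
        by norm
      with h[of "fst z"] h[of "snd z"] \<delta>
      show "(if idx (fst z) < N \<and> idx (snd z) < N then D (idx (fst z)) (idx (snd z)) else 0) \<le> norm (fst z - snd z) + 4 * \<delta>"
        by (auto simp: D_def)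
    qed (use nint cells[of N N D] in \<open>auto simp: has_bochner_integral_iff\<close>)
    also have "\<dots> \<le> c + 4 * \<delta>" using cost' nint prob_space by simp
    finally show ?thesis .
  qed
  have 2: "((\<integral>a. H (idx a) \<partial>m) - (\<Sum>i<N. \<Sum>j<N. H i * r i j)) +
        ((\<integral>a. H (idx a) \<partial>n) - (\<Sum>i<N. \<Sum>j<N. H j * r i j)) \<le> 2 * \<eta>"
  proof -
    let ?G = "\<lambda>i j. H i + H j"
    have "(\<integral>a. H (idx a) \<partial>m) + (\<integral>a. H (idx a) \<partial>n) = (\<integral>z. ?Hs z \<partial>\<pi>)"
      using Hm' Hn' by (simp add: \<pi>1(2)[of "\<lambda>a. H (idx a)"] \<pi>2(2)[of "\<lambda>a. H (idx a)"])
    also have "\<dots> = (\<integral>z. (if idx (fst z) < N \<and> idx (snd z) < N then 0 else ?Hs z) +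
        (if idx (fst z) < N \<and> idx (snd z) < N then ?G (idx (fst z)) (idx (snd z)) else 0) \<partial>\<pi>)"
      by (intro Bochner_Integration.integral_cong) auto
    also have "\<dots> = (\<integral>z. (if idx (fst z) < N \<and> idx (snd z) < N then 0 else ?Hs z) \<partial>\<pi>) + (\<Sum>i<N. \<Sum>j<N. ?G i j * P i j)"
    proof (subst Bochner_Integration.integral_add)
      show "integrable \<pi> (\<lambda>z. if idx (fst z) < N \<and> idx (snd z) < N then 0 else ?Hs z)"
        by (rule Bochner_Integration.integrable_bound[OF Hs]) auto
    qed (use cells[of N N ?G] in \<open>auto simp: has_bochner_integral_iff\<close>)
    finally have *: "(\<integral>a. H (idx a) \<partial>m) + (\<integral>a. H (idx a) \<partial>n) \<le> \<eta> + (\<Sum>i<N. \<Sum>j<N. ?G i j * P i j)"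
      using N by simp
    have "(\<Sum>i<N. \<Sum>j<N. ?G i j * P i j) \<le> (\<Sum>i<N. \<Sum>j<N. ?G i j * (r i j + \<theta>))"
    proof (intro sum_mono mult_left_mono)
      fix i j show "P i j \<le> r i j + \<theta>" using r(4)[of i j] by linarith
    qed (auto intro: add_nonneg_nonneg)
    also have "\<dots> = (\<Sum>i<N. \<Sum>j<N. H i * r i j) + (\<Sum>i<N. \<Sum>j<N. H j * r i j) + (\<Sum>i<N. \<Sum>j<N. ?G i j) * \<theta>"
      by (simp only: distrib_left distrib_right sum.distrib sum_distrib_right add_ac)
    also have "(\<Sum>i<N. \<Sum>j<N. ?G i j) * \<theta> \<le> \<eta>"
      using SH \<eta> by (simp add: \<theta>_def field_simps)
    finally show ?thesis using * by linarith
  qed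
  have "(\<Sum>i<N. \<Sum>j<N. r i j * D i j) + ((\<integral>a. H (idx a) \<partial>m) - (\<Sum>i<N. \<Sum>j<N. H i * r i j)) +
        ((\<integral>a. H (idx a) \<partial>n) - (\<Sum>i<N. \<Sum>j<N. H j * r i j)) \<le> c + \<epsilon>"
    using 1 2 by (simp add: \<eta>_def)
  then show ?thesis
    using sub r(1) by (intro exI[of _ N] exI[of _ r]) (auto simp: block_cost_def D_def H_def)
qed

section \<open>Measurable selection of near-optimal couplings\<close>

lemma measurable_density_prob_algebra:
  assumes K[measurable]: "K \<in> S \<rightarrow>\<^sub>M prob_algebra N"
    and f[measurable]: "case_prod f \<in> borel_measurable (S \<Otimes>\<^sub>M N)"
    and prob: "\<And>s. s \<in> space S \<Longrightarrow> prob_space (density (K s) (f s))"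
  shows "(\<lambda>s. density (K s) (f s)) \<in> S \<rightarrow>\<^sub>M prob_algebra N"
proof (rule measurable_prob_algebraI[OF prob measurable_subprob_algebra])
  fix s assume s: "s \<in> space S"
  have [measurable_cong]: "sets (K s) = sets N"
    using measurable_space[OF K s] by (simp add: space_prob_algebra)
  then show "sets (density (K s) (f s)) = sets N" by simp
  show "subprob_space (density (K s) (f s))"
    using prob[OF s] by (rule prob_space_imp_subprob_space)
next
  fix A assume A[measurable]: "A \<in> sets N"
  have "(\<lambda>s. \<integral>\<^sup>+x. f s x * indicator A x \<partial>K s) \<in> borel_measurable S"
    by (rule nn_integral_measurable_subprob_algebra2[OF _ measurable_prob_algebraD[OF K]]) measurable
  also have "?this \<longleftrightarrow> (\<lambda>s. emeasure (density (K s) (f s)) A) \<in> borel_measurable S"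
  proof (intro measurable_cong)
    fix s assume s: "s \<in> space S"
    have [measurable_cong]: "sets (K s) = sets N"
      using measurable_space[OF K s] by (simp add: space_prob_algebra)
    have "f s \<in> borel_measurable (K s)"
      using measurable_compose[OF measurable_Pair1'[OF s] f] by simp
    then show "(\<integral>\<^sup>+x. f s x * indicator A x \<partial>K s) = emeasure (density (K s) (f s)) A"
      by (subst emeasure_density) auto
  qed
  finally show "(\<lambda>s. emeasure (density (K s) (f s)) A) \<in> borel_measurable S" .
qed

text \<open>The measurable selection itself is elementary: among countably many kernels, take at each point the
  first one whose integral meets the bound.\<close>

lemma kernel_first_below:
  fixes \<Gamma> :: "nat \<Rightarrow> 'x \<Rightarrow> 'y measure"
  assumes \<Gamma>[measurable]: "\<And>k. \<Gamma> k \<in> S \<rightarrow>\<^sub>M prob_algebra N"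
    and [measurable]: "f \<in> borel_measurable N" "c \<in> borel_measurable S"
    and ex: "\<And>s. s \<in> space S \<Longrightarrow> \<exists>k. (\<integral>\<^sup>+x. f x \<partial>\<Gamma> k s) \<le> c s"
  shows "\<exists>k. (\<lambda>s. \<Gamma> (k s) s) \<in> S \<rightarrow>\<^sub>M prob_algebra N \<and> (\<forall>s\<in>space S. (\<integral>\<^sup>+x. f x \<partial>\<Gamma> (k s) s) \<le> c s)"
proof (intro exI[of _ "\<lambda>s. LEAST k. (\<integral>\<^sup>+x. f x \<partial>\<Gamma> k s) \<le> c s"] conjI ballI)
  note measurable_prob_algebraD[OF \<Gamma>, measurable]
  have [measurable]: "(\<lambda>s. \<integral>\<^sup>+x. f x \<partial>\<Gamma> k s) \<in> borel_measurable S" for k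
    by (rule nn_integral_measurable_subprob_algebra2[where N=N]) measurable
  show "(\<lambda>s. \<Gamma> (LEAST k. (\<integral>\<^sup>+x. f x \<partial>\<Gamma> k s) \<le> c s) s) \<in> S \<rightarrow>\<^sub>M prob_algebra N"
    by (rule measurable_compose_countable[OF \<Gamma>]) measurable
  fix s assume "s \<in> space S"
  from LeastI_ex[OF ex[OF this]]
  show "(\<integral>\<^sup>+x. f x \<partial>\<Gamma> (LEAST k. (\<integral>\<^sup>+x. f x \<partial>\<Gamma> k s) \<le> c s) s) \<le> c s" .
qed

lemma small_cells_exist:
  assumes "0 < \<delta>"
  obtains idx :: "'a::{real_normed_vector, second_countable_topology} \<Rightarrow> nat" and h :: "nat \<Rightarrow> 'a"
  where "idx \<in> borel \<rightarrow>\<^sub>M count_space UNIV" "\<And>a. norm (a - h (idx a)) \<le> \<delta>"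
proof -
  obtain D :: "'a set" where D: "countable D" "\<And>X. open X \<Longrightarrow> X \<noteq> {} \<Longrightarrow> \<exists>d\<in>D. d \<in> X"
    by (rule countable_dense_setE) blast
  define h where "h = from_nat_into D"
  have ex: "\<exists>i. norm (a - h i) < \<delta>" for a
  proof -
    have "a \<in> ball a \<delta>" using assms by simp
    then obtain d where "d \<in> D" "d \<in> ball a \<delta>" using D(2)[of "ball a \<delta>"] by auto
    then show ?thesis
      using from_nat_into_surj[OF D(1), of d] by (auto simp: h_def dist_norm)
  qed
  show ?thesis
  proof
    show "(\<lambda>a. LEAST i. norm (a - h i) < \<delta>) \<in> borel \<rightarrow>\<^sub>M count_space UNIV" by measurable
    show "norm (a - h (LEAST i. norm (a - h i) < \<delta>)) \<le> \<delta>" for a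
      using LeastI_ex[OF ex[of a]] by simp
  qed
qed

text \<open>If the measures \<open>K1 s\<close> and \<open>K2 s\<close> have finite first moments and a coupling of cost at most \<open>c s\<close>, then couplings
  of cost at most \<open>c s + \<epsilon>\<close> can be chosen measurably in \<open>s\<close>. The candidates are the block couplings of
  the countably many rational matrices with finite support, replaced by the product coupling where
  the matrix is not a sub-coupling.\<close>

lemma measurable_coupling_selection:
  fixes K1 K2 :: "'x \<Rightarrow> 'a::{real_normed_vector, second_countable_topology} measure" and c :: "'x \<Rightarrow> real"
  assumes K1[measurable]: "K1 \<in> S \<rightarrow>\<^sub>M prob_algebra borel" and K2[measurable]: "K2 \<in> S \<rightarrow>\<^sub>M prob_algebra borel"
    and c[measurable]: "c \<in> borel_measurable S" and c_nn: "\<And>s. s \<in> space S \<Longrightarrow> 0 \<le> c s"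
    and fin1: "\<And>s. s \<in> space S \<Longrightarrow> (\<integral>\<^sup>+a. ennreal (norm a) \<partial>K1 s) < \<infinity>"
    and fin2: "\<And>s. s \<in> space S \<Longrightarrow> (\<integral>\<^sup>+a. ennreal (norm a) \<partial>K2 s) < \<infinity>"
    and ex: "\<And>s. s \<in> space S \<Longrightarrow>
      \<exists>\<pi>\<in>couplings (K1 s) (K2 s). (\<integral>\<^sup>+(a, b). ennreal (norm (a - b)) \<partial>\<pi>) \<le> ennreal (c s)"
    and "0 < \<epsilon>"
  obtains \<Gamma> where "\<Gamma> \<in> S \<rightarrow>\<^sub>M prob_algebra (borel \<Otimes>\<^sub>M borel)"
    "\<And>s. s \<in> space S \<Longrightarrow> \<Gamma> s \<in> couplings (K1 s) (K2 s)"
    "\<And>s. s \<in> space S \<Longrightarrow> (\<integral>\<^sup>+(a, b). ennreal (norm (a - b)) \<partial>\<Gamma> s) \<le> ennreal (c s + \<epsilon>)"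
proof -
  \<comment> \<open>with cells of radius \<open>\<epsilon> / 5\<close> the discretisation error \<open>4 * (\<epsilon> / 5)\<close> stays below \<open>\<epsilon>\<close>\<close>
  have "0 < \<epsilon> / 5" using \<open>0 < \<epsilon>\<close> by simp
  then obtain idx :: "'a \<Rightarrow> nat" and h where idx[measurable]: "idx \<in> borel \<rightarrow>\<^sub>M count_space UNIV"
    and h: "\<And>a. norm (a - h (idx a)) \<le> \<epsilon> / 5"
    by (rule small_cells_exist) blast
  define I where "I = (SIGMA N:UNIV::nat set. PiE ({..<N} \<times> {..<N}) (\<lambda>_. \<rat> :: real set))"
  have I: "countable I"
    unfolding I_def by (intro countable_SIGMA countable_PiE) (auto simp: countable_rat)
  define N where "N k = fst (from_nat_into I k)" for k
  define r where "r k = curry (snd (from_nat_into I k))" for k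
  have m1: "prob_space (K1 s)" "sets (K1 s) = sets borel" and m2: "prob_space (K2 s)" "sets (K2 s) = sets borel"
    if "s \<in> space S" for s
    using measurable_space[OF K1 that] measurable_space[OF K2 that] by (auto simp: space_prob_algebra)
  define ok where "ok k s = subcoupling idx (N k) (r k) (K1 s) (K2 s)" for k s
  define u where "u k s a b = (if ok k s then block_density idx (N k) (r k) (K1 s) (K2 s) a b else 1)" for k s a b
  define \<Gamma> where "\<Gamma> k s = density (K1 s \<Otimes>\<^sub>M K2 s) (\<lambda>(a, b). ennreal (u k s a b))" for k s
  have [measurable]: "idx -` {k} \<in> sets borel" for k
    using measurable_sets[of idx borel "count_space UNIV" "{k}"] by simp
  have pq[measurable]: "(\<lambda>s. measure (K1 s) (idx -` {i})) \<in> borel_measurable S"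
    "(\<lambda>s. measure (K2 s) (idx -` {i})) \<in> borel_measurable S" for i
    by measurable
  have "Measurable.pred S (ok k)" for k
    unfolding ok_def subcoupling_def by measurable
  from measurable_compose[OF measurable_fst this]
  have [measurable]: "Measurable.pred (S \<Otimes>\<^sub>M (borel \<Otimes>\<^sub>M borel :: ('a \<times> 'a) measure)) (\<lambda>x. ok k (fst x))" for k .
  have [measurable]: "(\<lambda>x. block_density idx M w (K1 (fst x)) (K2 (fst x)) (fst (snd x)) (snd (snd x)))
      \<in> borel_measurable (S \<Otimes>\<^sub>M (borel \<Otimes>\<^sub>M borel))" for M w
    unfolding block_density_def row_excess_def of_bool_def by measurable
  have u_m[measurable]: "(\<lambda>(s, a, b). u k s a b) \<in> borel_measurable (S \<Otimes>\<^sub>M (borel \<Otimes>\<^sub>M borel))" for k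
    unfolding u_def split_beta' by measurable
  have cpl: "\<Gamma> k s \<in> couplings (K1 s) (K2 s)" if s: "s \<in> space S" for k s
  proof (cases "ok k s")
    case True
    then show ?thesis
      using block_coupling[OF m1[OF s] m2[OF s] idx] by (simp add: \<Gamma>_def u_def ok_def)
  next
    case False
    then show ?thesis
      unfolding \<Gamma>_def u_def
      using density_couplings[OF m1(1)[OF s] m2(1)[OF s], of "\<lambda>_ _. 1"]
        prob_space.emeasure_space_1[OF m1(1)[OF s]] prob_space.emeasure_space_1[OF m2(1)[OF s]]
      by (simp add: case_prod_beta')
  qed
  have sets_\<Gamma>: "sets (\<Gamma> k s) = sets (borel \<Otimes>\<^sub>M borel)" if "s \<in> space S" for k s
    using m1(2)[OF that] m2(2)[OF that] by (simp add: \<Gamma>_def cong: sets_pair_measure_cong)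
  have prob_\<Gamma>: "prob_space (\<Gamma> k s)" if s: "s \<in> space S" for k s
  proof -
    have *: "distr (\<Gamma> k s) (K1 s) fst = K1 s" and "sets (\<Gamma> k s) = sets (K1 s \<Otimes>\<^sub>M K2 s)"
      using cpl[OF s, of k] by (auto simp: couplings_def)
    then have "fst \<in> \<Gamma> k s \<rightarrow>\<^sub>M K1 s" by (simp cong: measurable_cong_sets)
    then show ?thesis
      using prob_space_distrD[of fst "\<Gamma> k s" "K1 s"] * m1(1)[OF s] by simp
  qed
  have \<Gamma>_m: "\<Gamma> k \<in> S \<rightarrow>\<^sub>M prob_algebra (borel \<Otimes>\<^sub>M borel)" for k
    unfolding \<Gamma>_def
  proof (rule measurable_density_prob_algebra)
    show "(\<lambda>s. K1 s \<Otimes>\<^sub>M K2 s) \<in> S \<rightarrow>\<^sub>M prob_algebra (borel \<Otimes>\<^sub>M borel)" by measurable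
    show "(\<lambda>(s, z). case z of (a, b) \<Rightarrow> ennreal (u k s a b)) \<in> borel_measurable (S \<Otimes>\<^sub>M (borel \<Otimes>\<^sub>M borel))"
      using u_m[unfolded split_beta'] unfolding split_beta' by measurable
    show "prob_space (density (K1 s \<Otimes>\<^sub>M K2 s) (\<lambda>(a, b). ennreal (u k s a b)))" if "s \<in> space S" for s
      using prob_\<Gamma>[OF that, of k] by (simp add: \<Gamma>_def)
  qed
  have int: "integrable m (\<lambda>a. norm (h (idx a)) + \<epsilon> / 5)"
    if m: "prob_space m" "sets m = sets borel" "(\<integral>\<^sup>+a. ennreal (norm a) \<partial>m) < \<infinity>" for m
  proof -
    interpret prob_space m by fact
    note [measurable_cong] = m(2)
    have "integrable m (\<lambda>a. norm a)"
      using m(3) by (intro integrableI_bounded) auto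
    then have *: "integrable m (\<lambda>a. norm a + 2 * \<epsilon> / 5)" by simp
    show ?thesis
    proof (rule Bochner_Integration.integrable_bound[OF *])
      show "AE a in m. norm (norm (h (idx a)) + \<epsilon> / 5) \<le> norm (norm a + 2 * \<epsilon> / 5)"
      proof (rule AE_I2)
        fix a
        have "norm (h (idx a)) \<le> norm a + norm (a - h (idx a))" by norm
        then show "norm (norm (h (idx a)) + \<epsilon> / 5) \<le> norm (norm a + 2 * \<epsilon> / 5)"
          using h[of a] \<open>0 < \<epsilon>\<close> by simp
      qed
    qed measurable
  qed
  have exk: "\<exists>k. (\<integral>\<^sup>+(a, b). ennreal (norm (a - b)) \<partial>\<Gamma> k s) \<le> ennreal (c s + \<epsilon>)" if s: "s \<in> space S" for s
  proof -
    note int1 = int[OF m1[OF s] fin1[OF s]] and int2 = int[OF m2[OF s] fin2[OF s]]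
    obtain \<pi> where \<pi>: "\<pi> \<in> couplings (K1 s) (K2 s)" "(\<integral>\<^sup>+(a, b). ennreal (norm (a - b)) \<partial>\<pi>) \<le> ennreal (c s)"
      using ex[OF s] by blast
    have "4 * (\<epsilon> / 5) < \<epsilon>" using \<open>0 < \<epsilon>\<close> by simp
    from rational_subcoupling_exists[OF m1[OF s] m2[OF s] idx h int1 int2 \<pi> c_nn[OF s] this]
    obtain M w where w: "range (case_prod w) \<subseteq> \<rat>" "subcoupling idx M w (K1 s) (K2 s)"
      "block_cost idx h (\<epsilon> / 5) M w (K1 s) (K2 s) \<le> c s + \<epsilon>"
      by blast
    have "(M, restrict (case_prod w) ({..<M} \<times> {..<M})) \<in> I"
      using w(1) by (auto simp: I_def)
    from from_nat_into_surj[OF I this] obtain k where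
      k: "from_nat_into I k = (M, restrict (case_prod w) ({..<M} \<times> {..<M}))" by blast
    have Nk: "N k = M" and rk: "\<And>i j. i < M \<Longrightarrow> j < M \<Longrightarrow> r k i j = w i j"
      by (auto simp: N_def r_def k)
    have ok: "subcoupling idx (N k) (r k) (K1 s) (K2 s)"
      using w(2) by (simp add: subcoupling_def Nk rk)
    have "(\<integral>\<^sup>+(a, b). ennreal (norm (a - b)) \<partial>\<Gamma> k s) \<le>
      ennreal (block_cost idx h (\<epsilon> / 5) M (r k) (K1 s) (K2 s))"
      using block_coupling_cost[OF m1[OF s] m2[OF s] idx ok h int1 int2] ok
      by (simp add: \<Gamma>_def u_def ok_def Nk)
    also have "\<dots> \<le> ennreal (c s + \<epsilon>)"
      using w(3) by (intro ennreal_leI) (simp add: block_cost_def rk)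
    finally show ?thesis by blast
  qed
  have "\<exists>k. (\<lambda>s. \<Gamma> (k s) s) \<in> S \<rightarrow>\<^sub>M prob_algebra (borel \<Otimes>\<^sub>M borel) \<and>
     (\<forall>s\<in>space S. (\<integral>\<^sup>+(a, b). ennreal (norm (a - b)) \<partial>\<Gamma> (k s) s) \<le> ennreal (c s + \<epsilon>))"
    by (rule kernel_first_below[OF \<Gamma>_m _ _ exk]) measurable
  then obtain k where "(\<lambda>s. \<Gamma> (k s) s) \<in> S \<rightarrow>\<^sub>M prob_algebra (borel \<Otimes>\<^sub>M borel)"
     "\<forall>s\<in>space S. (\<integral>\<^sup>+(a, b). ennreal (norm (a - b)) \<partial>\<Gamma> (k s) s) \<le> ennreal (c s + \<epsilon>)" by blast
  then show ?thesis by (intro that[of "\<lambda>s. \<Gamma> (k s) s"] cpl) auto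
qed

section \<open>Paths and conditional laws\<close>

abbreviation path_pairs :: "nat \<Rightarrow> ((nat \<Rightarrow> real ^ 'd) \<times> (nat \<Rightarrow> real ^ 'd)) measure" where
  "path_pairs n \<equiv> path_space n \<Otimes>\<^sub>M path_space n"

lemma atLeastAtMost_Suc_insert: "{1..Suc n} = insert (Suc n) {1..n}"
  by auto

lemma path_component_measurable:
  "1 \<le> i \<Longrightarrow> i \<le> n \<Longrightarrow> (\<lambda>x. x i) \<in> path_space n \<rightarrow>\<^sub>M borel"
  unfolding path_space_def by (rule measurable_component_singleton) simp

lemma path_component_measurable':
  "1 \<le> i \<Longrightarrow> i \<le> n \<Longrightarrow> f \<in> M \<rightarrow>\<^sub>M path_space n \<Longrightarrow> (\<lambda>w. f w i) \<in> M \<rightarrow>\<^sub>M borel"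
  by (rule measurable_compose[OF _ path_component_measurable])

lemma path_prefix_measurable:
  "m \<le> n \<Longrightarrow> path_prefix m \<in> path_space n \<rightarrow>\<^sub>M path_space m"
  unfolding path_space_def by (rule measurable_restrict_subset) auto

lemma path_extend_measurable [measurable]:
  assumes f: "f \<in> M \<rightarrow>\<^sub>M path_space n" and g: "g \<in> M \<rightarrow>\<^sub>M borel"
  shows "(\<lambda>w. (f w)(Suc n := g w)) \<in> M \<rightarrow>\<^sub>M path_space (Suc n)"
proof -
  have "(\<lambda>w. (f w, g w)) \<in> M \<rightarrow>\<^sub>M path_space n \<Otimes>\<^sub>M borel" using f g by measurable
  moreover have "(\<lambda>(x, a). x(Suc n := a)) \<in> path_space n \<Otimes>\<^sub>M borel \<rightarrow>\<^sub>M path_space (Suc n)"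
    using measurable_add_dim[of "Suc n" "{1..n}" "\<lambda>_. borel"]
    by (simp only: path_space_def atLeastAtMost_Suc_insert)
  ultimately have "(\<lambda>w. (\<lambda>(x, a). x(Suc n := a)) (f w, g w)) \<in> M \<rightarrow>\<^sub>M path_space (Suc n)"
    by (rule measurable_compose)
  then show ?thesis by simp
qed

text \<open>Addition of paths of length \<open>n\<close>, with values extensional as in \<^const>\<open>path_space\<close>.\<close>

definition path_add :: "nat \<Rightarrow> (nat \<Rightarrow> real ^ 'd) \<Rightarrow> (nat \<Rightarrow> real ^ 'd) \<Rightarrow> nat \<Rightarrow> real ^ 'd" where
  "path_add n x z = (\<lambda>s\<in>{1..n}. x s + z s)"

lemma path_add_in_space [simp]: "path_add n x z \<in> space (path_space n)"
  by (simp add: path_add_def path_space_def space_PiM)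

lemma path_add_const_measurable [measurable]: "path_add n x \<in> path_space n \<rightarrow>\<^sub>M path_space n"
  unfolding path_space_def path_add_def
  by (intro measurable_restrict borel_measurable_add measurable_const measurable_component_singleton) auto

lemma path_add_measurable [measurable]:
  assumes "f \<in> M \<rightarrow>\<^sub>M path_space n" and "g \<in> M \<rightarrow>\<^sub>M path_space n"
  shows "(\<lambda>w. path_add n (f w) (g w)) \<in> M \<rightarrow>\<^sub>M path_space n"
  unfolding path_space_def path_add_def
proof (intro measurable_restrict borel_measurable_add)
  fix s assume "s \<in> {1..n}"
  then show "(\<lambda>w. f w s) \<in> M \<rightarrow>\<^sub>M borel" "(\<lambda>w. g w s) \<in> M \<rightarrow>\<^sub>M borel"
    using path_component_measurable'[OF _ _ assms(1)] path_component_measurable'[OF _ _ assms(2)] by auto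
qed

lemma path_norm_measurable [measurable]:
  assumes "f \<in> M \<rightarrow>\<^sub>M path_space n" and "g \<in> M \<rightarrow>\<^sub>M path_space n"
  shows "(\<lambda>w. path_norm n (\<lambda>s. f w s - g w s)) \<in> borel_measurable M"
  unfolding path_norm_def
proof (rule borel_measurable_sum)
  fix s assume "s \<in> {1..n}"
  then have [measurable]: "(\<lambda>w. f w s) \<in> M \<rightarrow>\<^sub>M borel" "(\<lambda>w. g w s) \<in> M \<rightarrow>\<^sub>M borel"
    using path_component_measurable'[OF _ _ assms(1)] path_component_measurable'[OF _ _ assms(2)] by auto
  show "(\<lambda>w. norm (f w s - g w s)) \<in> borel_measurable M" by measurable
qed

abbreviation path_dist :: "nat \<Rightarrow> (nat \<Rightarrow> real ^ 'd) \<Rightarrow> (nat \<Rightarrow> real ^ 'd) \<Rightarrow> real" where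
  "path_dist n x y \<equiv> path_norm n (\<lambda>s. x s - y s)"

lemma path_norm_Suc: "path_norm (Suc n) x = path_norm n x + norm (x (Suc n))"
  by (simp add: path_norm_def)

lemma path_norm_nonneg [simp]: "0 \<le> path_norm n x"
  by (simp add: path_norm_def sum_nonneg)

lemma path_norm_cong: "(\<And>s. 1 \<le> s \<Longrightarrow> s \<le> n \<Longrightarrow> x s = y s) \<Longrightarrow> path_norm n x = path_norm n y"
  by (simp add: path_norm_def)

lemma path_prefix_id: "x \<in> space (path_space n) \<Longrightarrow> path_prefix n x = x"
  by (simp add: path_space_def space_PiM PiE_def extensional_restrict)

lemma path_prefix_extend: "m \<le> n \<Longrightarrow> path_prefix m (x(Suc n := a)) = path_prefix m x"
  by (auto simp: fun_eq_iff restrict_def)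

lemma path_prefix_Suc: "path_prefix (Suc n) x = (path_prefix n x)(Suc n := x (Suc n))"
  by (auto simp: fun_eq_iff restrict_def)

lemma path_prefix_prefix: "m \<le> n \<Longrightarrow> path_prefix m (path_prefix n x) = path_prefix m x"
  by (auto simp: fun_eq_iff restrict_def)

lemma prob_algebra_sets: "K \<in> S \<rightarrow>\<^sub>M prob_algebra N \<Longrightarrow> s \<in> space S \<Longrightarrow> sets (K s) = sets N"
  and prob_algebra_prob: "K \<in> S \<rightarrow>\<^sub>M prob_algebra N \<Longrightarrow> s \<in> space S \<Longrightarrow> prob_space (K s)"
  by (auto dest: measurable_space simp: space_prob_algebra)

lemma nn_integral_kernel_measurable [measurable (raw)]:
  assumes "(\<lambda>(x, y). f x y) \<in> borel_measurable (M \<Otimes>\<^sub>M N)" and "K \<in> M \<rightarrow>\<^sub>M prob_algebra N"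
  shows "(\<lambda>x. \<integral>\<^sup>+y. f x y \<partial>K x) \<in> borel_measurable M"
  by (rule nn_integral_measurable_subprob_algebra2[OF assms(1) measurable_prob_algebraD[OF assms(2)]])

lemma nn_integral_bind_prob:
  assumes "f \<in> borel_measurable B" "K \<in> M \<rightarrow>\<^sub>M prob_algebra B"
  shows "(\<integral>\<^sup>+x. f x \<partial>(M \<bind> K)) = (\<integral>\<^sup>+x. \<integral>\<^sup>+y. f y \<partial>K x \<partial>M)"
  by (rule nn_integral_bind[OF assms(1) measurable_prob_algebraD[OF assms(2)]])

lemma nn_integral_bind_bind:
  assumes M: "sets M = sets P" and R: "R \<in> P \<rightarrow>\<^sub>M prob_algebra N" and U: "U \<in> N \<rightarrow>\<^sub>M prob_algebra B"
    and f: "f \<in> borel_measurable B"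
  shows "(\<integral>\<^sup>+b. f b \<partial>(M \<bind> (\<lambda>x. R x \<bind> U))) = (\<integral>\<^sup>+x. \<integral>\<^sup>+z. \<integral>\<^sup>+b. f b \<partial>U z \<partial>R x \<partial>M)"
proof -
  have "(\<lambda>x. R x \<bind> U) \<in> M \<rightarrow>\<^sub>M prob_algebra B"
    unfolding measurable_cong_sets[OF M refl] by (rule measurable_bind_prob_space[OF R U])
  from nn_integral_bind_prob[OF f this]
  have "(\<integral>\<^sup>+b. f b \<partial>(M \<bind> (\<lambda>x. R x \<bind> U))) = (\<integral>\<^sup>+x. \<integral>\<^sup>+b. f b \<partial>(R x \<bind> U) \<partial>M)" .
  also have "\<dots> = (\<integral>\<^sup>+x. \<integral>\<^sup>+z. \<integral>\<^sup>+b. f b \<partial>U z \<partial>R x \<partial>M)"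
  proof (rule nn_integral_cong)
    fix x assume "x \<in> space M"
    then have "x \<in> space P" using sets_eq_imp_space_eq[OF M] by simp
    from prob_algebra_sets[OF R this] have "U \<in> R x \<rightarrow>\<^sub>M prob_algebra B"
      using U by (simp cong: measurable_cong_sets)
    then show "(\<integral>\<^sup>+b. f b \<partial>(R x \<bind> U)) = (\<integral>\<^sup>+z. \<integral>\<^sup>+b. f b \<partial>U z \<partial>R x)"
      by (rule nn_integral_bind_prob[OF f])
  qed
  finally show ?thesis .
qed

lemma nn_integral_rectangle:
  assumes K: "K \<in> S \<rightarrow>\<^sub>M prob_algebra N" and s: "s \<in> space S" and "B \<in> sets N"
  shows "(\<integral>\<^sup>+b. indicator (A \<times> B) (s, b) \<partial>K s) = indicator A s * emeasure (K s) B"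
proof -
  have "(\<integral>\<^sup>+b. indicator (A \<times> B) (s, b) \<partial>K s) = (\<integral>\<^sup>+b. indicator A s * indicator B b \<partial>K s)"
    by (intro nn_integral_cong) (auto simp: indicator_def)
  then show ?thesis using prob_algebra_sets[OF K s] \<open>B \<in> sets N\<close> by (simp add: nn_integral_cmult)
qed

lemma cond_lawI:
  assumes K[measurable]: "K \<in> S \<rightarrow>\<^sub>M prob_algebra N"
    and X[measurable]: "X \<in> M \<rightarrow>\<^sub>M S" and Y[measurable]: "Y \<in> M \<rightarrow>\<^sub>M N"
    and eq: "\<And>f. f \<in> borel_measurable (S \<Otimes>\<^sub>M N) \<Longrightarrow>
       (\<integral>\<^sup>+w. f (X w, Y w) \<partial>M) = (\<integral>\<^sup>+w. \<integral>\<^sup>+b. f (X w, b) \<partial>K (X w) \<partial>M)"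
  shows "cond_law M S X N Y K"
  unfolding cond_law_def
proof (intro conjI ballI K)
  fix A B assume [measurable]: "A \<in> sets S" "B \<in> sets N"
  have "emeasure M {w \<in> space M. X w \<in> A \<and> Y w \<in> B} = (\<integral>\<^sup>+w. indicator {w \<in> space M. X w \<in> A \<and> Y w \<in> B} w \<partial>M)"
    by simp
  also have "\<dots> = (\<integral>\<^sup>+w. indicator (A \<times> B) (X w, Y w) \<partial>M)"
    by (intro nn_integral_cong) (auto simp: indicator_def)
  also have "\<dots> = (\<integral>\<^sup>+w. \<integral>\<^sup>+b. indicator (A \<times> B) (X w, b) \<partial>K (X w) \<partial>M)"
    by (rule eq) measurable
  also have "\<dots> = (\<integral>\<^sup>+w. indicator A (X w) * emeasure (K (X w)) B \<partial>M)"
    using measurable_space[OF X] by (intro nn_integral_cong nn_integral_rectangle[OF K]) auto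
  finally show "emeasure M {w \<in> space M. X w \<in> A \<and> Y w \<in> B} = (\<integral>\<^sup>+w. indicator A (X w) * emeasure (K (X w)) B \<partial>M)" .
qed

text \<open>The defining identity on rectangles extends to all nonnegative measurable functions, since the
  rectangles generate the product sigma-algebra and are stable under intersection.\<close>

lemma cond_law_nn_integral:
  assumes law: "cond_law M S X N Y K" and "prob_space M"
    and X[measurable]: "X \<in> M \<rightarrow>\<^sub>M S" and Y[measurable]: "Y \<in> M \<rightarrow>\<^sub>M N"
    and f[measurable]: "f \<in> borel_measurable (S \<Otimes>\<^sub>M N)"
  shows "(\<integral>\<^sup>+w. f (X w, Y w) \<partial>M) = (\<integral>\<^sup>+w. \<integral>\<^sup>+b. f (X w, b) \<partial>K (X w) \<partial>M)"
proof -
  interpret prob_space M by fact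
  have K[measurable]: "K \<in> S \<rightarrow>\<^sub>M prob_algebra N" using law by (simp add: cond_law_def)
  let ?P = "distr M (S \<Otimes>\<^sub>M N) (\<lambda>w. (X w, Y w))"
  let ?k = "\<lambda>w. distr (K (X w)) (S \<Otimes>\<^sub>M N) (\<lambda>b. (X w, b))"
  have k[measurable]: "?k \<in> M \<rightarrow>\<^sub>M prob_algebra (S \<Otimes>\<^sub>M N)"
    by (rule measurable_distr_prob_space2[where M=N]) measurable
  let ?Q = "M \<bind> ?k"
  have sets_Q: "sets ?Q = sets (S \<Otimes>\<^sub>M N)"
    using not_empty by (intro sets_bind[OF sets_kernel[OF measurable_prob_algebraD[OF k]]]) auto
  have int_k: "(\<integral>\<^sup>+z. g z \<partial>?k w) = (\<integral>\<^sup>+b. g (X w, b) \<partial>K (X w))"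
    if [measurable]: "g \<in> borel_measurable (S \<Otimes>\<^sub>M N)" and w: "w \<in> space M" for g w
  proof -
    have Xw: "X w \<in> space S" using X w by (rule measurable_space)
    then have [measurable_cong]: "sets (K (X w)) = sets N" by (rule prob_algebra_sets[OF K])
    show ?thesis using Xw by (subst nn_integral_distr) auto
  qed
  have int_Q: "(\<integral>\<^sup>+z. g z \<partial>?Q) = (\<integral>\<^sup>+w. \<integral>\<^sup>+b. g (X w, b) \<partial>K (X w) \<partial>M)"
    if g[measurable]: "g \<in> borel_measurable (S \<Otimes>\<^sub>M N)" for g
    using int_k[OF g] by (subst nn_integral_bind_prob[OF g k]) (intro nn_integral_cong)
  have "?P = ?Q"
  proof (rule measure_eqI_generator_eq[where E="{a \<times> b |a b. a \<in> sets S \<and> b \<in> sets N}"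
        and A="\<lambda>_. space S \<times> space N" and \<Omega>="space S \<times> space N"])
    show "Int_stable {a \<times> b |a b. a \<in> sets S \<and> b \<in> sets N}"
      by (rule Int_stable_pair_measure_generator)
    show "{a \<times> b |a b. a \<in> sets S \<and> b \<in> sets N} \<subseteq> Pow (space S \<times> space N)"
      using sets.space_closed[of S] sets.space_closed[of N] by auto
    show "sets ?P = sigma_sets (space S \<times> space N) {a \<times> b |a b. a \<in> sets S \<and> b \<in> sets N}"
      by (simp add: sets_pair_measure)
    show "sets ?Q = sigma_sets (space S \<times> space N) {a \<times> b |a b. a \<in> sets S \<and> b \<in> sets N}"
      by (simp add: sets_Q sets_pair_measure)
    show "emeasure ?P (space S \<times> space N) \<noteq> \<infinity>" for i :: nat
      by (subst emeasure_distr) auto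
    fix Z assume "Z \<in> {a \<times> b |a b. a \<in> sets S \<and> b \<in> sets N}"
    then obtain A B where Z: "Z = A \<times> B" and [measurable]: "A \<in> sets S" "B \<in> sets N" by auto
    have "emeasure ?P Z = emeasure M {w \<in> space M. X w \<in> A \<and> Y w \<in> B}"
      unfolding Z by (subst emeasure_distr) (auto intro!: arg_cong[where f="emeasure M"])
    also have "\<dots> = (\<integral>\<^sup>+w. indicator A (X w) * emeasure (K (X w)) B \<partial>M)"
      using law by (simp add: cond_law_def)
    also have "\<dots> = (\<integral>\<^sup>+w. \<integral>\<^sup>+b. indicator (A \<times> B) (X w, b) \<partial>K (X w) \<partial>M)"
      using measurable_space[OF X] by (intro nn_integral_cong nn_integral_rectangle[OF K, symmetric]) auto
    also have "\<dots> = emeasure ?Q Z"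
      using int_Q[of "indicator (A \<times> B)"] sets_Q by (simp add: Z)
    finally show "emeasure ?P Z = emeasure ?Q Z" .
  qed auto
  then have "(\<integral>\<^sup>+z. f z \<partial>?P) = (\<integral>\<^sup>+z. f z \<partial>?Q)" by simp
  then show ?thesis by (simp add: int_Q nn_integral_distr)
qed

lemma path_kernel_measurable:
  "path_kernel n \<mu> K \<Longrightarrow> K \<in> path_space n \<rightarrow>\<^sub>M prob_algebra borel"
  by (simp add: path_kernel_def cond_law_def)

lemma path_kernel_nn_integral:
  fixes \<mu> :: "(nat \<Rightarrow> real ^ 'd) measure"
  assumes "path_kernel n \<mu> K" "prob_space \<mu>" and [measurable_cong]: "sets \<mu> = sets (path_space T)" and "n < T"
    and "(\<lambda>(x, a). f x a) \<in> borel_measurable (path_space n \<Otimes>\<^sub>M borel)"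
  shows "(\<integral>\<^sup>+x. f (path_prefix n x) (x (Suc n)) \<partial>\<mu>) = (\<integral>\<^sup>+x. \<integral>\<^sup>+a. f (path_prefix n x) a \<partial>K (path_prefix n x) \<partial>\<mu>)"
proof -
  have "path_prefix n \<in> \<mu> \<rightarrow>\<^sub>M path_space n" "(\<lambda>x. x (Suc n)) \<in> \<mu> \<rightarrow>\<^sub>M borel"
    using \<open>n < T\<close> path_prefix_measurable[of n T] path_component_measurable[of "Suc n" T]
    by (auto simp: measurable_cong_sets[OF assms(3) refl])
  from cond_law_nn_integral[OF assms(1)[unfolded path_kernel_def] assms(2) this assms(5)]
  show ?thesis by simp
qed

section \<open>Independent noise with a positive density and the posterior law\<close>

text \<open>The argument works for noise whose values are independent over time with one common law that has a
  positive bounded density \<open>g\<close> with respect to Lebesgue measure.\<close>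

locale noise_density =
  fixes g :: "real ^ 'd \<Rightarrow> real" and B :: real
  assumes g_measurable [measurable]: "g \<in> borel_measurable borel"
    and g_pos: "0 < g z"
    and g_le: "g z \<le> B"
    and g_integral: "(\<integral>\<^sup>+z. ennreal (g z) \<partial>lborel) = 1"
begin

text \<open>The law of the noise at one time.\<close>

definition noise :: "(real ^ 'd) measure" where
  "noise = density lborel (\<lambda>z. ennreal (g z))"

text \<open>The law of the noise along a path of length \<open>n\<close>.\<close>

definition path_noise :: "nat \<Rightarrow> (nat \<Rightarrow> real ^ 'd) measure" where
  "path_noise n = PiM {1..n} (\<lambda>_. noise)"

lemma sets_noise [simp, measurable_cong]: "sets noise = sets borel"
  by (simp add: noise_def)

lemma space_noise [simp]: "space noise = UNIV"
  by (simp add: noise_def)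

lemma sets_path_noise [simp, measurable_cong]: "sets (path_noise n) = sets (path_space n)"
  unfolding path_noise_def path_space_def by (intro sets_PiM_cong) auto

lemma prob_space_noise: "prob_space noise"
  by (rule prob_spaceI) (simp add: noise_def emeasure_density g_integral)

sublocale noise: prob_space noise by (rule prob_space_noise)

sublocale noise_product: product_prob_space "\<lambda>_::nat. noise" UNIV
  by unfold_locales

sublocale lborel_product: product_sigma_finite "\<lambda>_::nat. lborel :: (real ^ 'd) measure"
  by unfold_locales

lemma prob_space_path_noise: "prob_space (path_noise n)"
  unfolding path_noise_def by (rule prob_space_PiM) (rule prob_space_noise)

lemma noise_translate:
  assumes [measurable]: "f \<in> borel_measurable borel"
  shows "(\<integral>\<^sup>+b. f (c + b) \<partial>noise) = (\<integral>\<^sup>+b. ennreal (g (b - c)) * f b \<partial>lborel)"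
proof -
  have "(\<integral>\<^sup>+b. ennreal (g (b - c)) * f b \<partial>lborel) = (\<integral>\<^sup>+b. ennreal (g (b - c)) * f b \<partial>distr lborel borel ((+) c))"
    by (simp add: lborel_distr_plus)
  also have "\<dots> = (\<integral>\<^sup>+b. f (c + b) \<partial>noise)"
    by (subst nn_integral_distr) (auto simp: noise_def nn_integral_density)
  finally show ?thesis by simp
qed

lemma path_noise_Suc:
  assumes [measurable]: "f \<in> borel_measurable (path_space (Suc n))"
  shows "(\<integral>\<^sup>+z. f z \<partial>path_noise (Suc n)) = (\<integral>\<^sup>+z. \<integral>\<^sup>+b. f (z(Suc n := b)) \<partial>noise \<partial>path_noise n)"
proof -
  have "f \<in> borel_measurable (PiM (insert (Suc n) {1..n}) (\<lambda>_. noise))"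
    using assms unfolding path_space_def atLeastAtMost_Suc_insert
    by (subst measurable_cong_sets[OF sets_PiM_cong refl]) auto
  from noise_product.product_nn_integral_insert[OF _ _ this]
  show ?thesis
    unfolding path_noise_def atLeastAtMost_Suc_insert by simp
qed

lemma sets_lborel_paths: "sets (PiM {1..n} (\<lambda>_. lborel :: (real ^ 'd) measure)) = sets (path_space n)"
  unfolding path_space_def by (intro sets_PiM_cong) auto

lemma lborel_paths_Suc:
  fixes f :: "(nat \<Rightarrow> real ^ 'd) \<Rightarrow> ennreal"
  assumes [measurable]: "f \<in> borel_measurable (path_space (Suc n))"
  shows "(\<integral>\<^sup>+z. f z \<partial>PiM {1..Suc n} (\<lambda>_. lborel)) = (\<integral>\<^sup>+z. \<integral>\<^sup>+b. f (z(Suc n := b)) \<partial>lborel \<partial>PiM {1..n} (\<lambda>_. lborel))"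
proof -
  have "f \<in> borel_measurable (PiM (insert (Suc n) {1..n}) (\<lambda>_. lborel))"
    using assms unfolding path_space_def atLeastAtMost_Suc_insert
    by (subst measurable_cong_sets[OF sets_PiM_cong refl]) auto
  from lborel_product.product_nn_integral_insert[OF _ _ this]
  show ?thesis
    unfolding atLeastAtMost_Suc_insert by simp
qed

text \<open>The density at \<open>y\<close> of the path \<open>x\<close> disturbed by the noise.\<close>

definition likelihood :: "nat \<Rightarrow> (nat \<Rightarrow> real ^ 'd) \<Rightarrow> (nat \<Rightarrow> real ^ 'd) \<Rightarrow> real" where
  "likelihood n x y = (\<Prod>s = 1..n. g (y s - x s))"

lemma likelihood_measurable [measurable]:
  assumes "f \<in> M \<rightarrow>\<^sub>M path_space n" "h \<in> M \<rightarrow>\<^sub>M path_space n"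
  shows "(\<lambda>w. likelihood n (f w) (h w)) \<in> borel_measurable M"
  unfolding likelihood_def
proof (intro borel_measurable_prod measurable_compose[OF _ g_measurable] borel_measurable_diff)
  fix s assume "s \<in> {1..n}"
  then show "(\<lambda>w. h w s) \<in> borel_measurable M" "(\<lambda>w. f w s) \<in> borel_measurable M"
    using path_component_measurable'[OF _ _ assms(1)] path_component_measurable'[OF _ _ assms(2)] by auto
qed

lemma likelihood_pos: "0 < likelihood n x y"
  unfolding likelihood_def by (intro prod_pos) (simp add: g_pos)

lemma likelihood_le: "likelihood n x y \<le> B ^ n"
proof -
  have "likelihood n x y \<le> (\<Prod>s = 1..n. B)"
    unfolding likelihood_def by (intro prod_mono) (auto simp: g_pos less_imp_le g_le)
  then show ?thesis by simp
qed

lemma path_noise_translate: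
  assumes [measurable]: "f \<in> borel_measurable (path_space n)"
  shows "(\<integral>\<^sup>+z. f (path_add n x z) \<partial>path_noise n) =
    (\<integral>\<^sup>+y. ennreal (likelihood n x y) * f y \<partial>PiM {1..n} (\<lambda>_. lborel))"
  using assms
proof (induction n arbitrary: f)
  case 0
  then show ?case
    by (simp add: path_noise_def PiM_empty nn_integral_count_space_finite likelihood_def restrict_def path_add_def)
next
  case (Suc n)
  note [measurable] = Suc.prems
  let ?c = "x (Suc n)"
  let ?f = "\<lambda>y. \<integral>\<^sup>+b. ennreal (g (b - ?c)) * f (y(Suc n := b)) \<partial>lborel"
  have "(\<integral>\<^sup>+z. f (path_add (Suc n) x z) \<partial>path_noise (Suc n)) =
    (\<integral>\<^sup>+z. \<integral>\<^sup>+b. f (path_add (Suc n) x (z(Suc n := b))) \<partial>noise \<partial>path_noise n)"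
    by (rule path_noise_Suc) measurable
  also have "\<dots> = (\<integral>\<^sup>+z. \<integral>\<^sup>+b. f ((path_add n x z)(Suc n := ?c + b)) \<partial>noise \<partial>path_noise n)"
    by (intro nn_integral_cong arg_cong[where f=f]) (auto simp: path_add_def fun_eq_iff restrict_def)
  also have "\<dots> = (\<integral>\<^sup>+z. ?f (path_add n x z) \<partial>path_noise n)"
  proof (intro nn_integral_cong noise_translate)
    fix z :: "nat \<Rightarrow> real ^ 'd"
    have y: "path_add n x z \<in> space (path_space n)" by simp
    show "(\<lambda>b. f ((path_add n x z)(Suc n := b))) \<in> borel_measurable borel"
      by (rule measurable_compose[OF path_extend_measurable[OF measurable_const[OF y] measurable_ident_sets[OF refl]] Suc.prems])
  qed
  also have "\<dots> = (\<integral>\<^sup>+y. ennreal (likelihood n x y) * ?f y \<partial>PiM {1..n} (\<lambda>_. lborel))"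
    by (rule Suc.IH) measurable
  also have "\<dots> = (\<integral>\<^sup>+y. \<integral>\<^sup>+b. ennreal (likelihood (Suc n) x (y(Suc n := b))) * f (y(Suc n := b)) \<partial>lborel \<partial>PiM {1..n} (\<lambda>_. lborel))"
  proof (rule nn_integral_cong)
    fix y :: "nat \<Rightarrow> real ^ 'd" assume y: "y \<in> space (PiM {1..n} (\<lambda>_. lborel))"
    then have y': "y \<in> space (path_space n)" by (simp add: path_space_def space_PiM)
    have [measurable]: "(\<lambda>b. f (y(Suc n := b))) \<in> borel_measurable borel"
      using y' by (intro measurable_compose[OF path_extend_measurable Suc.prems] measurable_const) auto
    have eq: "likelihood (Suc n) x (y(Suc n := b)) = likelihood n x y * g (b - ?c)" for b
      by (simp add: likelihood_def)
    show "ennreal (likelihood n x y) * ?f y = (\<integral>\<^sup>+b. ennreal (likelihood (Suc n) x (y(Suc n := b))) * f (y(Suc n := b)) \<partial>lborel)"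
      by (subst nn_integral_cmult[symmetric])
         (auto simp: eq ennreal_mult less_imp_le[OF likelihood_pos] less_imp_le[OF g_pos] mult.assoc)
  qed
  also have "\<dots> = (\<integral>\<^sup>+y. ennreal (likelihood (Suc n) x y) * f y \<partial>PiM {1..Suc n} (\<lambda>_. lborel))"
  proof (rule lborel_paths_Suc[symmetric])
    have "(\<lambda>s\<in>{1..Suc n}. x s) \<in> space (path_space (Suc n))" by (simp add: path_space_def space_PiM)
    then have "likelihood (Suc n) (\<lambda>s\<in>{1..Suc n}. x s) \<in> borel_measurable (path_space (Suc n))"
      by measurable
    then have [measurable]: "likelihood (Suc n) x \<in> borel_measurable (path_space (Suc n))"
      by (simp add: likelihood_def[abs_def])
    show "(\<lambda>y. ennreal (likelihood (Suc n) x y) * f y) \<in> borel_measurable (path_space (Suc n))"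
      by measurable
  qed
  finally show ?case .
qed

text \<open>Bayes' formula. If \<open>X\<close> has law \<open>M\<close> and \<open>Y\<close> is \<open>X\<close> plus independent noise, then the law of \<open>X\<close> given
  \<open>Y = y\<close> has density proportional to \<open>likelihood n x y\<close> with respect to \<open>M\<close>. Positivity and boundedness
  of the noise density make the normalising constant positive and finite for every \<open>y\<close>, so that no
  exceptional null set occurs.\<close>

lemma posterior_exists:
  fixes M :: "(nat \<Rightarrow> real ^ 'd) measure"
  assumes "prob_space M" and sets_M [measurable_cong]: "sets M = sets (path_space n)"
  obtains post where "post \<in> path_space n \<rightarrow>\<^sub>M prob_algebra (path_space n)"
    "\<And>f. f \<in> borel_measurable (path_pairs n) \<Longrightarrow>
      (\<integral>\<^sup>+x. \<integral>\<^sup>+z. f (x, path_add n x z) \<partial>path_noise n \<partial>M) =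
      (\<integral>\<^sup>+x. \<integral>\<^sup>+z. \<integral>\<^sup>+x'. f (x', path_add n x z) \<partial>post (path_add n x z) \<partial>path_noise n \<partial>M)"
proof -
  interpret M: prob_space M by fact
  let ?\<Lambda> = "PiM {1..n} (\<lambda>_. lborel) :: (nat \<Rightarrow> real ^ 'd) measure"
  have [measurable_cong]: "sets ?\<Lambda> = sets (path_space n)" by (rule sets_lborel_paths)
  interpret \<Lambda>: sigma_finite_measure ?\<Lambda>
    by (rule lborel_product.sigma_finite) simp
  interpret P: pair_sigma_finite M ?\<Lambda> ..
  define q where "q y = (\<integral>\<^sup>+x. ennreal (likelihood n x y) \<partial>M)" for y
  have [measurable]: "q \<in> borel_measurable (path_space n)"
    unfolding q_def by measurable
  have q_fin: "q y \<noteq> \<infinity>" for y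
  proof -
    have "q y \<le> (\<integral>\<^sup>+x. ennreal (B ^ n) \<partial>M)"
      unfolding q_def by (intro nn_integral_mono ennreal_leI likelihood_le)
    also have "\<dots> < \<infinity>" by (simp add: M.emeasure_space_1)
    finally show ?thesis by simp
  qed
  have q_pos: "q y \<noteq> 0" if "y \<in> space (path_space n)" for y
  proof
    assume "q y = 0"
    then have "AE x in M. ennreal (likelihood n x y) = 0"
      unfolding q_def using that by (subst (asm) nn_integral_0_iff_AE) auto
    then have "AE x in M. False"
      by eventually_elim (use likelihood_pos in \<open>simp add: ennreal_eq_0_iff not_le[symmetric]\<close>)
    then show False by simp
  qed
  define post where "post y = density M (\<lambda>x. ennreal (likelihood n x y) / q y)" for y
  have post_int: "(\<integral>\<^sup>+x. f x \<partial>post y) = (\<integral>\<^sup>+x. ennreal (likelihood n x y) * f x \<partial>M) / q y"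
    if [measurable]: "f \<in> borel_measurable (path_space n)" and y: "y \<in> space (path_space n)" for f y
  proof -
    have "(\<integral>\<^sup>+x. f x \<partial>post y) = (\<integral>\<^sup>+x. ennreal (likelihood n x y) / q y * f x \<partial>M)"
      unfolding post_def using y by (subst nn_integral_density) auto
    also have "\<dots> = (\<integral>\<^sup>+x. (ennreal (likelihood n x y) * f x) / q y \<partial>M)"
      by (simp add: divide_ennreal_def mult_ac)
    finally show ?thesis using y by (subst (asm) nn_integral_divide) auto
  qed
  have post[measurable]: "post \<in> path_space n \<rightarrow>\<^sub>M prob_algebra (path_space n)"
    unfolding post_def
  proof (rule measurable_density_prob_algebra)
    show "(\<lambda>y. M) \<in> path_space n \<rightarrow>\<^sub>M prob_algebra (path_space n)"
      using assms by (intro measurable_const) (simp add: space_prob_algebra)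
    show "(\<lambda>(y, x). ennreal (likelihood n x y) / q y) \<in> borel_measurable (path_pairs n)"
      by measurable
    fix y :: "nat \<Rightarrow> real ^ 'd" assume y: "y \<in> space (path_space n)"
    have "emeasure (post y) (space (post y)) = (\<integral>\<^sup>+x. 1 \<partial>post y)" by simp
    also have "\<dots> = q y / q y"
      using y by (subst post_int) (auto simp: q_def)
    also have "\<dots> = 1" using q_fin q_pos[OF y] by (simp add: ennreal_divide_self less_top)
    finally show "prob_space (density M (\<lambda>x. ennreal (likelihood n x y) / q y))"
      by (intro prob_spaceI) (simp add: post_def)
  qed
  show ?thesis
  proof (rule that[OF post])
    fix f :: "(nat \<Rightarrow> real ^ 'd) \<times> (nat \<Rightarrow> real ^ 'd) \<Rightarrow> ennreal" assume f[measurable]: "f \<in> borel_measurable (path_pairs n)"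
    have sp: "space M = space (path_space n)" by (rule sets_eq_imp_space_eq[OF sets_M])
    have joint: "(\<integral>\<^sup>+x. \<integral>\<^sup>+z. h (x, path_add n x z) \<partial>path_noise n \<partial>M) =
      (\<integral>\<^sup>+y. \<integral>\<^sup>+x. ennreal (likelihood n x y) * h (x, y) \<partial>M \<partial>?\<Lambda>)"
      if [measurable]: "h \<in> borel_measurable (path_pairs n)" for h
    proof -
      have "(\<integral>\<^sup>+x. \<integral>\<^sup>+z. h (x, path_add n x z) \<partial>path_noise n \<partial>M) =
        (\<integral>\<^sup>+x. \<integral>\<^sup>+y. ennreal (likelihood n x y) * h (x, y) \<partial>?\<Lambda> \<partial>M)"
        using sp by (intro nn_integral_cong path_noise_translate) measurable
      also have "\<dots> = (\<integral>\<^sup>+y. \<integral>\<^sup>+x. ennreal (likelihood n x y) * h (x, y) \<partial>M \<partial>?\<Lambda>)"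
        by (rule P.Fubini'[symmetric]) measurable
      finally show ?thesis .
    qed
    have "(\<integral>\<^sup>+x. \<integral>\<^sup>+z. \<integral>\<^sup>+x'. f (x', path_add n x z) \<partial>post (path_add n x z) \<partial>path_noise n \<partial>M) =
      (\<integral>\<^sup>+y. \<integral>\<^sup>+x. ennreal (likelihood n x y) * (\<integral>\<^sup>+x'. f (x', y) \<partial>post y) \<partial>M \<partial>?\<Lambda>)"
      using joint[of "\<lambda>(x, y). \<integral>\<^sup>+x'. f (x', y) \<partial>post y"] by (simp add: split_beta')
    also have "\<dots> = (\<integral>\<^sup>+y. \<integral>\<^sup>+x. ennreal (likelihood n x y) * f (x, y) \<partial>M \<partial>?\<Lambda>)"
    proof (rule nn_integral_cong)
      fix y assume "y \<in> space ?\<Lambda>"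
      then have y: "y \<in> space (path_space n)" by (simp add: path_space_def space_PiM)
      have "(\<integral>\<^sup>+x. ennreal (likelihood n x y) * (\<integral>\<^sup>+x'. f (x', y) \<partial>post y) \<partial>M) = q y * (\<integral>\<^sup>+x'. f (x', y) \<partial>post y)"
        unfolding q_def using y by (intro nn_integral_multc) measurable
      also have "\<dots> = q y * ((\<integral>\<^sup>+x. ennreal (likelihood n x y) * f (x, y) \<partial>M) / q y)"
        using y by (subst post_int) auto
      also have "\<dots> = (\<integral>\<^sup>+x. ennreal (likelihood n x y) * f (x, y) \<partial>M)"
        using q_fin[of y] q_pos[OF y] by (simp add: ennreal_times_divide ennreal_mult_divide_eq mult.commute[of "q y"])
      finally show "(\<integral>\<^sup>+x. ennreal (likelihood n x y) * (\<integral>\<^sup>+x'. f (x', y) \<partial>post y) \<partial>M) =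
        (\<integral>\<^sup>+x. ennreal (likelihood n x y) * f (x, y) \<partial>M)" .
    qed
    also have "\<dots> = (\<integral>\<^sup>+x. \<integral>\<^sup>+z. f (x, path_add n x z) \<partial>path_noise n \<partial>M)"
      by (rule joint[symmetric]) fact
    finally show "(\<integral>\<^sup>+x. \<integral>\<^sup>+z. f (x, path_add n x z) \<partial>path_noise n \<partial>M) =
      (\<integral>\<^sup>+x. \<integral>\<^sup>+z. \<integral>\<^sup>+x'. f (x', path_add n x z) \<partial>post (path_add n x z) \<partial>path_noise n \<partial>M)" by simp
  qed
qed

end

section \<open>Kernels of the law of the noisy path\<close>

lemma path_prefix_add:
  "m \<le> n \<Longrightarrow> path_prefix m (path_add n x z) = path_add m (path_prefix m x) (path_prefix m z)"
  by (auto simp: path_add_def fun_eq_iff restrict_def)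

context noise_density
begin

lemma path_noise_prefix:
  assumes "m \<le> n" and [measurable]: "f \<in> borel_measurable (path_space m)"
  shows "(\<integral>\<^sup>+z. f (path_prefix m z) \<partial>path_noise n) = (\<integral>\<^sup>+z. f z \<partial>path_noise m)"
proof -
  interpret product_prob_space "\<lambda>_::nat. noise" "{1..n}" by unfold_locales
  have "path_noise m = distr (path_noise n) (path_noise m) (path_prefix m)"
    unfolding path_noise_def using \<open>m \<le> n\<close> by (intro distr_PiM_restrict_finite[symmetric]) auto
  moreover have "path_prefix m \<in> path_noise n \<rightarrow>\<^sub>M path_noise m"
    using path_prefix_measurable[OF \<open>m \<le> n\<close>] by (simp cong: measurable_cong_sets)
  moreover have "f \<in> borel_measurable (path_noise m)" by measurable
  ultimately show ?thesis
    by (metis nn_integral_distr)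
qed

text \<open>The law of a path with law \<open>\<mu>\<close> plus independent noise.\<close>

abbreviation noisy :: "nat \<Rightarrow> (nat \<Rightarrow> real ^ 'd) measure \<Rightarrow> (nat \<Rightarrow> real ^ 'd) measure" where
  "noisy n \<mu> \<equiv> path_convolution n \<mu> (path_noise n)"

lemma sets_noisy [simp, measurable_cong]: "sets (noisy n \<mu>) = sets (path_space n)"
  by (simp add: path_convolution_def)

lemma
  fixes \<mu> :: "(nat \<Rightarrow> real ^ 'd) measure"
  assumes "prob_space \<mu>" and \<mu>[measurable_cong]: "sets \<mu> = sets (path_space n)"
  shows prob_space_noisy: "prob_space (noisy n \<mu>)"
    and noisy_nn_integral: "\<And>f. f \<in> borel_measurable (path_space n) \<Longrightarrow>
      (\<integral>\<^sup>+y. f y \<partial>noisy n \<mu>) = (\<integral>\<^sup>+x. \<integral>\<^sup>+z. f (path_add n x z) \<partial>path_noise n \<partial>\<mu>)"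
proof -
  interpret \<mu>: prob_space \<mu> by fact
  interpret G: prob_space "path_noise n" by (rule prob_space_path_noise)
  interpret pair_prob_space \<mu> "path_noise n" ..
  have [measurable]: "(\<lambda>(x, z). path_add n x z) \<in> \<mu> \<Otimes>\<^sub>M path_noise n \<rightarrow>\<^sub>M path_space n"
    unfolding split_beta' by measurable
  have conv: "noisy n \<mu> = distr (\<mu> \<Otimes>\<^sub>M path_noise n) (path_space n) (\<lambda>(x, z). path_add n x z)"
    by (simp add: path_convolution_def path_add_def)
  show "prob_space (noisy n \<mu>)"
    unfolding conv by (rule prob_space_distr) measurable
  fix f :: "(nat \<Rightarrow> real ^ 'd) \<Rightarrow> ennreal" assume [measurable]: "f \<in> borel_measurable (path_space n)"
  have "(\<integral>\<^sup>+y. f y \<partial>noisy n \<mu>) = (\<integral>\<^sup>+w. f (path_add n (fst w) (snd w)) \<partial>(\<mu> \<Otimes>\<^sub>M path_noise n))"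
    unfolding conv by (subst nn_integral_distr) (auto simp: split_beta')
  also have "\<dots> = (\<integral>\<^sup>+x. \<integral>\<^sup>+z. f (path_add n x z) \<partial>path_noise n \<partial>\<mu>)"
    by (subst G.nn_integral_fst[symmetric]) auto
  finally show "(\<integral>\<^sup>+y. f y \<partial>noisy n \<mu>) = (\<integral>\<^sup>+x. \<integral>\<^sup>+z. f (path_add n x z) \<partial>path_noise n \<partial>\<mu>)" .
qed

lemma noisy_prefix:
  assumes "prob_space \<mu>" and \<mu>[measurable_cong]: "sets \<mu> = sets (path_space T)"
    and "n \<le> T" and f[measurable]: "f \<in> borel_measurable (path_space n)"
  shows "(\<integral>\<^sup>+y. f (path_prefix n y) \<partial>noisy T \<mu>) = (\<integral>\<^sup>+x. \<integral>\<^sup>+z. f (path_add n (path_prefix n x) z) \<partial>path_noise n \<partial>\<mu>)"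
proof -
  note [measurable] = path_prefix_measurable[OF \<open>n \<le> T\<close>]
  have "(\<integral>\<^sup>+y. f (path_prefix n y) \<partial>noisy T \<mu>) =
      (\<integral>\<^sup>+x. \<integral>\<^sup>+z. f (path_add n (path_prefix n x) (path_prefix n z)) \<partial>path_noise T \<partial>\<mu>)"
  proof -
    have "(\<lambda>y. f (path_prefix n y)) \<in> borel_measurable (path_space T)" by measurable
    from noisy_nn_integral[OF assms(1) \<mu> this] show ?thesis
      by (simp only: path_prefix_add[OF \<open>n \<le> T\<close>])
  qed
  also have "\<dots> = (\<integral>\<^sup>+x. \<integral>\<^sup>+z. f (path_add n (path_prefix n x) z) \<partial>path_noise n \<partial>\<mu>)"
  proof (rule nn_integral_cong)
    fix x assume "x \<in> space \<mu>"
    then have "x \<in> space (path_space T)" using sets_eq_imp_space_eq[OF \<mu>] by simp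
    then have x: "path_prefix n x \<in> space (path_space n)"
      using path_prefix_measurable[OF \<open>n \<le> T\<close>] by (rule measurable_space[rotated])
    show "(\<integral>\<^sup>+z. f (path_add n (path_prefix n x) (path_prefix n z)) \<partial>path_noise T) =
       (\<integral>\<^sup>+z. f (path_add n (path_prefix n x) z) \<partial>path_noise n)"
      by (rule path_noise_prefix[OF \<open>n \<le> T\<close> measurable_compose[OF path_add_const_measurable f]])
  qed
  finally show ?thesis .
qed

lemma noisy_extend:
  assumes "prob_space \<mu>" and \<mu>[measurable_cong]: "sets \<mu> = sets (path_space T)"
    and "n < T" and f[measurable]: "f \<in> borel_measurable (path_space n \<Otimes>\<^sub>M borel)"
  shows "(\<integral>\<^sup>+y. f (path_prefix n y, y (Suc n)) \<partial>noisy T \<mu>) =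
    (\<integral>\<^sup>+x. \<integral>\<^sup>+z. \<integral>\<^sup>+b. f (path_add n (path_prefix n x) z, x (Suc n) + b) \<partial>noise \<partial>path_noise n \<partial>\<mu>)"
proof -
  let ?f = "\<lambda>y. f (path_prefix n y, y (Suc n))"
  have "Suc n \<le> T" using \<open>n < T\<close> by simp
  have [measurable]: "path_prefix n \<in> path_space (Suc n) \<rightarrow>\<^sub>M path_space n"
    "(\<lambda>x. x (Suc n)) \<in> path_space (Suc n) \<rightarrow>\<^sub>M borel"
    by (rule path_prefix_measurable path_component_measurable; simp)+
  have "(\<integral>\<^sup>+y. f (path_prefix n y, y (Suc n)) \<partial>noisy T \<mu>) = (\<integral>\<^sup>+y. ?f (path_prefix (Suc n) y) \<partial>noisy T \<mu>)"
    by (simp add: path_prefix_prefix del: One_nat_def)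
  also have "\<dots> = (\<integral>\<^sup>+x. \<integral>\<^sup>+z. ?f (path_add (Suc n) (path_prefix (Suc n) x) z) \<partial>path_noise (Suc n) \<partial>\<mu>)"
    by (rule noisy_prefix[OF assms(1) \<mu> \<open>Suc n \<le> T\<close>]) measurable
  also have "\<dots> = (\<integral>\<^sup>+x. \<integral>\<^sup>+z. \<integral>\<^sup>+b. ?f (path_add (Suc n) (path_prefix (Suc n) x) (z(Suc n := b))) \<partial>noise \<partial>path_noise n \<partial>\<mu>)"
  proof (rule nn_integral_cong)
    fix x assume "x \<in> space \<mu>"
    then have "x \<in> space (path_space T)" using sets_eq_imp_space_eq[OF \<mu>] by simp
    then have x: "path_prefix (Suc n) x \<in> space (path_space (Suc n))"
      using path_prefix_measurable[OF \<open>Suc n \<le> T\<close>] by (rule measurable_space[rotated])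
    show "(\<integral>\<^sup>+z. ?f (path_add (Suc n) (path_prefix (Suc n) x) z) \<partial>path_noise (Suc n)) =
       (\<integral>\<^sup>+z. \<integral>\<^sup>+b. ?f (path_add (Suc n) (path_prefix (Suc n) x) (z(Suc n := b))) \<partial>noise \<partial>path_noise n)"
      by (rule path_noise_Suc) (use x in measurable)
  qed
  also have "\<dots> = (\<integral>\<^sup>+x. \<integral>\<^sup>+z. \<integral>\<^sup>+b. f (path_add n (path_prefix n x) z, x (Suc n) + b) \<partial>noise \<partial>path_noise n \<partial>\<mu>)"
    by (intro nn_integral_cong arg_cong[where f=f]) (auto simp: path_add_def fun_eq_iff restrict_def)
  finally show ?thesis .
qed

text \<open>The conditional law of the next noisy value given the noisy past \<open>y\<close>: draw the undisturbed past \<open>x\<close>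
  from the posterior, the next undisturbed value from \<open>K x\<close>, and add fresh noise.\<close>

definition noisy_kernel ::
  "((nat \<Rightarrow> real ^ 'd) \<Rightarrow> (nat \<Rightarrow> real ^ 'd) measure) \<Rightarrow> ((nat \<Rightarrow> real ^ 'd) \<Rightarrow> (real ^ 'd) measure) \<Rightarrow>
    (nat \<Rightarrow> real ^ 'd) \<Rightarrow> (real ^ 'd) measure" where
  "noisy_kernel post K y = post y \<bind> (\<lambda>x. K x \<bind> (\<lambda>a. distr noise borel (\<lambda>b. a + b)))"

lemma noise_shift_kernel [measurable]: "(\<lambda>a. distr noise borel (\<lambda>b. a + b)) \<in> borel \<rightarrow>\<^sub>M prob_algebra borel"
proof (rule measurable_distr_prob_space2[where M=borel])
  show "(\<lambda>a. noise) \<in> borel \<rightarrow>\<^sub>M prob_algebra borel"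
    by (intro measurable_const) (simp add: space_prob_algebra prob_space_noise)
qed measurable

lemma noisy_kernel_measurable:
  assumes [measurable]: "post \<in> path_space n \<rightarrow>\<^sub>M prob_algebra (path_space n)" "K \<in> path_space n \<rightarrow>\<^sub>M prob_algebra borel"
  shows "noisy_kernel post K \<in> path_space n \<rightarrow>\<^sub>M prob_algebra borel"
  unfolding noisy_kernel_def[abs_def]
  by (intro measurable_bind_prob_space[where N="path_space n"] measurable_bind_prob_space[where N=borel]) measurable

lemma noisy_kernel_nn_integral:
  assumes post[measurable]: "post \<in> path_space n \<rightarrow>\<^sub>M prob_algebra (path_space n)"
    and K[measurable]: "K \<in> path_space n \<rightarrow>\<^sub>M prob_algebra borel"
    and y: "y \<in> space (path_space n)" and f[measurable]: "f \<in> borel_measurable borel"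
  shows "(\<integral>\<^sup>+a. f a \<partial>noisy_kernel post K y) = (\<integral>\<^sup>+x. \<integral>\<^sup>+a. \<integral>\<^sup>+b. f (a + b) \<partial>noise \<partial>K x \<partial>post y)"
  unfolding noisy_kernel_def nn_integral_bind_bind[OF prob_algebra_sets[OF post y] K noise_shift_kernel f]
  by (intro nn_integral_cong nn_integral_distr) auto

text \<open>The kernel \<open>post\<close> is a conditional law of the first \<open>n\<close> undisturbed values given the first \<open>n\<close> noisy
  values, stated through integrals of joint functions of the two.\<close>

definition is_posterior ::
  "nat \<Rightarrow> (nat \<Rightarrow> real ^ 'd) measure \<Rightarrow> ((nat \<Rightarrow> real ^ 'd) \<Rightarrow> (nat \<Rightarrow> real ^ 'd) measure) \<Rightarrow> bool" where
  "is_posterior n \<mu> post \<longleftrightarrow>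
    post \<in> path_space n \<rightarrow>\<^sub>M prob_algebra (path_space n) \<and>
    (\<forall>f \<in> borel_measurable (path_pairs n).
      (\<integral>\<^sup>+x. \<integral>\<^sup>+z. f (path_prefix n x, path_add n (path_prefix n x) z) \<partial>path_noise n \<partial>\<mu>) =
      (\<integral>\<^sup>+x. \<integral>\<^sup>+z. \<integral>\<^sup>+x'. f (x', path_add n (path_prefix n x) z) \<partial>post (path_add n (path_prefix n x) z) \<partial>path_noise n \<partial>\<mu>))"

lemma is_posterior_exists:
  assumes "prob_space \<mu>" and \<mu>[measurable_cong]: "sets \<mu> = sets (path_space T)" and "n \<le> T"
  shows "\<exists>post. is_posterior n \<mu> post"
proof -
  interpret prob_space \<mu> by fact
  interpret G: prob_space "path_noise n" by (rule prob_space_path_noise)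
  note [measurable] = path_prefix_measurable[OF \<open>n \<le> T\<close>]
  let ?M = "distr \<mu> (path_space n) (path_prefix n)"
  have "prob_space ?M" by (rule prob_space_distr) measurable
  then obtain post where post[measurable]: "post \<in> path_space n \<rightarrow>\<^sub>M prob_algebra (path_space n)"
    and eq: "\<And>f. f \<in> borel_measurable (path_pairs n) \<Longrightarrow>
      (\<integral>\<^sup>+x. \<integral>\<^sup>+z. f (x, path_add n x z) \<partial>path_noise n \<partial>?M) =
      (\<integral>\<^sup>+x. \<integral>\<^sup>+z. \<integral>\<^sup>+x'. f (x', path_add n x z) \<partial>post (path_add n x z) \<partial>path_noise n \<partial>?M)"
    by (rule posterior_exists[OF _ sets_distr]) (rule that)
  have "is_posterior n \<mu> post"
    unfolding is_posterior_def
  proof (intro conjI ballI post)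
    fix f :: "(nat \<Rightarrow> real ^ 'd) \<times> (nat \<Rightarrow> real ^ 'd) \<Rightarrow> ennreal" assume f[measurable]: "f \<in> borel_measurable (path_pairs n)"
    have 1: "(\<lambda>x. \<integral>\<^sup>+z. f (x, path_add n x z) \<partial>path_noise n) \<in> borel_measurable ?M"
      by measurable
    have "(\<lambda>y. \<integral>\<^sup>+x'. f (x', y) \<partial>post y) \<in> borel_measurable (path_space n)" by measurable
    note [measurable] = measurable_compose[OF _ this]
    have 2: "(\<lambda>x. \<integral>\<^sup>+z. \<integral>\<^sup>+x'. f (x', path_add n x z) \<partial>post (path_add n x z) \<partial>path_noise n) \<in> borel_measurable ?M"
      by measurable
    show "(\<integral>\<^sup>+x. \<integral>\<^sup>+z. f (path_prefix n x, path_add n (path_prefix n x) z) \<partial>path_noise n \<partial>\<mu>) =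
      (\<integral>\<^sup>+x. \<integral>\<^sup>+z. \<integral>\<^sup>+x'. f (x', path_add n (path_prefix n x) z) \<partial>post (path_add n (path_prefix n x) z) \<partial>path_noise n \<partial>\<mu>)"
    proof -
      have p: "path_prefix n \<in> \<mu> \<rightarrow>\<^sub>M path_space n" by measurable
      show ?thesis using eq[OF f] unfolding nn_integral_distr[OF p 1] nn_integral_distr[OF p 2] .
    qed
  qed
  then show ?thesis by (rule exI[of _ post])
qed

lemma path_kernel_noisy:
  assumes "prob_space \<mu>" and \<mu>[measurable_cong]: "sets \<mu> = sets (path_space T)" and "n < T"
    and K: "path_kernel n \<mu> K" and post: "is_posterior n \<mu> post"
  shows "path_kernel n (noisy T \<mu>) (noisy_kernel post K)"
  unfolding path_kernel_def
proof (rule cond_lawI)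
  interpret prob_space \<mu> by fact
  interpret G: prob_space "path_noise n" by (rule prob_space_path_noise)
  note K_m[measurable] = path_kernel_measurable[OF K]
  have post_m[measurable]: "post \<in> path_space n \<rightarrow>\<^sub>M prob_algebra (path_space n)"
    using post by (simp add: is_posterior_def)
  show "noisy_kernel post K \<in> path_space n \<rightarrow>\<^sub>M prob_algebra borel"
    by (rule noisy_kernel_measurable) measurable
  have nT: "n \<le> T" using \<open>n < T\<close> by simp
  note pre[measurable] = path_prefix_measurable[OF nT]
  have [measurable]: "(\<lambda>x. x (Suc n)) \<in> path_space T \<rightarrow>\<^sub>M borel"
    using \<open>n < T\<close> by (intro path_component_measurable) auto
  show "path_prefix n \<in> noisy T \<mu> \<rightarrow>\<^sub>M path_space n" "(\<lambda>x. x (Suc n)) \<in> noisy T \<mu> \<rightarrow>\<^sub>M borel" by measurable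
  fix f :: "(nat \<Rightarrow> real ^ 'd) \<times> (real ^ 'd) \<Rightarrow> ennreal" assume f[measurable]: "f \<in> borel_measurable (path_space n \<Otimes>\<^sub>M borel)"
  define h where "h x y = (\<integral>\<^sup>+a. \<integral>\<^sup>+b. f (y, a + b) \<partial>noise \<partial>K x)" for x y
  have h[measurable]: "(\<lambda>w. h (fst w) (snd w)) \<in> borel_measurable (path_pairs n)"
    unfolding h_def by measurable
  have h'[measurable]: "(\<lambda>w. h (u w) (v w)) \<in> borel_measurable M"
    if "u \<in> M \<rightarrow>\<^sub>M path_space n" "v \<in> M \<rightarrow>\<^sub>M path_space n" for u v and M :: "'z measure"
    using measurable_compose[OF measurable_Pair[OF that] h] by simp
  have "(\<integral>\<^sup>+y. f (path_prefix n y, y (Suc n)) \<partial>noisy T \<mu>) =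
    (\<integral>\<^sup>+x. \<integral>\<^sup>+z. \<integral>\<^sup>+b. f (path_add n (path_prefix n x) z, x (Suc n) + b) \<partial>noise \<partial>path_noise n \<partial>\<mu>)"
    by (rule noisy_extend) fact+
  also have "\<dots> = (\<integral>\<^sup>+x. \<integral>\<^sup>+a. \<integral>\<^sup>+z. \<integral>\<^sup>+b. f (path_add n (path_prefix n x) z, a + b) \<partial>noise \<partial>path_noise n \<partial>K (path_prefix n x) \<partial>\<mu>)"
    by (rule path_kernel_nn_integral[OF K assms(1) \<mu> \<open>n < T\<close>]) measurable
  also have "\<dots> = (\<integral>\<^sup>+x. \<integral>\<^sup>+z. h (path_prefix n x) (path_add n (path_prefix n x) z) \<partial>path_noise n \<partial>\<mu>)"
  proof (rule nn_integral_cong)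
    fix x assume "x \<in> space \<mu>"
    then have "x \<in> space (path_space T)" using sets_eq_imp_space_eq[OF \<mu>] by simp
    then have x: "path_prefix n x \<in> space (path_space n)" by (rule measurable_space[OF pre])
    interpret Kx: prob_space "K (path_prefix n x)" by (rule prob_algebra_prob[OF K_m x])
    interpret pair_sigma_finite "K (path_prefix n x)" "path_noise n" ..
    note [measurable_cong] = prob_algebra_sets[OF K_m x]
    show "(\<integral>\<^sup>+a. \<integral>\<^sup>+z. \<integral>\<^sup>+b. f (path_add n (path_prefix n x) z, a + b) \<partial>noise \<partial>path_noise n \<partial>K (path_prefix n x)) =
      (\<integral>\<^sup>+z. h (path_prefix n x) (path_add n (path_prefix n x) z) \<partial>path_noise n)"
      unfolding h_def by (rule Fubini'[symmetric]) (use x in measurable)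
  qed
  also have "\<dots> = (\<integral>\<^sup>+x. \<integral>\<^sup>+z. \<integral>\<^sup>+x'. h x' (path_add n (path_prefix n x) z) \<partial>post (path_add n (path_prefix n x) z) \<partial>path_noise n \<partial>\<mu>)"
    using bspec[OF conjunct2[OF post[unfolded is_posterior_def]] h] by (simp only: fst_conv snd_conv)
  also have "\<dots> = (\<integral>\<^sup>+y. \<integral>\<^sup>+x'. h x' (path_prefix n y) \<partial>post (path_prefix n y) \<partial>noisy T \<mu>)"
  proof (rule noisy_prefix[OF assms(1) \<mu> nT, symmetric])
    show "(\<lambda>y. \<integral>\<^sup>+x'. h x' y \<partial>post y) \<in> borel_measurable (path_space n)"
      by (rule nn_integral_kernel_measurable[OF _ post_m]) (simp add: split_beta' h')
  qed
  also have "\<dots> = (\<integral>\<^sup>+y. \<integral>\<^sup>+b. f (path_prefix n y, b) \<partial>noisy_kernel post K (path_prefix n y) \<partial>noisy T \<mu>)"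
  proof (rule nn_integral_cong)
    fix y assume "y \<in> space (noisy T \<mu>)"
    then have "y \<in> space (path_space T)" using sets_eq_imp_space_eq[OF sets_noisy] by auto
    then have y: "path_prefix n y \<in> space (path_space n)" by (rule measurable_space[OF pre])
    show "(\<integral>\<^sup>+x'. h x' (path_prefix n y) \<partial>post (path_prefix n y)) = (\<integral>\<^sup>+b. f (path_prefix n y, b) \<partial>noisy_kernel post K (path_prefix n y))"
      unfolding h_def by (rule noisy_kernel_nn_integral[OF post_m K_m y, symmetric]) (use y in measurable)
  qed
  finally show "(\<integral>\<^sup>+y. f (path_prefix n y, y (Suc n)) \<partial>noisy T \<mu>) =
    (\<integral>\<^sup>+y. \<integral>\<^sup>+b. f (path_prefix n y, b) \<partial>noisy_kernel post K (path_prefix n y) \<partial>noisy T \<mu>)" .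
qed

end

section \<open>Bi-causal couplings built step by step\<close>

text \<open>The mean distance of the two components.\<close>

abbreviation pair_cost :: "('a::real_normed_vector \<times> 'a) measure \<Rightarrow> ennreal" where
  "pair_cost \<pi> \<equiv> \<integral>\<^sup>+z. ennreal (norm (fst z - snd z)) \<partial>\<pi>"

text \<open>The joint law on pairs of paths of length \<open>n\<close> is prolonged by one time step with the kernel \<open>Q\<close>.\<close>

definition extend_pair ::
  "nat \<Rightarrow> ((nat \<Rightarrow> real ^ 'd) \<times> (nat \<Rightarrow> real ^ 'd)) measure \<Rightarrow>
    ((nat \<Rightarrow> real ^ 'd) \<times> (nat \<Rightarrow> real ^ 'd) \<Rightarrow> ((real ^ 'd) \<times> (real ^ 'd)) measure) \<Rightarrow>
    ((nat \<Rightarrow> real ^ 'd) \<times> (nat \<Rightarrow> real ^ 'd)) measure" where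
  "extend_pair n \<pi> Q = \<pi> \<bind> (\<lambda>w. distr (Q w) (path_pairs (Suc n))
      (\<lambda>z. ((fst w)(Suc n := fst z), (snd w)(Suc n := snd z))))"

lemma
  fixes \<pi> :: "((nat \<Rightarrow> real ^ 'd) \<times> (nat \<Rightarrow> real ^ 'd)) measure"
  assumes \<pi>: "\<pi> \<in> space (prob_algebra (path_pairs n))"
    and Q[measurable]: "Q \<in> path_pairs n \<rightarrow>\<^sub>M prob_algebra (borel \<Otimes>\<^sub>M borel)"
  shows extend_pair_prob: "extend_pair n \<pi> Q \<in> space (prob_algebra (path_pairs (Suc n)))"
    and extend_pair_nn_integral: "\<And>f. f \<in> borel_measurable (path_pairs (Suc n)) \<Longrightarrow>
      (\<integral>\<^sup>+w. f w \<partial>extend_pair n \<pi> Q) =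
      (\<integral>\<^sup>+w. \<integral>\<^sup>+z. f ((fst w)(Suc n := fst z), (snd w)(Suc n := snd z)) \<partial>Q w \<partial>\<pi>)"
proof -
  have sets_\<pi>[measurable_cong]: "sets \<pi> = sets (path_pairs n)"
    using \<pi> by (simp add: space_prob_algebra)
  let ?k = "\<lambda>w. distr (Q w) (path_pairs (Suc n))
      (\<lambda>z. ((fst w)(Suc n := fst z), (snd w)(Suc n := snd z)))"
  have k: "?k \<in> path_pairs n \<rightarrow>\<^sub>M prob_algebra (path_pairs (Suc n))"
    by (rule measurable_distr_prob_space2[OF Q]) (simp add: split_beta')
  show "extend_pair n \<pi> Q \<in> space (prob_algebra (path_pairs (Suc n)))"
    unfolding extend_pair_def
    using prob_space_bind'[OF \<pi> k] sets_bind'[OF \<pi> k] by (simp add: space_prob_algebra)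
  fix f :: "(nat \<Rightarrow> real ^ 'd) \<times> (nat \<Rightarrow> real ^ 'd) \<Rightarrow> ennreal"
  assume f[measurable]: "f \<in> borel_measurable (path_pairs (Suc n))"
  have "(\<integral>\<^sup>+w. f w \<partial>extend_pair n \<pi> Q) = (\<integral>\<^sup>+w. \<integral>\<^sup>+z. f z \<partial>?k w \<partial>\<pi>)"
    unfolding extend_pair_def
  proof (rule nn_integral_bind_prob[OF f])
    show "?k \<in> \<pi> \<rightarrow>\<^sub>M prob_algebra (path_pairs (Suc n))"
      unfolding measurable_cong_sets[OF sets_\<pi> refl] by (rule k)
  qed
  also have "\<dots> = (\<integral>\<^sup>+w. \<integral>\<^sup>+z. f ((fst w)(Suc n := fst z), (snd w)(Suc n := snd z)) \<partial>Q w \<partial>\<pi>)"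
  proof (rule nn_integral_cong)
    fix w assume "w \<in> space \<pi>"
    then have w: "w \<in> space (path_pairs n)" using sets_eq_imp_space_eq[OF sets_\<pi>] by simp
    then have w': "fst w \<in> space (path_space n)" "snd w \<in> space (path_space n)" by (auto simp: space_pair_measure)
    note [measurable_cong] = prob_algebra_sets[OF Q w]
    show "(\<integral>\<^sup>+z. f z \<partial>?k w) = (\<integral>\<^sup>+z. f ((fst w)(Suc n := fst z), (snd w)(Suc n := snd z)) \<partial>Q w)"
      using w' by (subst nn_integral_distr) auto
  qed
  finally show "(\<integral>\<^sup>+w. f w \<partial>extend_pair n \<pi> Q) =
      (\<integral>\<^sup>+w. \<integral>\<^sup>+z. f ((fst w)(Suc n := fst z), (snd w)(Suc n := snd z)) \<partial>Q w \<partial>\<pi>)" .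
qed

text \<open>The recursion starts from the unique pair of paths of length zero.\<close>

primrec iterated_coupling ::
  "(nat \<Rightarrow> (nat \<Rightarrow> real ^ 'd) \<times> (nat \<Rightarrow> real ^ 'd) \<Rightarrow> ((real ^ 'd) \<times> (real ^ 'd)) measure) \<Rightarrow>
    nat \<Rightarrow> ((nat \<Rightarrow> real ^ 'd) \<times> (nat \<Rightarrow> real ^ 'd)) measure" where
  "iterated_coupling Q 0 = return (path_space 0 \<Otimes>\<^sub>M path_space 0) (\<lambda>_. undefined, \<lambda>_. undefined)"
| "iterated_coupling Q (Suc n) = extend_pair n (iterated_coupling Q n) (Q n)"

lemma space_path_space_0: "space (path_space 0) = {\<lambda>_. undefined}"
  by (simp add: path_space_def space_PiM)

context
  fixes Q :: "nat \<Rightarrow> (nat \<Rightarrow> real ^ 'd) \<times> (nat \<Rightarrow> real ^ 'd) \<Rightarrow> ((real ^ 'd) \<times> (real ^ 'd)) measure"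
    and T :: nat
  assumes Q: "\<And>n. n < T \<Longrightarrow> Q n \<in> path_pairs n \<rightarrow>\<^sub>M prob_algebra (borel \<Otimes>\<^sub>M borel)"
begin

lemma iterated_coupling_prob:
  "n \<le> T \<Longrightarrow> iterated_coupling Q n \<in> space (prob_algebra (path_pairs n))"
proof (induction n)
  case 0
  show ?case
    by (simp add: space_prob_algebra prob_space_return space_pair_measure space_path_space_0)
next
  case (Suc n)
  then show ?case by (simp add: extend_pair_prob Q)
qed

lemma sets_iterated_coupling:
  "n \<le> T \<Longrightarrow> sets (iterated_coupling Q n) = sets (path_pairs n)"
  using iterated_coupling_prob[of n] by (simp add: space_prob_algebra)

lemma space_iterated_coupling:
  "n \<le> T \<Longrightarrow> space (iterated_coupling Q n) = space (path_pairs n)"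
  by (rule sets_eq_imp_space_eq[OF sets_iterated_coupling])

lemma prob_space_iterated_coupling: "n \<le> T \<Longrightarrow> prob_space (iterated_coupling Q n)"
  using iterated_coupling_prob[of n] by (simp add: space_prob_algebra)

lemma iterated_coupling_Suc:
  assumes "n < T" and "f \<in> borel_measurable (path_pairs (Suc n))"
  shows "(\<integral>\<^sup>+w. f w \<partial>iterated_coupling Q (Suc n)) =
      (\<integral>\<^sup>+w. \<integral>\<^sup>+z. f ((fst w)(Suc n := fst z), (snd w)(Suc n := snd z)) \<partial>Q n w \<partial>iterated_coupling Q n)"
  using assms iterated_coupling_prob[of n] Q[of n] by (simp add: extend_pair_nn_integral)

text \<open>Later steps do not change the law of the initial segments.\<close>

lemma iterated_coupling_prefix:
  assumes "m \<le> n" "n \<le> T" and f[measurable]: "f \<in> borel_measurable (path_pairs m)"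
  shows "(\<integral>\<^sup>+w. f (path_prefix m (fst w), path_prefix m (snd w)) \<partial>iterated_coupling Q n) =
    (\<integral>\<^sup>+w. f w \<partial>iterated_coupling Q m)"
  using \<open>m \<le> n\<close> \<open>n \<le> T\<close>
proof (induction n rule: dec_induct)
  case base
  show ?case
  proof (rule nn_integral_cong)
    fix w assume "w \<in> space (iterated_coupling Q m)"
    then have "w \<in> space (path_pairs m)" using space_iterated_coupling base by simp
    then show "f (path_prefix m (fst w), path_prefix m (snd w)) = f w"
      by (auto simp: space_pair_measure path_prefix_id simp del: One_nat_def)
  qed
next
  case (step n)
  note [measurable] = path_prefix_measurable[of m "Suc n"] path_prefix_measurable[OF \<open>m \<le> n\<close>]
  have "m \<le> Suc n" using step by simp
  note [measurable] = path_prefix_measurable[OF this]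
  have nT: "n < T" "n \<le> T" using step by auto
  have "(\<integral>\<^sup>+w. f (path_prefix m (fst w), path_prefix m (snd w)) \<partial>iterated_coupling Q (Suc n)) =
    (\<integral>\<^sup>+w. \<integral>\<^sup>+z. f (path_prefix m ((fst w)(Suc n := fst z)), path_prefix m ((snd w)(Suc n := snd z))) \<partial>Q n w \<partial>iterated_coupling Q n)"
  proof -
    have "(\<lambda>w. f (path_prefix m (fst w), path_prefix m (snd w))) \<in> borel_measurable (path_pairs (Suc n))"
      by measurable
    from iterated_coupling_Suc[OF nT(1) this] show ?thesis by (simp only: fst_conv snd_conv)
  qed
  also have "\<dots> = (\<integral>\<^sup>+w. f (path_prefix m (fst w), path_prefix m (snd w)) \<partial>iterated_coupling Q n)"
  proof (rule nn_integral_cong)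
    fix w assume "w \<in> space (iterated_coupling Q n)"
    then have "w \<in> space (path_pairs n)" using space_iterated_coupling[OF nT(2)] by simp
    from prob_space.emeasure_space_1[OF prob_algebra_prob[OF Q[OF nT(1)] this]]
    show "(\<integral>\<^sup>+z. f (path_prefix m ((fst w)(Suc n := fst z)), path_prefix m ((snd w)(Suc n := snd z))) \<partial>Q n w) =
        f (path_prefix m (fst w), path_prefix m (snd w))"
      by (simp only: path_prefix_extend[OF \<open>m \<le> n\<close>] nn_integral_const mult_1_right)
  qed
  also have "\<dots> = (\<integral>\<^sup>+w. f w \<partial>iterated_coupling Q m)"
    by (rule step.IH[OF nT(2)])
  finally show ?case .
qed

lemma pair_kernel_iterated_coupling:
  assumes "t < T"
  shows "pair_kernel t (iterated_coupling Q T) (Q t)"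
  unfolding pair_kernel_def
proof (rule cond_lawI)
  have le: "t \<le> T" "Suc t \<le> T" using assms by auto
  note [measurable_cong] = sets_iterated_coupling[OF order_refl]
  note [measurable] = path_prefix_measurable[OF le(1)] path_component_measurable[of "Suc t" T, OF _ le(2)]
    path_prefix_measurable[of t "Suc t"] path_component_measurable[of "Suc t" "Suc t"]
  note Qt[measurable] = Q[OF assms]
  show "Q t \<in> path_pairs t \<rightarrow>\<^sub>M prob_algebra (borel \<Otimes>\<^sub>M borel)" by fact
  show "(\<lambda>(x, y). (path_prefix t x, path_prefix t y)) \<in> iterated_coupling Q T \<rightarrow>\<^sub>M path_pairs t"
    unfolding split_beta' by measurable
  show "(\<lambda>(x, y). (x (Suc t), y (Suc t))) \<in> iterated_coupling Q T \<rightarrow>\<^sub>M borel \<Otimes>\<^sub>M borel"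
    unfolding split_beta' by measurable
  fix f :: "((nat \<Rightarrow> real ^ 'd) \<times> (nat \<Rightarrow> real ^ 'd)) \<times> ((real ^ 'd) \<times> (real ^ 'd)) \<Rightarrow> ennreal"
  assume f[measurable]: "f \<in> borel_measurable ((path_pairs t) \<Otimes>\<^sub>M (borel \<Otimes>\<^sub>M borel))"
  let ?F = "\<lambda>w. f ((path_prefix t (fst w), path_prefix t (snd w)), (fst w (Suc t), snd w (Suc t)))"
  have F: "?F \<in> borel_measurable (path_space (Suc t) \<Otimes>\<^sub>M path_space (Suc t))" by measurable
  have "(\<integral>\<^sup>+w. ?F w \<partial>iterated_coupling Q T) =
     (\<integral>\<^sup>+w. ?F (path_prefix (Suc t) (fst w), path_prefix (Suc t) (snd w)) \<partial>iterated_coupling Q T)"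
    by (simp add: path_prefix_prefix del: One_nat_def)
  also have "\<dots> = (\<integral>\<^sup>+w. ?F w \<partial>iterated_coupling Q (Suc t))"
    by (rule iterated_coupling_prefix[OF le(2) order_refl F])
  also have "\<dots> = (\<integral>\<^sup>+w. \<integral>\<^sup>+z. ?F ((fst w)(Suc t := fst z), (snd w)(Suc t := snd z)) \<partial>Q t w \<partial>iterated_coupling Q t)"
    by (rule iterated_coupling_Suc[OF assms F])
  also have "\<dots> = (\<integral>\<^sup>+w. \<integral>\<^sup>+z. f (w, z) \<partial>Q t w \<partial>iterated_coupling Q t)"
  proof (intro nn_integral_cong)
    fix w z assume "w \<in> space (iterated_coupling Q t)"
    then have "w \<in> space (path_pairs t)" using space_iterated_coupling[OF le(1)] by simp
    then show "?F ((fst w)(Suc t := fst z), (snd w)(Suc t := snd z)) = f (w, z)"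
      by (auto simp: space_pair_measure path_prefix_extend path_prefix_id simp del: One_nat_def)
  qed
  also have "\<dots> = (\<integral>\<^sup>+w. \<integral>\<^sup>+z. f ((path_prefix t (fst w), path_prefix t (snd w)), z)
      \<partial>Q t (path_prefix t (fst w), path_prefix t (snd w)) \<partial>iterated_coupling Q T)"
    by (rule iterated_coupling_prefix[OF le(1) order_refl, symmetric]) measurable
  finally show "(\<integral>\<^sup>+w. f ((case w of (x, y) \<Rightarrow> (path_prefix t x, path_prefix t y)), (case w of (x, y) \<Rightarrow> (x (Suc t), y (Suc t)))) \<partial>iterated_coupling Q T) =
     (\<integral>\<^sup>+w. \<integral>\<^sup>+z. f ((case w of (x, y) \<Rightarrow> (path_prefix t x, path_prefix t y)), z)
       \<partial>Q t (case w of (x, y) \<Rightarrow> (path_prefix t x, path_prefix t y)) \<partial>iterated_coupling Q T)"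
    unfolding split_beta' .
qed

text \<open>Both marginals are treated at once: \<open>p\<close> and \<open>p'\<close> stand for the projections of pairs of paths and of
  pairs of points to the same component. If the projected kernels are conditional laws of \<open>\<mu>\<close>, then
  the projected coupling is the law of the initial segment under \<open>\<mu>\<close>.\<close>

lemma iterated_coupling_marginal:
  fixes \<mu> :: "(nat \<Rightarrow> real ^ 'd) measure"
    and p :: "(nat \<Rightarrow> real ^ 'd) \<times> (nat \<Rightarrow> real ^ 'd) \<Rightarrow> nat \<Rightarrow> real ^ 'd" and p' :: "(real ^ 'd) \<times> (real ^ 'd) \<Rightarrow> real ^ 'd"
  assumes \<mu>: "prob_space \<mu>" "sets \<mu> = sets (path_space T)"
    and K: "\<And>n. n < T \<Longrightarrow> path_kernel n \<mu> (K n)"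
    and p: "\<And>n. p \<in> path_pairs n \<rightarrow>\<^sub>M path_space n"
    and p': "\<And>n w z. p ((fst w)(n := fst z), (snd w)(n := snd z)) = (p w)(n := p' z)"
    and marg: "\<And>n w f. n < T \<Longrightarrow> w \<in> space (path_pairs n) \<Longrightarrow> f \<in> borel_measurable borel \<Longrightarrow>
      (\<integral>\<^sup>+z. f (p' z) \<partial>Q n w) = (\<integral>\<^sup>+a. f a \<partial>K n (p w))"
    and "n \<le> T" and "f \<in> borel_measurable (path_space n)"
  shows "(\<integral>\<^sup>+w. f (p w) \<partial>iterated_coupling Q n) = (\<integral>\<^sup>+x. f (path_prefix n x) \<partial>\<mu>)"
  using \<open>n \<le> T\<close> \<open>f \<in> _\<close>
proof (induction n arbitrary: f)
  case 0
  note f[measurable] = 0(2) and p[measurable]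
  have sp: "(\<lambda>_. undefined, \<lambda>_. undefined) \<in> space (path_space 0 \<Otimes>\<^sub>M path_space 0 :: ((nat \<Rightarrow> real ^ 'd) \<times> (nat \<Rightarrow> real ^ 'd)) measure)"
    by (simp add: space_pair_measure space_path_space_0)
  then have "p (\<lambda>_. undefined, \<lambda>_. undefined) = (\<lambda>_. undefined)"
    using measurable_space[OF p sp] by (simp add: space_path_space_0)
  moreover have "path_prefix 0 x = (\<lambda>_. undefined)" for x :: "nat \<Rightarrow> real ^ 'd" by (auto simp: restrict_def)
  moreover have "(\<lambda>w. f (p w)) \<in> borel_measurable (path_space 0 \<Otimes>\<^sub>M path_space 0)" by measurable
  ultimately show ?case
    using sp prob_space.emeasure_space_1[OF \<mu>(1)] by (simp add: nn_integral_return)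
next
  case (Suc n)
  then have nT: "n < T" "n \<le> T" by auto
  note f[measurable] = Suc.prems(2) and p[measurable]
  note K_m[measurable] = path_kernel_measurable[OF K[OF nT(1)]]
  have "(\<lambda>w. f (p w)) \<in> borel_measurable (path_pairs (Suc n))" by measurable
  from iterated_coupling_Suc[OF nT(1) this]
  have "(\<integral>\<^sup>+w. f (p w) \<partial>iterated_coupling Q (Suc n)) =
    (\<integral>\<^sup>+w. \<integral>\<^sup>+z. f ((p w)(Suc n := p' z)) \<partial>Q n w \<partial>iterated_coupling Q n)"
    by (simp only: p')
  also have "\<dots> = (\<integral>\<^sup>+w. \<integral>\<^sup>+a. f ((p w)(Suc n := a)) \<partial>K n (p w) \<partial>iterated_coupling Q n)"
  proof (rule nn_integral_cong)
    fix w assume "w \<in> space (iterated_coupling Q n)"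
    then have w: "w \<in> space (path_pairs n)"
      by (simp only: space_iterated_coupling[OF nT(2)])
    have "(\<lambda>a. f ((p w)(Suc n := a))) \<in> borel_measurable borel"
      by (rule measurable_compose[OF path_extend_measurable[OF measurable_const[OF measurable_space[OF p w]] measurable_ident_sets[OF refl]] f])
    then show "(\<integral>\<^sup>+z. f ((p w)(Suc n := p' z)) \<partial>Q n w) = (\<integral>\<^sup>+a. f ((p w)(Suc n := a)) \<partial>K n (p w))"
      by (rule marg[OF nT(1) w])
  qed
  also have "\<dots> = (\<integral>\<^sup>+x. \<integral>\<^sup>+a. f ((path_prefix n x)(Suc n := a)) \<partial>K n (path_prefix n x) \<partial>\<mu>)"
    by (rule Suc.IH[OF nT(2), of "\<lambda>x. \<integral>\<^sup>+a. f (x(Suc n := a)) \<partial>K n x"]) measurable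
  also have "\<dots> = (\<integral>\<^sup>+x. f ((path_prefix n x)(Suc n := x (Suc n))) \<partial>\<mu>)"
    by (rule path_kernel_nn_integral[OF K[OF nT(1)] \<mu> nT(1), symmetric]) measurable
  finally show ?case by (simp only: path_prefix_Suc)
qed

lemma
  fixes \<mu> \<nu> :: "(nat \<Rightarrow> real ^ 'd) measure"
  assumes cpl: "\<And>n x y. n < T \<Longrightarrow> x \<in> space (path_space n) \<Longrightarrow> y \<in> space (path_space n) \<Longrightarrow> Q n (x, y) \<in> couplings (K n x) (K' n y)"
    and "n \<le> T" and "f \<in> borel_measurable (path_space n)"
  shows iterated_coupling_fst: "prob_space \<mu> \<Longrightarrow> sets \<mu> = sets (path_space T) \<Longrightarrow> (\<And>n. n < T \<Longrightarrow> path_kernel n \<mu> (K n)) \<Longrightarrow>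
      (\<integral>\<^sup>+w. f (fst w) \<partial>iterated_coupling Q n) = (\<integral>\<^sup>+x. f (path_prefix n x) \<partial>\<mu>)"
    and iterated_coupling_snd: "prob_space \<nu> \<Longrightarrow> sets \<nu> = sets (path_space T) \<Longrightarrow> (\<And>n. n < T \<Longrightarrow> path_kernel n \<nu> (K' n)) \<Longrightarrow>
      (\<integral>\<^sup>+w. f (snd w) \<partial>iterated_coupling Q n) = (\<integral>\<^sup>+x. f (path_prefix n x) \<partial>\<nu>)"
proof -
  have sp: "fst w \<in> space (path_space n)" "snd w \<in> space (path_space n)"
    if "w \<in> space (path_pairs n)" for n and w :: "(nat \<Rightarrow> real ^ 'd) \<times> (nat \<Rightarrow> real ^ 'd)"
    using that by (auto simp: space_pair_measure)
  have cpl': "Q n w \<in> couplings (K n (fst w)) (K' n (snd w))"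
    if "n < T" "w \<in> space (path_pairs n)" for n and w :: "(nat \<Rightarrow> real ^ 'd) \<times> (nat \<Rightarrow> real ^ 'd)"
    using cpl[OF that(1) sp[OF that(2)]] by simp
  {
    assume \<mu>: "prob_space \<mu>" "sets \<mu> = sets (path_space T)" and K: "\<And>n. n < T \<Longrightarrow> path_kernel n \<mu> (K n)"
    show "(\<integral>\<^sup>+w. f (fst w) \<partial>iterated_coupling Q n) = (\<integral>\<^sup>+x. f (path_prefix n x) \<partial>\<mu>)"
    proof (rule iterated_coupling_marginal[OF \<mu> K _ _ _ assms(2,3), where p'=fst])
      fix n and w :: "(nat \<Rightarrow> real ^ 'd) \<times> (nat \<Rightarrow> real ^ 'd)" and u :: "real ^ 'd \<Rightarrow> ennreal"
      assume n: "n < T" and w: "w \<in> space (path_pairs n)" and u: "u \<in> borel_measurable borel"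
      have "u \<in> borel_measurable (K n (fst w))"
        unfolding measurable_cong_sets[OF prob_algebra_sets[OF path_kernel_measurable[OF K[OF n]] sp(1)[OF w]] refl] by (rule u)
      then show "(\<integral>\<^sup>+z. u (fst z) \<partial>Q n w) = (\<integral>\<^sup>+a. u a \<partial>K n (fst w))"
        by (rule couplings_nn_integral_fst[OF cpl'[OF n w]])
    qed simp_all
  }
  {
    assume \<nu>: "prob_space \<nu>" "sets \<nu> = sets (path_space T)" and K': "\<And>n. n < T \<Longrightarrow> path_kernel n \<nu> (K' n)"
    show "(\<integral>\<^sup>+w. f (snd w) \<partial>iterated_coupling Q n) = (\<integral>\<^sup>+x. f (path_prefix n x) \<partial>\<nu>)"
    proof (rule iterated_coupling_marginal[OF \<nu> K' _ _ _ assms(2,3), where p'=snd])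
      fix n and w :: "(nat \<Rightarrow> real ^ 'd) \<times> (nat \<Rightarrow> real ^ 'd)" and u :: "real ^ 'd \<Rightarrow> ennreal"
      assume n: "n < T" and w: "w \<in> space (path_pairs n)" and u: "u \<in> borel_measurable borel"
      have "u \<in> borel_measurable (K' n (snd w))"
        unfolding measurable_cong_sets[OF prob_algebra_sets[OF path_kernel_measurable[OF K'[OF n]] sp(2)[OF w]] refl] by (rule u)
      then show "(\<integral>\<^sup>+z. u (snd z) \<partial>Q n w) = (\<integral>\<^sup>+a. u a \<partial>K' n (snd w))"
        by (rule couplings_nn_integral_snd[OF cpl'[OF n w]])
    qed simp_all
  }
qed

lemma iterated_coupling_bicausal:
  fixes \<mu> \<nu> :: "(nat \<Rightarrow> real ^ 'd) measure"
  assumes \<mu>: "prob_space \<mu>" "sets \<mu> = sets (path_space T)" and \<nu>: "prob_space \<nu>" "sets \<nu> = sets (path_space T)"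
    and K: "\<And>n. n < T \<Longrightarrow> path_kernel n \<mu> (K n)"
    and K': "\<And>n. n < T \<Longrightarrow> path_kernel n \<nu> (K' n)"
    and cpl: "\<And>n x y. n < T \<Longrightarrow> x \<in> space (path_space n) \<Longrightarrow> y \<in> space (path_space n) \<Longrightarrow> Q n (x, y) \<in> couplings (K n x) (K' n y)"
  shows "iterated_coupling Q T \<in> bicausal_couplings T \<mu> \<nu>"
  unfolding bicausal_couplings_def
proof (intro CollectI conjI ballI)
  show "iterated_coupling Q T \<in> couplings \<mu> \<nu>"
  proof (rule couplingsI_nn_integral)
    show "sets (iterated_coupling Q T) = sets (\<mu> \<Otimes>\<^sub>M \<nu>)"
      using \<mu>(2) \<nu>(2) by (simp add: sets_iterated_coupling cong: sets_pair_measure_cong)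
  next
    fix f :: "(nat \<Rightarrow> real ^ 'd) \<Rightarrow> ennreal" assume "f \<in> borel_measurable \<mu>"
    then have "f \<in> borel_measurable (path_space T)" unfolding measurable_cong_sets[OF \<mu>(2) refl] .
    from iterated_coupling_fst[OF cpl order_refl this \<mu> K]
    have "(\<integral>\<^sup>+w. f (fst w) \<partial>iterated_coupling Q T) = (\<integral>\<^sup>+x. f (path_prefix T x) \<partial>\<mu>)" by simp
    also have "\<dots> = (\<integral>\<^sup>+x. f x \<partial>\<mu>)"
      using sets_eq_imp_space_eq[OF \<mu>(2)] by (intro nn_integral_cong arg_cong[where f=f] path_prefix_id) simp
    finally show "(\<integral>\<^sup>+w. f (fst w) \<partial>iterated_coupling Q T) = (\<integral>\<^sup>+x. f x \<partial>\<mu>)" .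
  next
    fix f :: "(nat \<Rightarrow> real ^ 'd) \<Rightarrow> ennreal" assume "f \<in> borel_measurable \<nu>"
    then have "f \<in> borel_measurable (path_space T)" unfolding measurable_cong_sets[OF \<nu>(2) refl] .
    from iterated_coupling_snd[OF cpl order_refl this \<nu> K']
    have "(\<integral>\<^sup>+w. f (snd w) \<partial>iterated_coupling Q T) = (\<integral>\<^sup>+x. f (path_prefix T x) \<partial>\<nu>)" by simp
    also have "\<dots> = (\<integral>\<^sup>+x. f x \<partial>\<nu>)"
      using sets_eq_imp_space_eq[OF \<nu>(2)] by (intro nn_integral_cong arg_cong[where f=f] path_prefix_id) simp
    finally show "(\<integral>\<^sup>+w. f (snd w) \<partial>iterated_coupling Q T) = (\<integral>\<^sup>+x. f x \<partial>\<nu>)" .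
  qed
next
  fix t assume "t \<in> {1..<T}"
  then have t: "t < T" "t \<le> T" by auto
  have "AE (x, y) in iterated_coupling Q T. Q t (path_prefix t x, path_prefix t y) \<in> couplings (K t (path_prefix t x)) (K' t (path_prefix t y))"
  proof (rule AE_I2)
    fix w assume "w \<in> space (iterated_coupling Q T)"
    then have "fst w \<in> space (path_space T)" "snd w \<in> space (path_space T)"
      by (auto simp: space_iterated_coupling space_pair_measure)
    from cpl[OF t(1) measurable_space[OF path_prefix_measurable[OF t(2)] this(1)] measurable_space[OF path_prefix_measurable[OF t(2)] this(2)]]
    show "case w of (x, y) \<Rightarrow> Q t (path_prefix t x, path_prefix t y) \<in> couplings (K t (path_prefix t x)) (K' t (path_prefix t y))"
      by (simp only: split_beta')
  qed
  then show "\<exists>K\<mu> K\<nu> K\<pi>. path_kernel t \<mu> K\<mu> \<and> path_kernel t \<nu> K\<nu> \<and> pair_kernel t (iterated_coupling Q T) K\<pi> \<and>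
       (AE (x, y) in iterated_coupling Q T.
          K\<pi> (path_prefix t x, path_prefix t y) \<in> couplings (K\<mu> (path_prefix t x)) (K\<nu> (path_prefix t y)))"
    using K[OF t(1)] K'[OF t(1)] pair_kernel_iterated_coupling[OF t(1)] by blast
qed

lemma iterated_coupling_cost_Suc:
  assumes "n < T"
  shows "(\<integral>\<^sup>+w. ennreal (path_dist (Suc n) (fst w) (snd w)) \<partial>iterated_coupling Q (Suc n)) =
    (\<integral>\<^sup>+w. ennreal (path_dist n (fst w) (snd w)) \<partial>iterated_coupling Q n) +
    (\<integral>\<^sup>+w. pair_cost (Q n w) \<partial>iterated_coupling Q n)"
proof -
  have nT: "n \<le> T" using assms by simp
  note [measurable_cong] = sets_iterated_coupling[OF nT]
  note Qn[measurable] = Q[OF assms]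
  have "(\<integral>\<^sup>+w. ennreal (path_dist (Suc n) (fst w) (snd w)) \<partial>iterated_coupling Q (Suc n)) =
    (\<integral>\<^sup>+w. \<integral>\<^sup>+z. ennreal (path_norm (Suc n) (\<lambda>s. ((fst w)(Suc n := fst z)) s - ((snd w)(Suc n := snd z)) s)) \<partial>Q n w \<partial>iterated_coupling Q n)"
  proof -
    have "(\<lambda>w. ennreal (path_dist (Suc n) (fst w) (snd w))) \<in> borel_measurable (path_pairs (Suc n))"
      by measurable
    from iterated_coupling_Suc[OF assms this] show ?thesis by (simp only: fst_conv snd_conv)
  qed
  also have "\<dots> = (\<integral>\<^sup>+w. \<integral>\<^sup>+z. ennreal (path_dist n (fst w) (snd w)) + ennreal (norm (fst z - snd z)) \<partial>Q n w \<partial>iterated_coupling Q n)"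
  proof (intro nn_integral_cong)
    fix w z :: "_ \<times> _"
    have "path_norm n (\<lambda>s. ((fst w)(Suc n := fst z)) s - ((snd w)(Suc n := snd z)) s) = path_dist n (fst w) (snd w)"
      by (rule path_norm_cong) simp
    then show "ennreal (path_norm (Suc n) (\<lambda>s. ((fst w)(Suc n := fst z)) s - ((snd w)(Suc n := snd z)) s)) =
       ennreal (path_dist n (fst w) (snd w)) + ennreal (norm (fst z - snd z))"
      by (simp add: path_norm_Suc ennreal_plus)
  qed
  also have "\<dots> = (\<integral>\<^sup>+w. ennreal (path_dist n (fst w) (snd w)) + pair_cost (Q n w) \<partial>iterated_coupling Q n)"
  proof (rule nn_integral_cong)
    fix w assume "w \<in> space (iterated_coupling Q n)"
    then have w: "w \<in> space (path_pairs n)" using space_iterated_coupling[OF nT] by simp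
    note [measurable_cong] = prob_algebra_sets[OF Qn w]
    show "(\<integral>\<^sup>+z. ennreal (path_dist n (fst w) (snd w)) + ennreal (norm (fst z - snd z)) \<partial>Q n w) =
      ennreal (path_dist n (fst w) (snd w)) + pair_cost (Q n w)"
      using prob_space.emeasure_space_1[OF prob_algebra_prob[OF Qn w]]
      by (subst nn_integral_add) auto
  qed
  also have "\<dots> = (\<integral>\<^sup>+w. ennreal (path_dist n (fst w) (snd w)) \<partial>iterated_coupling Q n) +
    (\<integral>\<^sup>+w. pair_cost (Q n w) \<partial>iterated_coupling Q n)"
    by (rule nn_integral_add) measurable
  finally show ?thesis .
qed

end

section \<open>One step of the coupling and its cost\<close>

text \<open>One conditional law has a finite first moment because \<open>\<mu>\<close> does, and the other ones have finite
  distance to it.\<close>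

lemma path_kernel_first_moment:
  fixes \<mu> :: "(nat \<Rightarrow> real ^ 'd) measure"
  assumes \<mu>: "\<mu> \<in> P1 T" and "n < T" and K: "path_kernel n \<mu> K"
    and W1: "\<And>x y. x \<in> space (path_space n) \<Longrightarrow> y \<in> space (path_space n) \<Longrightarrow> W1 (K x) (K y) < \<infinity>"
    and x: "x \<in> space (path_space n)"
  shows "(\<integral>\<^sup>+a. ennreal (norm a) \<partial>K x) < \<infinity>"
proof -
  have prob: "prob_space \<mu>" and sets: "sets \<mu> = sets (path_space T)" and int: "integrable \<mu> (path_norm T)"
    using \<mu> by (auto simp: P1_def)
  interpret prob_space \<mu> by fact
  note [measurable_cong] = sets
  note K_m[measurable] = path_kernel_measurable[OF K]
  have nT: "n \<le> T" using \<open>n < T\<close> by simp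
  note pre[measurable] = path_prefix_measurable[OF nT]
  have "(\<integral>\<^sup>+x. \<integral>\<^sup>+a. ennreal (norm a) \<partial>K (path_prefix n x) \<partial>\<mu>) = (\<integral>\<^sup>+x. ennreal (norm (x (Suc n))) \<partial>\<mu>)"
    by (rule path_kernel_nn_integral[OF K prob sets \<open>n < T\<close>, symmetric]) measurable
  also have "\<dots> \<le> (\<integral>\<^sup>+x. ennreal (path_norm T x) \<partial>\<mu>)"
    unfolding path_norm_def using \<open>n < T\<close>
    by (intro nn_integral_mono ennreal_leI member_le_sum) auto
  also have "\<dots> < \<infinity>"
    using int by (simp add: integrable_iff_bounded)
  finally have fin: "(\<integral>\<^sup>+x. \<integral>\<^sup>+a. ennreal (norm a) \<partial>K (path_prefix n x) \<partial>\<mu>) \<noteq> \<infinity>" by simp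
  have "AE x in \<mu>. (\<integral>\<^sup>+a. ennreal (norm a) \<partial>K (path_prefix n x)) \<noteq> \<infinity>"
    by (rule nn_integral_PInf_AE[OF _ fin]) measurable
  then obtain S where S: "S \<subseteq> {x \<in> space \<mu>. (\<integral>\<^sup>+a. ennreal (norm a) \<partial>K (path_prefix n x)) \<noteq> \<infinity>}"
    "S \<in> events" "prob S = 1"
    by (rule AE_E_prob) (rule that)
  then have "S \<noteq> {}" by auto
  then have "\<exists>x. x \<in> space (path_space T) \<and> (\<integral>\<^sup>+a. ennreal (norm a) \<partial>K (path_prefix n x)) \<noteq> \<infinity>"
    using S(1) sets_eq_imp_space_eq[OF sets] by blast
  then obtain x0 where x0: "x0 \<in> space (path_space n)" "(\<integral>\<^sup>+a. ennreal (norm a) \<partial>K x0) \<noteq> \<infinity>"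
    using measurable_space[OF pre] by blast
  have "W1 (K x) (K x0) < \<infinity>" by (rule W1) fact+
  then obtain \<pi> where \<pi>: "\<pi> \<in> couplings (K x) (K x0)" "(\<integral>\<^sup>+(a, b). ennreal (norm (a - b)) \<partial>\<pi>) < \<infinity>"
    unfolding W1_def by (auto simp: INF_less_iff)
  have [measurable_cong]: "sets \<pi> = sets (borel \<Otimes>\<^sub>M borel)"
    using \<pi>(1) prob_algebra_sets[OF K_m x] prob_algebra_sets[OF K_m x0(1)]
    by (simp add: couplings_def cong: sets_pair_measure_cong)
  have [measurable_cong]: "sets (K x) = sets borel" "sets (K x0) = sets borel"
    by (rule prob_algebra_sets[OF K_m]; fact)+
  have "(\<integral>\<^sup>+a. ennreal (norm a) \<partial>K x) = (\<integral>\<^sup>+w. ennreal (norm (fst w)) \<partial>\<pi>)"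
    by (rule couplings_nn_integral_fst[OF \<pi>(1), symmetric]) measurable
  also have "\<dots> \<le> (\<integral>\<^sup>+w. ennreal (norm (fst w - snd w)) + ennreal (norm (snd w)) \<partial>\<pi>)"
  proof (rule nn_integral_mono)
    fix w :: "(real ^ 'd) \<times> (real ^ 'd)"
    have "norm (fst w) \<le> norm (fst w - snd w) + norm (snd w)" by norm
    then show "ennreal (norm (fst w)) \<le> ennreal (norm (fst w - snd w)) + ennreal (norm (snd w))"
      by (simp add: ennreal_plus[symmetric] del: ennreal_plus)
  qed
  also have "\<dots> = (\<integral>\<^sup>+w. ennreal (norm (fst w - snd w)) \<partial>\<pi>) + (\<integral>\<^sup>+w. ennreal (norm (snd w)) \<partial>\<pi>)"
    by (rule nn_integral_add) measurable
  also have "(\<integral>\<^sup>+w. ennreal (norm (snd w)) \<partial>\<pi>) = (\<integral>\<^sup>+a. ennreal (norm a) \<partial>K x0)"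
    by (rule couplings_nn_integral_snd[OF \<pi>(1)]) measurable
  also have "(\<integral>\<^sup>+w. ennreal (norm (fst w - snd w)) \<partial>\<pi>) + (\<integral>\<^sup>+a. ennreal (norm a) \<partial>K x0) < \<infinity>"
    using \<pi>(2) x0(2) by (simp add: split_beta' less_top)
  finally show ?thesis .
qed

context noise_density
begin

text \<open>One step of the bi-causal coupling, given the undisturbed past \<open>fst w\<close> of the first path and the noisy
  past \<open>snd w\<close> of the second one: draw \<open>x\<close> from the posterior at \<open>snd w\<close>, draw a pair from \<open>\<Gamma> (fst w, x)\<close>,
  which couples \<open>K (fst w)\<close> and \<open>K x\<close>, and add fresh noise to its second entry.\<close>

definition noisy_coupling ::
  "((nat \<Rightarrow> real ^ 'd) \<Rightarrow> (nat \<Rightarrow> real ^ 'd) measure) \<Rightarrow>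
    ((nat \<Rightarrow> real ^ 'd) \<times> (nat \<Rightarrow> real ^ 'd) \<Rightarrow> ((real ^ 'd) \<times> (real ^ 'd)) measure) \<Rightarrow>
    (nat \<Rightarrow> real ^ 'd) \<times> (nat \<Rightarrow> real ^ 'd) \<Rightarrow> ((real ^ 'd) \<times> (real ^ 'd)) measure" where
  "noisy_coupling post \<Gamma> w = post (snd w) \<bind> (\<lambda>x. \<Gamma> (fst w, x) \<bind>
      (\<lambda>z. distr noise (borel \<Otimes>\<^sub>M borel) (\<lambda>b. (fst z, snd z + b))))"

lemma noise_shift_snd_kernel [measurable]:
  "(\<lambda>z. distr noise (borel \<Otimes>\<^sub>M borel) (\<lambda>b. (fst z, snd z + b))) \<in> borel \<Otimes>\<^sub>M borel \<rightarrow>\<^sub>M prob_algebra (borel \<Otimes>\<^sub>M borel)"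
proof (rule measurable_distr_prob_space2[where M=borel])
  show "(\<lambda>z. noise) \<in> borel \<Otimes>\<^sub>M borel \<rightarrow>\<^sub>M prob_algebra borel"
    by (intro measurable_const) (simp add: space_prob_algebra prob_space_noise)
qed measurable

context
  fixes post :: "(nat \<Rightarrow> real ^ 'd) \<Rightarrow> (nat \<Rightarrow> real ^ 'd) measure" and n
    and \<Gamma> :: "(nat \<Rightarrow> real ^ 'd) \<times> (nat \<Rightarrow> real ^ 'd) \<Rightarrow> ((real ^ 'd) \<times> (real ^ 'd)) measure"
  assumes post[measurable]: "post \<in> path_space n \<rightarrow>\<^sub>M prob_algebra (path_space n)"
    and \<Gamma>[measurable]: "\<Gamma> \<in> path_pairs n \<rightarrow>\<^sub>M prob_algebra (borel \<Otimes>\<^sub>M borel)"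
begin

lemma noisy_coupling_measurable:
  "noisy_coupling post \<Gamma> \<in> path_pairs n \<rightarrow>\<^sub>M prob_algebra (borel \<Otimes>\<^sub>M borel)"
  unfolding noisy_coupling_def[abs_def]
proof (rule measurable_bind_prob_space2[where N="path_space n"])
  show "(\<lambda>(w, x). \<Gamma> (fst w, x) \<bind> (\<lambda>z. distr noise (borel \<Otimes>\<^sub>M borel) (\<lambda>b. (fst z, snd z + b))))
      \<in> (path_pairs n) \<Otimes>\<^sub>M path_space n \<rightarrow>\<^sub>M prob_algebra (borel \<Otimes>\<^sub>M borel)"
    unfolding split_beta' by (rule measurable_bind_prob_space[OF _ noise_shift_snd_kernel]) measurable
qed measurable

lemma noisy_coupling_nn_integral:
  assumes x: "x \<in> space (path_space n)" and y: "y \<in> space (path_space n)"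
    and f[measurable]: "f \<in> borel_measurable (borel \<Otimes>\<^sub>M borel)"
  shows "(\<integral>\<^sup>+z. f z \<partial>noisy_coupling post \<Gamma> (x, y)) =
    (\<integral>\<^sup>+x'. \<integral>\<^sup>+z. \<integral>\<^sup>+b. f (fst z, snd z + b) \<partial>noise \<partial>\<Gamma> (x, x') \<partial>post y)"
proof -
  have "(\<lambda>x'. \<Gamma> (x, x')) \<in> path_space n \<rightarrow>\<^sub>M prob_algebra (borel \<Otimes>\<^sub>M borel)"
    by (rule measurable_compose[OF measurable_Pair1'[OF x] \<Gamma>])
  from nn_integral_bind_bind[OF prob_algebra_sets[OF post y] this noise_shift_snd_kernel f]
  have "(\<integral>\<^sup>+z. f z \<partial>noisy_coupling post \<Gamma> (x, y)) = (\<integral>\<^sup>+x'. \<integral>\<^sup>+z. \<integral>\<^sup>+u. f u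
      \<partial>distr noise (borel \<Otimes>\<^sub>M borel) (\<lambda>b. (fst z, snd z + b)) \<partial>\<Gamma> (x, x') \<partial>post y)"
    by (simp add: noisy_coupling_def)
  also have "\<dots> = (\<integral>\<^sup>+x'. \<integral>\<^sup>+z. \<integral>\<^sup>+b. f (fst z, snd z + b) \<partial>noise \<partial>\<Gamma> (x, x') \<partial>post y)"
    by (intro nn_integral_cong nn_integral_distr) auto
  finally show ?thesis .
qed

lemma noisy_coupling_in_couplings:
  assumes K[measurable]: "K \<in> path_space n \<rightarrow>\<^sub>M prob_algebra borel"
    and cpl: "\<And>x x'. x \<in> space (path_space n) \<Longrightarrow> x' \<in> space (path_space n) \<Longrightarrow> \<Gamma> (x, x') \<in> couplings (K x) (K x')"
    and x: "x \<in> space (path_space n)" and y: "y \<in> space (path_space n)"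
  shows "noisy_coupling post \<Gamma> (x, y) \<in> couplings (K x) (noisy_kernel post K y)"
proof (rule couplingsI_nn_integral)
  have xy: "(x, y) \<in> space (path_pairs n)" using x y by (simp add: space_pair_measure)
  note nk = noisy_kernel_measurable[OF post K]
  show "sets (noisy_coupling post \<Gamma> (x, y)) = sets (K x \<Otimes>\<^sub>M noisy_kernel post K y)"
    using prob_algebra_sets[OF noisy_coupling_measurable xy] prob_algebra_sets[OF K x] prob_algebra_sets[OF nk y]
    by (simp cong: sets_pair_measure_cong)
  have sp: "x' \<in> space (path_space n)" if "x' \<in> space (post y)" for x'
    using that sets_eq_imp_space_eq[OF prob_algebra_sets[OF post y]] by simp
  fix f :: "real ^ 'd \<Rightarrow> ennreal"
  {
    assume f: "f \<in> borel_measurable (K x)"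
    then have [measurable]: "f \<in> borel_measurable borel"
      unfolding measurable_cong_sets[OF prob_algebra_sets[OF K x] refl] .
    have "(\<integral>\<^sup>+w. f (fst w) \<partial>noisy_coupling post \<Gamma> (x, y)) = (\<integral>\<^sup>+x'. \<integral>\<^sup>+z. f (fst z) \<partial>\<Gamma> (x, x') \<partial>post y)"
      by (subst noisy_coupling_nn_integral[OF x y]) (auto simp: noise.emeasure_space_1[simplified])
    also have "\<dots> = (\<integral>\<^sup>+x'. (\<integral>\<^sup>+a. f a \<partial>K x) \<partial>post y)"
      by (intro nn_integral_cong couplings_nn_integral_fst[OF cpl[OF x]] sp f)
    also have "\<dots> = (\<integral>\<^sup>+a. f a \<partial>K x)"
      using prob_space.emeasure_space_1[OF prob_algebra_prob[OF post y]] by simp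
    finally show "(\<integral>\<^sup>+w. f (fst w) \<partial>noisy_coupling post \<Gamma> (x, y)) = (\<integral>\<^sup>+a. f a \<partial>K x)" .
  }
  {
    assume "f \<in> borel_measurable (noisy_kernel post K y)"
    then have f[measurable]: "f \<in> borel_measurable borel"
      unfolding measurable_cong_sets[OF prob_algebra_sets[OF nk y] refl] .
    have "(\<integral>\<^sup>+w. f (snd w) \<partial>noisy_coupling post \<Gamma> (x, y)) = (\<integral>\<^sup>+x'. \<integral>\<^sup>+z. \<integral>\<^sup>+b. f (snd z + b) \<partial>noise \<partial>\<Gamma> (x, x') \<partial>post y)"
      by (subst noisy_coupling_nn_integral[OF x y]) auto
    also have "\<dots> = (\<integral>\<^sup>+x'. \<integral>\<^sup>+a. \<integral>\<^sup>+b. f (a + b) \<partial>noise \<partial>K x' \<partial>post y)"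
    proof (rule nn_integral_cong)
      fix x' assume "x' \<in> space (post y)"
      then have x': "x' \<in> space (path_space n)" by (rule sp)
      have "(\<lambda>a. \<integral>\<^sup>+b. f (a + b) \<partial>noise) \<in> borel_measurable (K x')"
        unfolding measurable_cong_sets[OF prob_algebra_sets[OF K x'] refl] by measurable
      from couplings_nn_integral_snd[OF cpl[OF x x'] this]
      show "(\<integral>\<^sup>+z. \<integral>\<^sup>+b. f (snd z + b) \<partial>noise \<partial>\<Gamma> (x, x')) = (\<integral>\<^sup>+a. \<integral>\<^sup>+b. f (a + b) \<partial>noise \<partial>K x')" .
    qed
    also have "\<dots> = (\<integral>\<^sup>+a. f a \<partial>noisy_kernel post K y)"
      by (rule noisy_kernel_nn_integral[OF post K y f, symmetric])
    finally show "(\<integral>\<^sup>+w. f (snd w) \<partial>noisy_coupling post \<Gamma> (x, y)) = (\<integral>\<^sup>+a. f a \<partial>noisy_kernel post K y)" .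
  }
qed

lemma noisy_coupling_cost:
  assumes x: "x \<in> space (path_space n)" and y: "y \<in> space (path_space n)"
  shows "pair_cost (noisy_coupling post \<Gamma> (x, y)) \<le>
    (\<integral>\<^sup>+x'. pair_cost (\<Gamma> (x, x')) \<partial>post y) + (\<integral>\<^sup>+b. ennreal (norm b) \<partial>noise)"
proof -
  have post_y[measurable_cong]: "sets (post y) = sets (path_space n)" by (rule prob_algebra_sets[OF post y])
  have "pair_cost (noisy_coupling post \<Gamma> (x, y)) =
    (\<integral>\<^sup>+x'. \<integral>\<^sup>+z. \<integral>\<^sup>+b. ennreal (norm (fst z - (snd z + b))) \<partial>noise \<partial>\<Gamma> (x, x') \<partial>post y)"
    by (subst noisy_coupling_nn_integral[OF x y]) auto
  also have "\<dots> \<le> (\<integral>\<^sup>+x'. \<integral>\<^sup>+z. \<integral>\<^sup>+b. ennreal (norm (fst z - snd z)) + ennreal (norm b) \<partial>noise \<partial>\<Gamma> (x, x') \<partial>post y)"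
  proof (intro nn_integral_mono)
    fix z :: "(real ^ 'd) \<times> (real ^ 'd)" and b :: "real ^ 'd"
    have "norm (fst z - (snd z + b)) \<le> norm (fst z - snd z) + norm b" by norm
    then show "ennreal (norm (fst z - (snd z + b))) \<le> ennreal (norm (fst z - snd z)) + ennreal (norm b)"
      by (simp add: ennreal_plus[symmetric] del: ennreal_plus)
  qed
  also have "\<dots> = (\<integral>\<^sup>+x'. pair_cost (\<Gamma> (x, x')) + (\<integral>\<^sup>+b. ennreal (norm b) \<partial>noise) \<partial>post y)"
  proof (rule nn_integral_cong)
    fix x' assume "x' \<in> space (post y)"
    then have "x' \<in> space (path_space n)" using sets_eq_imp_space_eq[OF post_y] by simp
    with x have xx': "(x, x') \<in> space (path_pairs n)" by (simp add: space_pair_measure)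
    note [measurable_cong] = prob_algebra_sets[OF \<Gamma> xx']
    interpret G: prob_space "\<Gamma> (x, x')" by (rule prob_algebra_prob[OF \<Gamma> xx'])
    have "(\<integral>\<^sup>+z. \<integral>\<^sup>+b. ennreal (norm (fst z - snd z)) + ennreal (norm b) \<partial>noise \<partial>\<Gamma> (x, x')) =
      (\<integral>\<^sup>+z. ennreal (norm (fst z - snd z)) + (\<integral>\<^sup>+b. ennreal (norm b) \<partial>noise) \<partial>\<Gamma> (x, x'))"
      using noise.emeasure_space_1 by (intro nn_integral_cong, subst nn_integral_add) auto
    also have "\<dots> = pair_cost (\<Gamma> (x, x')) + (\<integral>\<^sup>+b. ennreal (norm b) \<partial>noise)"
      using G.emeasure_space_1 by (subst nn_integral_add) auto
    finally show "(\<integral>\<^sup>+z. \<integral>\<^sup>+b. ennreal (norm (fst z - snd z)) + ennreal (norm b) \<partial>noise \<partial>\<Gamma> (x, x')) =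
      pair_cost (\<Gamma> (x, x')) + (\<integral>\<^sup>+b. ennreal (norm b) \<partial>noise)" .
  qed
  also have "\<dots> = (\<integral>\<^sup>+x'. pair_cost (\<Gamma> (x, x')) \<partial>post y) + (\<integral>\<^sup>+b. ennreal (norm b) \<partial>noise)"
  proof -
    have "(\<lambda>x'. pair_cost (\<Gamma> (x, x'))) \<in> borel_measurable (post y)"
      unfolding measurable_cong_sets[OF post_y refl]
      by (rule nn_integral_kernel_measurable[OF _ measurable_compose[OF measurable_Pair1'[OF x] \<Gamma>]]) measurable
    then show ?thesis
      using prob_space.emeasure_space_1[OF prob_algebra_prob[OF post y]]
      by (subst nn_integral_add) auto
  qed
  finally show ?thesis .
qed

end

lemma path_noise_norm:
  "(\<integral>\<^sup>+z. ennreal (path_norm n z) \<partial>path_noise n) = of_nat n * (\<integral>\<^sup>+b. ennreal (norm b) \<partial>noise)"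
proof -
  interpret G: prob_space "path_noise n" by (rule prob_space_path_noise)
  have meas: "(\<lambda>z. ennreal (norm (z s))) \<in> borel_measurable (path_noise n)" if "s \<in> {1..n}" for s
  proof -
    have [measurable]: "(\<lambda>z. z s) \<in> path_space n \<rightarrow>\<^sub>M (borel :: (real ^ 'd) measure)"
      using that by (intro path_component_measurable) auto
    show ?thesis by measurable
  qed
  have int: "(\<integral>\<^sup>+z. ennreal (norm (z s)) \<partial>path_noise n) = (\<integral>\<^sup>+b. ennreal (norm b) \<partial>noise)" if "s \<in> {1..n}" for s
  proof -
    interpret product_prob_space "\<lambda>_::nat. noise" "{1..n}" by unfold_locales
    have law: "distr (path_noise n) noise (\<lambda>z. z s) = noise"
      unfolding path_noise_def using that by (intro PiM_component) auto
    have "(\<lambda>z. z s) \<in> path_noise n \<rightarrow>\<^sub>M noise"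
      unfolding path_noise_def using that by (rule measurable_component_singleton)
    then have "(\<integral>\<^sup>+b. ennreal (norm b) \<partial>distr (path_noise n) noise (\<lambda>z. z s)) = (\<integral>\<^sup>+z. ennreal (norm (z s)) \<partial>path_noise n)"
      by (rule nn_integral_distr) measurable
    then show ?thesis by (simp only: law)
  qed
  have "(\<integral>\<^sup>+z. ennreal (path_norm n z) \<partial>path_noise n) = (\<integral>\<^sup>+z. (\<Sum>s = 1..n. ennreal (norm (z s))) \<partial>path_noise n)"
    by (simp add: path_norm_def sum_ennreal)
  also have "\<dots> = (\<Sum>s = 1..n. \<integral>\<^sup>+z. ennreal (norm (z s)) \<partial>path_noise n)"
    by (rule nn_integral_sum) (rule meas)
  also have "\<dots> = (\<Sum>s = 1..n. \<integral>\<^sup>+b. ennreal (norm b) \<partial>noise)"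
    by (intro sum.cong refl int)
  finally show ?thesis by simp
qed

end

section \<open>The bound for general noise\<close>

text \<open>The first time step is treated like the others, with the law of \<open>x 1\<close> as kernel over the one-point
  space of paths of length zero. A constant kernel satisfies every Lipschitz bound.\<close>

lemma path_kernel_0:
  fixes \<mu> :: "(nat \<Rightarrow> real ^ 'd) measure"
  assumes "prob_space \<mu>" and sets[measurable_cong]: "sets \<mu> = sets (path_space T)" and "1 \<le> T"
  shows "path_kernel 0 \<mu> (\<lambda>_. distr \<mu> borel (\<lambda>x. x 1))"
  unfolding path_kernel_def
proof (rule cond_lawI)
  interpret prob_space \<mu> by fact
  have [measurable]: "(\<lambda>x. x (Suc 0)) \<in> path_space T \<rightarrow>\<^sub>M borel"
    using \<open>1 \<le> T\<close> by (intro path_component_measurable) auto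
  note [measurable] = path_prefix_measurable[of 0 T, OF le0]
  have const: "path_prefix 0 x = (\<lambda>_. undefined)" for x :: "nat \<Rightarrow> real ^ 'd" by (auto simp: restrict_def)
  show "(\<lambda>_. distr \<mu> borel (\<lambda>x. x 1)) \<in> path_space 0 \<rightarrow>\<^sub>M prob_algebra borel"
    by (intro measurable_const) (simp add: space_prob_algebra prob_space_distr)
  show "path_prefix 0 \<in> \<mu> \<rightarrow>\<^sub>M path_space 0" "(\<lambda>x. x (Suc 0)) \<in> \<mu> \<rightarrow>\<^sub>M borel" by measurable
  fix f :: "(nat \<Rightarrow> real ^ 'd) \<times> (real ^ 'd) \<Rightarrow> ennreal"
  assume f[measurable]: "f \<in> borel_measurable (path_space 0 \<Otimes>\<^sub>M borel)"
  have "(\<lambda>_. undefined) \<in> space (path_space 0)" by (simp add: space_path_space_0)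
  from measurable_compose[OF measurable_Pair1'[OF this] f]
  have [measurable]: "(\<lambda>b. f (\<lambda>_. undefined, b)) \<in> borel_measurable borel" .
  show "(\<integral>\<^sup>+w. f (path_prefix 0 w, w (Suc 0)) \<partial>\<mu>) =
    (\<integral>\<^sup>+w. \<integral>\<^sup>+b. f (path_prefix 0 w, b) \<partial>distr \<mu> borel (\<lambda>x. x 1) \<partial>\<mu>)"
    unfolding const by (simp add: nn_integral_distr emeasure_space_1)
qed

lemma W1_self:
  assumes "sets M = sets borel"
  shows "W1 M M = 0"
proof -
  note [measurable_cong] = assms
  let ?\<pi> = "distr M (M \<Otimes>\<^sub>M M) (\<lambda>a. (a, a))"
  have "?\<pi> \<in> couplings M M"
    by (rule couplingsI_nn_integral) (simp_all add: nn_integral_distr)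
  then have "W1 M M \<le> (\<integral>\<^sup>+(a, b). ennreal (norm (a - b)) \<partial>?\<pi>)"
    unfolding W1_def by (rule INF_lower)
  also have "\<dots> = 0"
    by (subst nn_integral_distr) (auto simp: split_beta')
  finally show ?thesis by simp
qed

text \<open>Bounds for the cost of the first \<open>n\<close> steps, in units of the mean noise: step \<open>n + 1\<close> adds \<open>L\<close> times the
  cost so far, \<open>L\<close> times the mean noise \<open>n\<close> of the past, one unit for the new noise, and one unit of
  slack for the choice of the couplings.\<close>

primrec growth :: "real \<Rightarrow> nat \<Rightarrow> real" where
  "growth L 0 = 0"
| "growth L (Suc n) = (1 + L) * growth L n + L * real n + 2"

lemma growth_nonneg: "0 \<le> L \<Longrightarrow> 0 \<le> growth L n"
  by (induction n) auto

context noise_density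
begin

text \<open>The bound for noise of mean norm at most \<open>c\<close>. The triangle inequality through the noisy path
  reduces the distance between the first path and a draw from the posterior to the current cost
  plus the distance between that draw and the noisy path; on average over the noisy path, the
  latter is the mean norm of the noise.\<close>

lemma AW1_noisy_le:
  fixes \<mu> :: "(nat \<Rightarrow> real ^ 'd) measure"
  assumes \<mu>: "\<mu> \<in> P1 T" and "0 \<le> L" and "0 < c"
    and K: "\<And>n. n < T \<Longrightarrow> path_kernel n \<mu> (K n)"
    and lip: "\<And>n x y. n < T \<Longrightarrow> x \<in> space (path_space n) \<Longrightarrow> y \<in> space (path_space n) \<Longrightarrow>
      W1 (K n x) (K n y) \<le> ennreal (L * path_dist n x y)"
    and noise_c: "(\<integral>\<^sup>+b. ennreal (norm b) \<partial>noise) \<le> ennreal c"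
  shows "AW1 T \<mu> (noisy T \<mu>) \<le> ennreal (growth L T * c)"
proof -
  have prob: "prob_space \<mu>" and sets: "sets \<mu> = sets (path_space T)"
    using \<mu> by (auto simp: P1_def)
  have prob_\<nu>: "prob_space (noisy T \<mu>)" by (rule prob_space_noisy) fact+
  define good where "good n \<Gamma> \<longleftrightarrow> \<Gamma> \<in> path_pairs n \<rightarrow>\<^sub>M prob_algebra (borel \<Otimes>\<^sub>M borel) \<and>
     (\<forall>x\<in>space (path_space n). \<forall>y\<in>space (path_space n). \<Gamma> (x, y) \<in> couplings (K n x) (K n y) \<and>
       pair_cost (\<Gamma> (x, y)) \<le> ennreal (L * path_dist n x y + c))" for n \<Gamma>
  have "\<exists>\<Gamma>. good n \<Gamma>" if n: "n < T" for n
  proof -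
    note K_m[measurable] = path_kernel_measurable[OF K[OF n]]
    let ?S = "path_pairs n :: ((nat \<Rightarrow> real ^ 'd) \<times> (nat \<Rightarrow> real ^ 'd)) measure"
    let ?c = "\<lambda>w. L * path_dist n (fst w) (snd w) + c / 2"
    have fin: "(\<integral>\<^sup>+a. ennreal (norm a) \<partial>K n x) < \<infinity>" if "x \<in> space (path_space n)" for x
    proof (rule path_kernel_first_moment[OF \<mu> n K[OF n] _ that])
      fix x y :: "nat \<Rightarrow> real ^ 'd" assume "x \<in> space (path_space n)" "y \<in> space (path_space n)"
      from lip[OF n this] show "W1 (K n x) (K n y) < \<infinity>" by (auto simp: le_less_trans)
    qed
    have ex: "\<exists>\<pi>\<in>couplings (K n (fst w)) (K n (snd w)). (\<integral>\<^sup>+(a, b). ennreal (norm (a - b)) \<partial>\<pi>) \<le> ennreal (?c w)"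
      if w: "w \<in> space ?S" for w
    proof -
      have "W1 (K n (fst w)) (K n (snd w)) \<le> ennreal (L * path_dist n (fst w) (snd w))"
        using w by (intro lip n) (auto simp: space_pair_measure)
      \<comment> \<open>half of the slack \<open>c\<close> pays for the infimum in the Wasserstein distance, the other half for the selection\<close>
      also have "\<dots> < ennreal (?c w)"
        using \<open>0 < c\<close> \<open>0 \<le> L\<close> by (intro ennreal_lessI) (auto intro: add_nonneg_pos)
      finally show ?thesis
        unfolding W1_def by (auto simp: INF_less_iff intro: less_imp_le)
    qed
    obtain \<Gamma> where "\<Gamma> \<in> ?S \<rightarrow>\<^sub>M prob_algebra (borel \<Otimes>\<^sub>M borel)"
      and "\<And>w. w \<in> space ?S \<Longrightarrow> \<Gamma> w \<in> couplings (K n (fst w)) (K n (snd w))"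
      and "\<And>w. w \<in> space ?S \<Longrightarrow> (\<integral>\<^sup>+(a, b). ennreal (norm (a - b)) \<partial>\<Gamma> w) \<le> ennreal (?c w + c / 2)"
    proof (rule measurable_coupling_selection[of "\<lambda>w. K n (fst w)" ?S "\<lambda>w. K n (snd w)" ?c "c / 2"])
      show "(\<lambda>w. K n (fst w)) \<in> ?S \<rightarrow>\<^sub>M prob_algebra borel" "(\<lambda>w. K n (snd w)) \<in> ?S \<rightarrow>\<^sub>M prob_algebra borel"
        "?c \<in> borel_measurable ?S" by measurable
      show "0 \<le> ?c w" "(\<integral>\<^sup>+a. ennreal (norm a) \<partial>K n (fst w)) < \<infinity>" "(\<integral>\<^sup>+a. ennreal (norm a) \<partial>K n (snd w)) < \<infinity>"
        if "w \<in> space ?S" for w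
        using that \<open>0 < c\<close> \<open>0 \<le> L\<close> fin by (auto simp: space_pair_measure)
    qed (use ex \<open>0 < c\<close> in auto)
    note \<Gamma> = this
    show ?thesis
      unfolding good_def
    proof (intro exI[of _ \<Gamma>] conjI ballI \<Gamma>(1))
      fix x y :: "nat \<Rightarrow> real ^ 'd" assume "x \<in> space (path_space n)" "y \<in> space (path_space n)"
      then have xy: "(x, y) \<in> space ?S" by (simp add: space_pair_measure)
      show "\<Gamma> (x, y) \<in> couplings (K n x) (K n y)" using \<Gamma>(2)[OF xy] by simp
      show "pair_cost (\<Gamma> (x, y)) \<le> ennreal (L * path_dist n x y + c)"
        using \<Gamma>(3)[OF xy] by (simp add: split_beta' add.assoc)
    qed
  qed
  then obtain \<Gamma> where good: "\<And>n. n < T \<Longrightarrow> good n (\<Gamma> n)" by metis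
  have \<Gamma>: "\<Gamma> n \<in> path_pairs n \<rightarrow>\<^sub>M prob_algebra (borel \<Otimes>\<^sub>M borel)" if "n < T" for n
    using good[OF that] by (simp add: good_def)
  have \<Gamma>_cpl: "\<Gamma> n (x, y) \<in> couplings (K n x) (K n y)"
    and \<Gamma>_cost: "pair_cost (\<Gamma> n (x, y)) \<le> ennreal (L * path_dist n x y + c)"
    if "n < T" "x \<in> space (path_space n)" "y \<in> space (path_space n)" for n x y
    using good[OF that(1)] that(2,3) by (simp_all add: good_def)
  have "\<exists>post. is_posterior n \<mu> post" if "n < T" for n
    using that by (intro is_posterior_exists[OF prob sets]) simp
  then obtain post where post: "\<And>n. n < T \<Longrightarrow> is_posterior n \<mu> (post n)" by metis
  then have post_m: "\<And>n. n < T \<Longrightarrow> post n \<in> path_space n \<rightarrow>\<^sub>M prob_algebra (path_space n)"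
    by (auto simp: is_posterior_def)
  define K' where "K' n = noisy_kernel (post n) (K n)" for n
  define Q where "Q n = noisy_coupling (post n) (\<Gamma> n)" for n
  have Q: "Q n \<in> path_pairs n \<rightarrow>\<^sub>M prob_algebra (borel \<Otimes>\<^sub>M borel)" if "n < T" for n
    unfolding Q_def by (rule noisy_coupling_measurable[OF post_m[OF that] \<Gamma>[OF that]])
  have K': "path_kernel n (noisy T \<mu>) (K' n)" if "n < T" for n
    unfolding K'_def by (rule path_kernel_noisy[OF prob sets that K[OF that] post[OF that]])
  have cpl: "Q n (x, y) \<in> couplings (K n x) (K' n y)"
    if "n < T" "x \<in> space (path_space n)" "y \<in> space (path_space n)" for n x y
    unfolding Q_def K'_def
    by (rule noisy_coupling_in_couplings[OF post_m[OF that(1)] \<Gamma>[OF that(1)]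
          path_kernel_measurable[OF K[OF that(1)]] \<Gamma>_cpl[OF that(1)] that(2,3)])
  let ?\<pi> = "iterated_coupling Q"
  have bicausal: "?\<pi> T \<in> bicausal_couplings T \<mu> (noisy T \<mu>)"
    by (rule iterated_coupling_bicausal[OF Q prob sets prob_\<nu> sets_noisy K K' cpl])
  have cost: "(\<integral>\<^sup>+w. ennreal (path_dist n (fst w) (snd w)) \<partial>?\<pi> n) \<le> ennreal (growth L n * c)" if "n \<le> T" for n
    using that
  proof (induction n)
    case 0
    show ?case by (simp add: path_norm_def)
  next
    case (Suc n)
    then have n: "n < T" "n \<le> T" by auto
    note [measurable_cong] = sets_iterated_coupling[OF Q n(2)]
    interpret \<pi>: prob_space "?\<pi> n" by (rule prob_space_iterated_coupling[OF Q n(2)])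
    note [measurable] = post_m[OF n(1)]
    define a where "a = (\<integral>\<^sup>+w. ennreal (path_dist n (fst w) (snd w)) \<partial>?\<pi> n)"
    define R where "R y = (\<integral>\<^sup>+x. ennreal (path_dist n x y) \<partial>post n y)" for y
    have R[measurable]: "R \<in> borel_measurable (path_space n)"
      unfolding R_def by measurable
    have step: "pair_cost (Q n w) \<le>
        ennreal L * ennreal (path_dist n (fst w) (snd w)) + ennreal L * R (snd w) + ennreal (2 * c)"
      if "w \<in> space (?\<pi> n)" for w
    proof -
      have w: "fst w \<in> space (path_space n)" "snd w \<in> space (path_space n)"
        using that by (simp_all only: space_iterated_coupling[OF Q n(2)] space_pair_measure mem_Times_iff)
      have ps[measurable_cong]: "sets (post n (snd w)) = sets (path_space n)"
        by (rule prob_algebra_sets[OF post_m[OF n(1)] w(2)])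
      have "pair_cost (Q n (fst w, snd w)) \<le>
        (\<integral>\<^sup>+x'. pair_cost (\<Gamma> n (fst w, x')) \<partial>post n (snd w)) + (\<integral>\<^sup>+b. ennreal (norm b) \<partial>noise)"
        unfolding Q_def by (rule noisy_coupling_cost[OF post_m[OF n(1)] \<Gamma>[OF n(1)] w])
      also have "\<dots> \<le> (\<integral>\<^sup>+x'. ennreal L * ennreal (path_dist n (fst w) (snd w)) + ennreal c
           + ennreal L * ennreal (path_dist n x' (snd w)) \<partial>post n (snd w)) + ennreal c"
      proof (intro add_mono noise_c nn_integral_mono)
        fix x' assume "x' \<in> space (post n (snd w))"
        then have x': "x' \<in> space (path_space n)" using sets_eq_imp_space_eq[OF ps] by simp
        have "path_dist n (fst w) x' \<le> path_dist n (fst w) (snd w) + path_dist n x' (snd w)"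
          unfolding path_norm_def sum.distrib[symmetric] by (intro sum_mono) norm
        then have "L * path_dist n (fst w) x' + c \<le>
          L * path_dist n (fst w) (snd w) + c + L * path_dist n x' (snd w)"
          using \<open>0 \<le> L\<close> mult_left_mono[of _ _ L] by (fastforce simp: distrib_left)
        with \<Gamma>_cost[OF n(1) w(1) x']
        have "pair_cost (\<Gamma> n (fst w, x')) \<le>
          ennreal (L * path_dist n (fst w) (snd w) + c + L * path_dist n x' (snd w))"
          by (meson ennreal_leI order_trans)
        then show "pair_cost (\<Gamma> n (fst w, x')) \<le>
          ennreal L * ennreal (path_dist n (fst w) (snd w)) + ennreal c
           + ennreal L * ennreal (path_dist n x' (snd w))"
          using \<open>0 \<le> L\<close> \<open>0 < c\<close> by (simp add: ennreal_plus ennreal_mult)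
      qed
      also have "(\<integral>\<^sup>+x'. ennreal L * ennreal (path_dist n (fst w) (snd w)) + ennreal c
           + ennreal L * ennreal (path_dist n x' (snd w)) \<partial>post n (snd w)) =
         ennreal L * ennreal (path_dist n (fst w) (snd w)) + ennreal c + ennreal L * R (snd w)"
      proof -
        have m: "(\<lambda>x'. ennreal (path_dist n x' (snd w))) \<in> borel_measurable (post n (snd w))"
          unfolding measurable_cong_sets[OF ps refl]
          by (intro measurable_compose[OF path_norm_measurable measurable_ennreal] measurable_ident_sets refl measurable_const w)
        show ?thesis
          unfolding R_def
          using m prob_space.emeasure_space_1[OF prob_algebra_prob[OF post_m[OF n(1)] w(2)]]
          by (subst nn_integral_add) (auto simp: nn_integral_cmult)
      qed
      also have "ennreal L * ennreal (path_dist n (fst w) (snd w)) + ennreal c + ennreal L * R (snd w) + ennreal c =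
          ennreal L * ennreal (path_dist n (fst w) (snd w)) + ennreal L * R (snd w) + ennreal (2 * c)"
      proof -
        have "ennreal (2 * c) = ennreal c + ennreal c"
          using \<open>0 < c\<close> by (simp flip: ennreal_plus)
        then show ?thesis by (simp only: add_ac)
      qed
      finally show ?thesis by simp
    qed
    \<comment> \<open>\<open>R y\<close> is the mean distance of a posterior draw to \<open>y\<close>; averaging it over the noisy law undoes the conditioning\<close>
    have R_int: "(\<integral>\<^sup>+w. R (snd w) \<partial>?\<pi> n) \<le> ennreal (real n * c)"
    proof -
      have "(\<integral>\<^sup>+w. R (snd w) \<partial>?\<pi> n) = (\<integral>\<^sup>+y. R (path_prefix n y) \<partial>noisy T \<mu>)"
        by (rule iterated_coupling_snd[OF Q cpl n(2) R prob_\<nu> sets_noisy K'])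
      also have "\<dots> = (\<integral>\<^sup>+x. \<integral>\<^sup>+z. R (path_add n (path_prefix n x) z) \<partial>path_noise n \<partial>\<mu>)"
        by (rule noisy_prefix[OF prob sets n(2) R])
      also have "\<dots> = (\<integral>\<^sup>+x. \<integral>\<^sup>+z. ennreal (path_norm n (\<lambda>s. path_prefix n x s - path_add n (path_prefix n x) z s)) \<partial>path_noise n \<partial>\<mu>)"
      proof -
        have "(\<lambda>w. ennreal (path_dist n (fst w) (snd w))) \<in> borel_measurable (path_pairs n)"
          by measurable
        from bspec[OF conjunct2[OF post[OF n(1), unfolded is_posterior_def]] this]
        show ?thesis unfolding R_def by (simp only: fst_conv snd_conv)
      qed
      also have "\<dots> = (\<integral>\<^sup>+x. \<integral>\<^sup>+z. ennreal (path_norm n z) \<partial>path_noise n \<partial>\<mu>)"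
        by (intro nn_integral_cong) (simp add: path_norm_def path_add_def)
      also have "\<dots> = of_nat n * (\<integral>\<^sup>+b. ennreal (norm b) \<partial>noise)"
        using prob_space.emeasure_space_1[OF prob] by (simp add: path_noise_norm)
      also have "\<dots> \<le> of_nat n * ennreal c"
        by (rule mult_left_mono[OF noise_c]) simp
      also have "\<dots> = ennreal (real n * c)"
        using \<open>0 < c\<close> by (simp add: ennreal_mult ennreal_of_nat_eq_real_of_nat)
      finally show ?thesis .
    qed
    have "(\<integral>\<^sup>+w. ennreal (path_dist (Suc n) (fst w) (snd w)) \<partial>?\<pi> (Suc n)) =
      a + (\<integral>\<^sup>+w. pair_cost (Q n w) \<partial>?\<pi> n)"
      unfolding a_def by (rule iterated_coupling_cost_Suc[OF Q n(1)])
    also have "\<dots> \<le> a + (\<integral>\<^sup>+w. ennreal L * ennreal (path_dist n (fst w) (snd w)) + ennreal L * R (snd w) + ennreal (2 * c) \<partial>?\<pi> n)"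
      by (intro add_left_mono nn_integral_mono step)
    also have "(\<integral>\<^sup>+w. ennreal L * ennreal (path_dist n (fst w) (snd w)) + ennreal L * R (snd w) + ennreal (2 * c) \<partial>?\<pi> n) =
       ennreal L * a + ennreal L * (\<integral>\<^sup>+w. R (snd w) \<partial>?\<pi> n) + ennreal (2 * c)"
      using \<pi>.emeasure_space_1 by (simp add: nn_integral_add nn_integral_cmult a_def)
    also have "a + (ennreal L * a + ennreal L * (\<integral>\<^sup>+w. R (snd w) \<partial>?\<pi> n) + ennreal (2 * c)) \<le>
       ennreal (growth L n * c) + (ennreal L * ennreal (growth L n * c) + ennreal L * ennreal (real n * c) + ennreal (2 * c))"
      using Suc.IH n(2) R_int unfolding a_def by (intro add_mono mult_left_mono) auto
    also have "\<dots> = ennreal (growth L n * c + (L * (growth L n * c) + L * (real n * c) + 2 * c))"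
      using \<open>0 \<le> L\<close> \<open>0 < c\<close> growth_nonneg[OF \<open>0 \<le> L\<close>, of n]
      by (simp add: ennreal_plus ennreal_mult)
    also have "growth L n * c + (L * (growth L n * c) + L * (real n * c) + 2 * c) = growth L (Suc n) * c"
      by (simp add: algebra_simps)
    finally show ?case .
  qed
  have "AW1 T \<mu> (noisy T \<mu>) \<le> (\<integral>\<^sup>+(x, y). ennreal (path_dist T x y) \<partial>?\<pi> T)"
    unfolding AW1_def by (rule INF_lower[OF bicausal])
  also have "\<dots> \<le> ennreal (growth L T * c)"
    using cost[OF order_refl] by (simp add: split_beta')
  finally show ?thesis .
qed

end

section \<open>Gaussian noise\<close>

lemma nn_integral_lborel_vec_prod:
  fixes f :: "'d::finite \<Rightarrow> real \<Rightarrow> ennreal"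
  assumes [measurable]: "\<And>i. f i \<in> borel_measurable borel"
  shows "(\<integral>\<^sup>+z. (\<Prod>i\<in>UNIV. f i (z $ i)) \<partial>(lborel :: (real ^ 'd) measure)) = (\<Prod>i\<in>UNIV. \<integral>\<^sup>+x. f i x \<partial>lborel)"
proof -
  define F where "F b = f (THE i. b = axis i 1)" for b :: "real ^ 'd"
  have F: "F (axis i 1) = f i" for i
  proof -
    have "(THE j. axis i (1::real) = axis j 1) = i"
      by (rule the_equality) (auto simp: axis_eq_axis)
    then show ?thesis by (simp add: F_def)
  qed
  have Basis: "Basis = range (\<lambda>i::'d. axis i (1::real))"
    by (auto simp: Basis_vec_def)
  have inj: "inj (\<lambda>i::'d. axis i (1::real))"
    by (auto simp: inj_on_def axis_eq_axis)
  have "(\<integral>\<^sup>+z. (\<Prod>b\<in>Basis. F b (z \<bullet> b)) \<partial>(lborel :: (real ^ 'd) measure)) = (\<Prod>b\<in>Basis. \<integral>\<^sup>+x. F b x \<partial>lborel)"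
    by (rule nn_integral_lborel_prod) (auto simp: F_def)
  then show ?thesis
    unfolding Basis by (simp add: prod.reindex[OF inj] F cart_eq_inner_axis[symmetric])
qed

context
  fixes \<sigma> :: real
  assumes \<sigma>: "0 < \<sigma>"
begin

text \<open>The density of the centred normal law with covariance \<open>\<sigma>\<^sup>2 I\<close> on one copy of the space.\<close>

definition normal_vec :: "real ^ 'd \<Rightarrow> real" where
  "normal_vec z = (\<Prod>i\<in>UNIV. normal_density 0 \<sigma> (z $ i))"

lemma nn_integral_normal: "(\<integral>\<^sup>+x. ennreal (normal_density 0 \<sigma> x) \<partial>lborel) = 1"
  using \<sigma> by (subst nn_integral_eq_integral) auto

lemma noise_density_normal_vec:
  "noise_density (normal_vec :: real ^ 'd \<Rightarrow> real) ((1 / sqrt (2 * pi * \<sigma>\<^sup>2)) ^ CARD('d))"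
proof
  show "normal_vec \<in> borel_measurable (borel :: (real ^ 'd) measure)"
    unfolding normal_vec_def by measurable
  show "0 < normal_vec z" for z :: "real ^ 'd"
    unfolding normal_vec_def by (intro prod_pos) (simp add: normal_density_pos \<sigma>)
  show "normal_vec z \<le> (1 / sqrt (2 * pi * \<sigma>\<^sup>2)) ^ CARD('d)" for z :: "real ^ 'd"
  proof -
    have "normal_vec z \<le> (\<Prod>i\<in>(UNIV :: 'd set). 1 / sqrt (2 * pi * \<sigma>\<^sup>2))"
      unfolding normal_vec_def
    proof (intro prod_mono conjI)
      fix i
      show "normal_density 0 \<sigma> (z $ i) \<le> 1 / sqrt (2 * pi * \<sigma>\<^sup>2)"
        unfolding normal_density_def by (intro mult_left_le) auto
    qed simp
    then show ?thesis by simp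
  qed
  have "(\<integral>\<^sup>+z. ennreal (normal_vec z) \<partial>(lborel :: (real ^ 'd) measure)) = (\<integral>\<^sup>+z. (\<Prod>i\<in>UNIV. ennreal (normal_density 0 \<sigma> (z $ i))) \<partial>(lborel :: (real ^ 'd) measure))"
    by (simp add: normal_vec_def prod_ennreal)
  also have "\<dots> = 1"
    by (subst nn_integral_lborel_vec_prod) (auto simp: nn_integral_normal)
  finally show "(\<integral>\<^sup>+z. ennreal (normal_vec z) \<partial>(lborel :: (real ^ 'd) measure)) = 1" .
qed

interpretation normal: noise_density "normal_vec :: real ^ 'd \<Rightarrow> real" "(1 / sqrt (2 * pi * \<sigma>\<^sup>2)) ^ CARD('d)"
  by (rule noise_density_normal_vec)

lemma normal_first_moment:
  "(\<integral>\<^sup>+b. ennreal (norm b) \<partial>(normal.noise :: (real ^ 'd) measure)) \<le> ennreal (real CARD('d) * \<sigma>)"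
proof -
  have abs_moment: "(\<integral>\<^sup>+x. ennreal (normal_density 0 \<sigma> x) * ennreal \<bar>x\<bar> \<partial>lborel) \<le> ennreal \<sigma>"
  proof -
    have "has_bochner_integral lborel (\<lambda>x. normal_density 0 \<sigma> x * \<bar>x\<bar>) (\<sigma> * sqrt (2 / pi))"
      using normal_moment_abs_odd[OF \<sigma>, of 0 0] by simp
    then have "(\<integral>\<^sup>+x. ennreal (normal_density 0 \<sigma> x * \<bar>x\<bar>) \<partial>lborel) = ennreal (\<sigma> * sqrt (2 / pi))"
      by (subst nn_integral_eq_integral) (auto simp: has_bochner_integral_iff)
    moreover have "\<sigma> * sqrt (2 / pi) \<le> \<sigma>"
      using \<sigma> pi_ge_two by (intro mult_left_le) auto
    ultimately show ?thesis
      by (simp add: ennreal_mult ennreal_leI)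
  qed
  have "(\<integral>\<^sup>+b. ennreal (norm b) \<partial>(normal.noise :: (real ^ 'd) measure)) =
    (\<integral>\<^sup>+z. ennreal (normal_vec z) * ennreal (norm z) \<partial>(lborel :: (real ^ 'd) measure))"
    unfolding normal.noise_def by (rule nn_integral_density) measurable
  \<comment> \<open>the Euclidean norm is at most the sum of the absolute values, and each summand is again a product over the coordinates\<close>
  also have "\<dots> \<le> (\<integral>\<^sup>+z. (\<Sum>k\<in>UNIV. \<Prod>i\<in>UNIV. ennreal (normal_density 0 \<sigma> (z $ i)) * (if i = k then ennreal \<bar>z $ i\<bar> else 1)) \<partial>(lborel :: (real ^ 'd) measure))"
  proof (rule nn_integral_mono)
    fix z :: "real ^ 'd"
    have "ennreal (normal_vec z) * ennreal (norm z) \<le> ennreal (normal_vec z) * ennreal (\<Sum>k\<in>UNIV. \<bar>z $ k\<bar>)"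
      by (intro mult_left_mono ennreal_leI norm_le_l1_cart) simp
    also have "\<dots> = (\<Sum>k\<in>UNIV. ennreal (normal_vec z) * ennreal \<bar>z $ k\<bar>)"
      by (simp add: sum_ennreal[symmetric] sum_distrib_left del: sum_ennreal)
    also have "\<dots> = (\<Sum>k\<in>UNIV. \<Prod>i\<in>UNIV. ennreal (normal_density 0 \<sigma> (z $ i)) * (if i = k then ennreal \<bar>z $ i\<bar> else 1))"
      by (simp add: prod.distrib normal_vec_def prod_ennreal)
    finally show "ennreal (normal_vec z) * ennreal (norm z) \<le>
      (\<Sum>k\<in>UNIV. \<Prod>i\<in>UNIV. ennreal (normal_density 0 \<sigma> (z $ i)) * (if i = k then ennreal \<bar>z $ i\<bar> else 1))" .
  qed
  also have "\<dots> = (\<Sum>k\<in>UNIV. \<integral>\<^sup>+z. (\<Prod>i\<in>UNIV. ennreal (normal_density 0 \<sigma> (z $ i)) * (if i = k then ennreal \<bar>z $ i\<bar> else 1)) \<partial>(lborel :: (real ^ 'd) measure))"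
    by (rule nn_integral_sum) measurable
  also have "\<dots> = (\<Sum>k\<in>(UNIV :: 'd set). \<Prod>i\<in>UNIV. \<integral>\<^sup>+x. ennreal (normal_density 0 \<sigma> x) * (if i = k then ennreal \<bar>x\<bar> else 1) \<partial>lborel)"
    by (intro sum.cong refl nn_integral_lborel_vec_prod) measurable
  also have "\<dots> \<le> (\<Sum>k\<in>(UNIV :: 'd set). ennreal \<sigma>)"
  proof (rule sum_mono)
    fix k :: 'd
    have "(\<Prod>i\<in>UNIV. \<integral>\<^sup>+x. ennreal (normal_density 0 \<sigma> x) * (if i = k then ennreal \<bar>x\<bar> else 1) \<partial>lborel) =
      (\<Prod>i\<in>UNIV. if i = k then \<integral>\<^sup>+x. ennreal (normal_density 0 \<sigma> x) * ennreal \<bar>x\<bar> \<partial>lborel else 1)"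
      by (intro prod.cong) (auto simp: nn_integral_normal)
    also have "\<dots> \<le> ennreal \<sigma>" using abs_moment by simp
    finally show "(\<Prod>i\<in>UNIV. \<integral>\<^sup>+x. ennreal (normal_density 0 \<sigma> x) * (if i = k then ennreal \<bar>x\<bar> else 1) \<partial>lborel) \<le> ennreal \<sigma>" .
  qed
  also have "\<dots> = ennreal (real CARD('d) * \<sigma>)"
    using \<sigma> by (simp add: ennreal_mult ennreal_of_nat_eq_real_of_nat)
  finally show ?thesis .
qed

text \<open>Disturbing the zero path yields the noise itself, so its law has the likelihood at zero as density.\<close>

lemma gaussian_eq_path_noise: "gaussian T \<sigma> = (normal.path_noise T :: (nat \<Rightarrow> real ^ 'd) measure)"
proof (rule measure_eq_nn_integralI)
  show "sets (gaussian T \<sigma> :: (nat \<Rightarrow> real ^ 'd) measure) = sets (normal.path_noise T :: (nat \<Rightarrow> real ^ 'd) measure)"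
    unfolding gaussian_def by (simp add: normal.sets_lborel_paths del: One_nat_def)
  fix f :: "(nat \<Rightarrow> real ^ 'd) \<Rightarrow> ennreal" assume "f \<in> borel_measurable (normal.path_noise T)"
  then have f: "f \<in> borel_measurable (path_space T)"
    unfolding measurable_cong_sets[OF normal.sets_path_noise refl] .
  let ?\<Lambda> = "PiM {1..T} (\<lambda>_. lborel) :: (nat \<Rightarrow> real ^ 'd) measure"
  have lik: "(\<Prod>t = 1..T. \<Prod>i\<in>UNIV. normal_density 0 \<sigma> (z t $ i)) = normal.likelihood T (\<lambda>_. 0) z" for z :: "nat \<Rightarrow> real ^ 'd"
    by (simp add: normal.likelihood_def normal_vec_def)
  have sp: "(\<lambda>s\<in>{1..T}. 0) \<in> space (path_space T :: (nat \<Rightarrow> real ^ 'd) measure)"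
    by (simp add: path_space_def space_PiM)
  have "(\<lambda>z. normal.likelihood T (\<lambda>s\<in>{1..T}. 0) z) \<in> borel_measurable (path_space T :: (nat \<Rightarrow> real ^ 'd) measure)"
    by (intro normal.likelihood_measurable measurable_const[OF sp] measurable_ident_sets refl)
  also have "normal.likelihood T (\<lambda>s\<in>{1..T}. 0) = normal.likelihood T (\<lambda>_. 0 :: real ^ 'd)"
    by (simp add: normal.likelihood_def[abs_def])
  finally have m: "(\<lambda>z. ennreal (normal.likelihood T (\<lambda>_. 0) z)) \<in> borel_measurable ?\<Lambda>"
    unfolding measurable_cong_sets[OF normal.sets_lborel_paths refl] by measurable
  have f': "f \<in> borel_measurable ?\<Lambda>"
    unfolding measurable_cong_sets[OF normal.sets_lborel_paths refl] by (rule f)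
  have "(\<integral>\<^sup>+z. f z \<partial>gaussian T \<sigma>) = (\<integral>\<^sup>+z. ennreal (normal.likelihood T (\<lambda>_. 0) z) * f z \<partial>?\<Lambda>)"
    unfolding gaussian_def lik by (rule nn_integral_density[OF m f'])
  also have "\<dots> = (\<integral>\<^sup>+z. f (path_add T (\<lambda>_. 0) z) \<partial>normal.path_noise T)"
    by (rule normal.path_noise_translate[OF f, symmetric])
  also have "\<dots> = (\<integral>\<^sup>+z. f z \<partial>normal.path_noise T)"
  proof (intro nn_integral_cong arg_cong[where f=f])
    fix z :: "nat \<Rightarrow> real ^ 'd" assume "z \<in> space (normal.path_noise T)"
    then have "z \<in> space (path_space T)" using sets_eq_imp_space_eq[OF normal.sets_path_noise] by blast
    from path_prefix_id[OF this] show "path_add T (\<lambda>_. 0) z = z"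
      by (simp add: path_add_def)
  qed
  finally show "(\<integral>\<^sup>+z. f z \<partial>gaussian T \<sigma>) = (\<integral>\<^sup>+z. f z \<partial>normal.path_noise T)" .
qed

lemma AW1_gaussian_le:
  fixes \<mu> :: "(nat \<Rightarrow> real ^ 'd) measure"
  assumes \<mu>: "\<mu> \<in> P1 T" and "1 \<le> T" and "0 < L" and lip: "lipschitz_kernels T L \<mu>"
  shows "AW1 T \<mu> (path_convolution T \<mu> (gaussian T \<sigma>)) \<le> ennreal (growth L T * real CARD('d) * \<sigma>)"
proof -
  have prob: "prob_space \<mu>" and sets: "sets \<mu> = sets (path_space T)"
    using \<mu> by (auto simp: P1_def)
  from lip obtain K where K: "\<And>t. t \<in> {1..<T} \<Longrightarrow> path_kernel t \<mu> (K t)"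
    and K_lip: "\<And>t x y. t \<in> {1..<T} \<Longrightarrow> x \<in> space (path_space t) \<Longrightarrow> y \<in> space (path_space t) \<Longrightarrow>
       W1 (K t x) (K t y) \<le> ennreal (L * path_norm t (\<lambda>s. x s - y s))"
    unfolding lipschitz_kernels_def by blast
  define K0 where "K0 n = (if n = 0 then (\<lambda>_. distr \<mu> borel (\<lambda>x. x 1)) else K n)" for n
  have "AW1 T \<mu> (normal.noisy T \<mu>) \<le> ennreal (growth L T * (real CARD('d) * \<sigma>))"
  proof (rule normal.AW1_noisy_le[OF \<mu>])
    show "path_kernel n \<mu> (K0 n)" if "n < T" for n
      using that K[of n] path_kernel_0[OF prob sets \<open>1 \<le> T\<close>] by (auto simp: K0_def)
    show "W1 (K0 n x) (K0 n y) \<le> ennreal (L * path_norm n (\<lambda>s. x s - y s))"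
      if "n < T" "x \<in> space (path_space n)" "y \<in> space (path_space n)" for n x y
      using that K_lip[of n x y] by (auto simp: K0_def W1_self)
    show "(\<integral>\<^sup>+b. ennreal (norm b) \<partial>(normal.noise :: (real ^ 'd) measure)) \<le> ennreal (real CARD('d) * \<sigma>)"
      by (rule normal_first_moment)
  qed (use \<open>0 < L\<close> \<sigma> in auto)
  then show ?thesis by (simp add: gaussian_eq_path_noise mult.assoc)
qed

end

theorem theorem5p1:
  fixes T :: nat and L :: real
  assumes "T \<ge> 1" and "L > 0"
  shows "\<exists>C>0. \<forall>\<mu> \<in> (P1 T :: (nat \<Rightarrow> real ^ 'd) measure set).
           lipschitz_kernels T L \<mu> \<longrightarrow>
           (\<forall>\<sigma>>0. AW1 T \<mu> (path_convolution T \<mu> (gaussian T \<sigma>)) \<le> ennreal (C * \<sigma>))"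
proof (intro exI[of _ "growth L T * real CARD('d)"] conjI ballI allI impI)
  obtain n where "T = Suc n" using \<open>T \<ge> 1\<close> by (cases T) auto
  then have "0 < growth L T"
    using growth_nonneg[of L n] \<open>L > 0\<close> by (auto intro!: add_nonneg_pos)
  then show "0 < growth L T * real CARD('d)" by simp
  fix \<mu> :: "(nat \<Rightarrow> real ^ 'd) measure" and \<sigma> :: real
  assume "\<mu> \<in> P1 T" "lipschitz_kernels T L \<mu>" "\<sigma> > 0"
  then show "AW1 T \<mu> (path_convolution T \<mu> (gaussian T \<sigma>)) \<le> ennreal (growth L T * real CARD('d) * \<sigma>)"
    using assms by (intro AW1_gaussian_le)
qed

end
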